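(* Let $p$ be a prime and let $(G,\theta)$ be a cyclotomically $p$-oriented torsion free Bloch-Kato pro-$p$ group. If $p=2$, assume further that $\mathrm{im}(\theta)\subseteq1+4\mathbb{Z}_2$. Then $\mathrm{Z}_\theta(G)$ is the unique maximal closed abelian normal subgroup of $G$ contained in $\ker(\theta)$.
   Context: A $p$-orientation of a profinite group $G$ is a continuous homomorphism $\theta\colon G\to\mathbb{Z}_p^\times$. For $k\in\mathbb{Z}$, $\mathbb{Z}_p(k)$ is the additive group $\mathbb{Z}_p$ with $G$-action $g\cdot z=\theta(g)^k z$, and $\mathbb{F}_p(k)=\mathbb{Z}_p(k)/p$. The orientation $\theta$ is cyclotomic (and $(G,\theta)$ is cyclotomically $p$-oriented) if for every open subgroup $U\subseteq G$ and all $k,n\ge1$ the natural map $H^k(U,\mathbb{Z}_p(k)/p^n)\to H^k(U,\mathbb{Z}_p(k)/p)$ is surjective. $(G,\theta)$ is Bloch-Kato if for every open subgroup $U$ of $G$ the graded $\mathbb{F}_p$-algebra $\bigoplus_{k\ge0}H^k(U,\mathbb{F}_p(k))$ with cup product is quadratic. A graded $\mathbb{F}_p$-algebra $A=\bigoplus_{k\ge 0}A_k$ is quadratic if the canonical map from the tensor algebra $T(A_1)\to A$ is surjective and its kernel is generated, as a two-sided ideal, by its degree-2 part. The $\theta$-center is $\mathrm{Z}_\theta(G)=\{x\in O_p(\ker\theta)\mid gxg^{-1}=x^{\theta(g)}\ \text{for all } g\in G\}$, where $O_p(\cdot)$ denotes the maximal closed normal pro-$p$ subgroup. *)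

theory Defs
  imports "HOL-Analysis.Function_Topology" "HOL-Analysis.Abstract_Topological_Spaces"
    "HOL-Analysis.Abstract_Limits" "HOL-Computational_Algebra.Primes"
    "HOL-Algebra.Module" "HOL-Algebra.QuotRing"
begin

section \<open>Profinite and pro-p groups\<close>

text \<open>A topological group is a pair of a group \<open>G\<close> and a topology \<open>T\<close> with
  \<open>topspace T = carrier G\<close>; a subgroup \<open>U\<close> is the pair
  \<open>G\<lparr>carrier := U\<rparr>\<close>, \<open>subtopology T U\<close>.\<close>

definition topological_group :: "('a, 'b) monoid_scheme \<Rightarrow> 'a topology \<Rightarrow> bool" where
  "topological_group G T \<longleftrightarrow>
     group G \<and> topspace T = carrier G \<and>
     continuous_map (prod_topology T T) T (\<lambda>(x, y). x \<otimes>\<^bsub>G\<^esub> y) \<and>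
     continuous_map T T (\<lambda>x. inv\<^bsub>G\<^esub> x)"

definition totally_disconnected_space :: "'a topology \<Rightarrow> bool" where
  "totally_disconnected_space T \<longleftrightarrow> (\<forall>S. connectedin T S \<longrightarrow> (\<exists>a. S \<subseteq> {a}))"

definition profinite_group :: "('a, 'b) monoid_scheme \<Rightarrow> 'a topology \<Rightarrow> bool" where
  "profinite_group G T \<longleftrightarrow>
     topological_group G T \<and> compact_space T \<and> Hausdorff_space T \<and> totally_disconnected_space T"

definition pro_p_group :: "nat \<Rightarrow> ('a, 'b) monoid_scheme \<Rightarrow> 'a topology \<Rightarrow> bool" where
  "pro_p_group p G T \<longleftrightarrow>
     profinite_group G T \<and> (\<forall>N. N \<lhd> G \<and> openin T N \<longrightarrow> (\<exists>m. Coset.order (G Mod N) = p ^ m))"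

definition torsion_free_group :: "('a, 'b) monoid_scheme \<Rightarrow> bool" where
  "torsion_free_group G \<longleftrightarrow>
     (\<forall>x\<in>carrier G. \<forall>n::nat. 0 < n \<and> x [^]\<^bsub>G\<^esub> n = \<one>\<^bsub>G\<^esub> \<longrightarrow> x = \<one>\<^bsub>G\<^esub>)"

definition closed_normal_pro_p :: "nat \<Rightarrow> ('a, 'b) monoid_scheme \<Rightarrow> 'a topology \<Rightarrow> 'a set \<Rightarrow> bool" where
  "closed_normal_pro_p p G T N \<longleftrightarrow>
     closedin T N \<and> N \<lhd> G \<and> pro_p_group p (G\<lparr>carrier := N\<rparr>) (subtopology T N)"

definition p_core :: "nat \<Rightarrow> ('a, 'b) monoid_scheme \<Rightarrow> 'a topology \<Rightarrow> 'a set" where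
  "p_core p G T =
     (THE N. closed_normal_pro_p p G T N \<and> (\<forall>M. closed_normal_pro_p p G T M \<longrightarrow> M \<subseteq> N))"


section \<open>The p-adic integers\<close>

text \<open>\<open>\<int>\<^sub>p\<close> is the inverse limit of the rings \<open>\<int>/p\<^sup>n\<close>: an element is the sequence of its
  reductions modulo \<open>p\<^sup>n\<close>, each represented by its least non-negative residue.\<close>

definition padic_int :: "nat \<Rightarrow> (nat \<Rightarrow> int) ring" where
  "padic_int p =
     \<lparr>carrier = {x. \<forall>n. 0 \<le> x n \<and> x n < int p ^ n \<and> x (Suc n) mod int p ^ n = x n},
      mult = (\<lambda>x y n. (x n * y n) mod int p ^ n),
      one = (\<lambda>n. 1 mod int p ^ n),
      zero = (\<lambda>n. 0),
      add = (\<lambda>x y n. (x n + y n) mod int p ^ n)\<rparr>"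

definition padic_topology :: "nat \<Rightarrow> (nat \<Rightarrow> int) topology" where
  "padic_topology p =
     subtopology (product_topology (\<lambda>n. discrete_topology UNIV) UNIV) (carrier (padic_int p))"

definition padic_units :: "nat \<Rightarrow> (nat \<Rightarrow> int) monoid" where
  "padic_units p = units_of (padic_int p)"

text \<open>The power \<open>x\<^sup>z\<close> of an element \<open>x\<close> of a pro-p group, \<open>z\<close> a p-adic integer: the limit of
  the powers of \<open>x\<close> with integer exponents converging to \<open>z\<close>.\<close>

definition padic_power :: "('a, 'b) monoid_scheme \<Rightarrow> 'a topology \<Rightarrow> 'a \<Rightarrow> (nat \<Rightarrow> int) \<Rightarrow> 'a" where
  "padic_power G T x z = (THE y. limitin T (\<lambda>n. x [^]\<^bsub>G\<^esub> z n) y sequentially)"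


section \<open>Continuous cohomology with discrete coefficients\<close>

text \<open>Cohomology is computed by continuous inhomogeneous cochains. A \<open>k\<close>-tuple of group elements
  is an element of \<open>{..<k} \<rightarrow>\<^sub>E carrier G\<close>. The coefficient module is the additive group of \<open>M\<close>
  with the discrete topology, on which \<open>G\<close> acts by \<open>act\<close>. Cochain groups and cohomology groups
  are abelian groups written multiplicatively.\<close>

definition cochains ::
  "('a, 'b) monoid_scheme \<Rightarrow> 'a topology \<Rightarrow> ('m, 'c) ring_scheme \<Rightarrow> nat \<Rightarrow> ((nat \<Rightarrow> 'a) \<Rightarrow> 'm) monoid" where
  "cochains G T M k =
     \<lparr>carrier = {c \<in> extensional ({..<k} \<rightarrow>\<^sub>E carrier G).
        continuous_map (product_topology (\<lambda>i. T) {..<k}) (discrete_topology (carrier M)) c},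
      mult = (\<lambda>c d. \<lambda>g\<in>{..<k} \<rightarrow>\<^sub>E carrier G. c g \<oplus>\<^bsub>M\<^esub> d g),
      one = (\<lambda>g\<in>{..<k} \<rightarrow>\<^sub>E carrier G. \<zero>\<^bsub>M\<^esub>)\<rparr>"

definition merge_at :: "('a, 'b) monoid_scheme \<Rightarrow> nat \<Rightarrow> nat \<Rightarrow> (nat \<Rightarrow> 'a) \<Rightarrow> nat \<Rightarrow> 'a" where
  "merge_at G k i g =
     (\<lambda>j\<in>{..<k}. if j < i then g j else if j = i then g i \<otimes>\<^bsub>G\<^esub> g (Suc i) else g (Suc j))"

definition coboundary_map ::
  "('a, 'b) monoid_scheme \<Rightarrow> ('m, 'c) ring_scheme \<Rightarrow> ('a \<Rightarrow> 'm \<Rightarrow> 'm) \<Rightarrow> nat \<Rightarrow>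
     ((nat \<Rightarrow> 'a) \<Rightarrow> 'm) \<Rightarrow> ((nat \<Rightarrow> 'a) \<Rightarrow> 'm)" where
  "coboundary_map G M act k c =
     (\<lambda>g\<in>{..<Suc k} \<rightarrow>\<^sub>E carrier G.
        act (g 0) (c (\<lambda>j\<in>{..<k}. g (Suc j)))
        \<oplus>\<^bsub>M\<^esub> (\<Oplus>\<^bsub>M\<^esub>i\<in>{..<k}. [((- 1 :: int) ^ (i + 1))] \<cdot>\<^bsub>M\<^esub> c (merge_at G k i g))
        \<oplus>\<^bsub>M\<^esub> [((- 1 :: int) ^ (k + 1))] \<cdot>\<^bsub>M\<^esub> c (restrict g {..<k}))"

definition cocycles ::
  "('a, 'b) monoid_scheme \<Rightarrow> 'a topology \<Rightarrow> ('m, 'c) ring_scheme \<Rightarrow> ('a \<Rightarrow> 'm \<Rightarrow> 'm) \<Rightarrow> nat \<Rightarrow>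
     ((nat \<Rightarrow> 'a) \<Rightarrow> 'm) set" where
  "cocycles G T M act k =
     {c \<in> carrier (cochains G T M k). coboundary_map G M act k c = \<one>\<^bsub>cochains G T M (Suc k)\<^esub>}"

definition coboundaries ::
  "('a, 'b) monoid_scheme \<Rightarrow> 'a topology \<Rightarrow> ('m, 'c) ring_scheme \<Rightarrow> ('a \<Rightarrow> 'm \<Rightarrow> 'm) \<Rightarrow> nat \<Rightarrow>
     ((nat \<Rightarrow> 'a) \<Rightarrow> 'm) set" where
  "coboundaries G T M act k =
     (case k of 0 \<Rightarrow> {\<one>\<^bsub>cochains G T M 0\<^esub>}
      | Suc j \<Rightarrow> coboundary_map G M act j ` carrier (cochains G T M j))"

definition cohomology ::
  "('a, 'b) monoid_scheme \<Rightarrow> 'a topology \<Rightarrow> ('m, 'c) ring_scheme \<Rightarrow> ('a \<Rightarrow> 'm \<Rightarrow> 'm) \<Rightarrow> nat \<Rightarrow>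
     ((nat \<Rightarrow> 'a) \<Rightarrow> 'm) set monoid" where
  "cohomology G T M act k =
     ((cochains G T M k)\<lparr>carrier := cocycles G T M act k\<rparr>) Mod (coboundaries G T M act k)"

definition cohomology_class ::
  "('a, 'b) monoid_scheme \<Rightarrow> 'a topology \<Rightarrow> ('m, 'c) ring_scheme \<Rightarrow> ('a \<Rightarrow> 'm \<Rightarrow> 'm) \<Rightarrow> nat \<Rightarrow>
     ((nat \<Rightarrow> 'a) \<Rightarrow> 'm) \<Rightarrow> ((nat \<Rightarrow> 'a) \<Rightarrow> 'm) set" where
  "cohomology_class G T M act k c = coboundaries G T M act k #>\<^bsub>cochains G T M k\<^esub> c"

text \<open>The map into \<open>H\<^sup>k(G, N)\<close>, \<open>N\<close> with action \<open>act\<close>, induced by an equivariant map \<open>f\<close> from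
  some coefficient module to \<open>N\<close>. As for \<^const>\<open>rcoset_mult\<close>, the union is over all
  representatives, which all give the same class.\<close>

definition cohomology_map ::
  "('a, 'b) monoid_scheme \<Rightarrow> 'a topology \<Rightarrow> ('n, 'd) ring_scheme \<Rightarrow> ('a \<Rightarrow> 'n \<Rightarrow> 'n) \<Rightarrow> nat \<Rightarrow>
     ('m \<Rightarrow> 'n) \<Rightarrow> ((nat \<Rightarrow> 'a) \<Rightarrow> 'm) set \<Rightarrow> ((nat \<Rightarrow> 'a) \<Rightarrow> 'n) set" where
  "cohomology_map G T N act k f X =
     (\<Union>c\<in>X. cohomology_class G T N act k (\<lambda>g\<in>{..<k} \<rightarrow>\<^sub>E carrier G. f (c g)))"


section \<open>Orientations and Tate twists\<close>

definition p_orientation ::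
  "nat \<Rightarrow> ('a, 'b) monoid_scheme \<Rightarrow> 'a topology \<Rightarrow> ('a \<Rightarrow> nat \<Rightarrow> int) \<Rightarrow> bool" where
  "p_orientation p G T \<theta> \<longleftrightarrow>
     \<theta> \<in> hom G (padic_units p) \<and> continuous_map T (padic_topology p) \<theta>"

definition tate_action :: "nat \<Rightarrow> ('a \<Rightarrow> nat \<Rightarrow> int) \<Rightarrow> int \<Rightarrow> 'a \<Rightarrow> (nat \<Rightarrow> int) \<Rightarrow> (nat \<Rightarrow> int)" where
  "tate_action p \<theta> k g z = (\<theta> g [^]\<^bsub>padic_units p\<^esub> k) \<otimes>\<^bsub>padic_int p\<^esub> z"

definition padic_power_ideal :: "nat \<Rightarrow> nat \<Rightarrow> (nat \<Rightarrow> int) set" where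
  "padic_power_ideal p n = PIdl\<^bsub>padic_int p\<^esub> ([(p ^ n)] \<cdot>\<^bsub>padic_int p\<^esub> \<one>\<^bsub>padic_int p\<^esub>)"

definition padic_quot :: "nat \<Rightarrow> nat \<Rightarrow> (nat \<Rightarrow> int) set ring" where
  "padic_quot p n = padic_int p Quot padic_power_ideal p n"

text \<open>The action that \<open>\<int>\<^sub>p(k)/p\<^sup>n\<close> inherits from \<open>\<int>\<^sub>p(k)\<close>: multiplication by a unit maps
  cosets of \<open>p\<^sup>n\<int>\<^sub>p\<close> onto cosets.\<close>

definition tate_quot_action ::
  "nat \<Rightarrow> ('a \<Rightarrow> nat \<Rightarrow> int) \<Rightarrow> int \<Rightarrow> 'a \<Rightarrow> (nat \<Rightarrow> int) set \<Rightarrow> (nat \<Rightarrow> int) set" where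
  "tate_quot_action p \<theta> k g C = tate_action p \<theta> k g ` C"

definition padic_reduction :: "nat \<Rightarrow> (nat \<Rightarrow> int) set \<Rightarrow> (nat \<Rightarrow> int) set" where
  "padic_reduction p C = padic_power_ideal p 1 <+>\<^bsub>padic_int p\<^esub> C"

definition cyclotomic ::
  "nat \<Rightarrow> ('a, 'b) monoid_scheme \<Rightarrow> 'a topology \<Rightarrow> ('a \<Rightarrow> nat \<Rightarrow> int) \<Rightarrow> bool" where
  "cyclotomic p G T \<theta> \<longleftrightarrow>
     (\<forall>U k n. subgroup U G \<and> openin T U \<and> 1 \<le> k \<and> 1 \<le> n \<longrightarrow>
        cohomology_map (G\<lparr>carrier := U\<rparr>) (subtopology T U)
            (padic_quot p 1) (tate_quot_action p \<theta> (int k)) k (padic_reduction p)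
          ` carrier (cohomology (G\<lparr>carrier := U\<rparr>) (subtopology T U)
              (padic_quot p n) (tate_quot_action p \<theta> (int k)) k)
        = carrier (cohomology (G\<lparr>carrier := U\<rparr>) (subtopology T U)
              (padic_quot p 1) (tate_quot_action p \<theta> (int k)) k))"

definition theta_center ::
  "nat \<Rightarrow> ('a, 'b) monoid_scheme \<Rightarrow> 'a topology \<Rightarrow> ('a \<Rightarrow> nat \<Rightarrow> int) \<Rightarrow> 'a set" where
  "theta_center p G T \<theta> =
     {x \<in> p_core p (G\<lparr>carrier := kernel G (padic_units p) \<theta>\<rparr>)
            (subtopology T (kernel G (padic_units p) \<theta>)).
        \<forall>g\<in>carrier G. g \<otimes>\<^bsub>G\<^esub> x \<otimes>\<^bsub>G\<^esub> inv\<^bsub>G\<^esub> g = padic_power G T x (\<theta> g)}"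


section \<open>Quadratic algebras\<close>

text \<open>The free associative \<open>K\<close>-algebra on a set \<open>X\<close>: finitely supported \<open>K\<close>-valued functions on
  the words over \<open>X\<close>, with the convolution product.\<close>

definition free_algebra :: "('k, 'c) ring_scheme \<Rightarrow> 'v set \<Rightarrow> ('v list \<Rightarrow> 'k) ring" where
  "free_algebra K X =
     \<lparr>carrier = {f. (\<forall>w. f w \<in> carrier K) \<and> finite {w. f w \<noteq> \<zero>\<^bsub>K\<^esub>} \<and>
        (\<forall>w. w \<notin> lists X \<longrightarrow> f w = \<zero>\<^bsub>K\<^esub>)},
      mult = (\<lambda>f h w. \<Oplus>\<^bsub>K\<^esub>i\<in>{..length w}. f (take i w) \<otimes>\<^bsub>K\<^esub> h (drop i w)),
      one = (\<lambda>w. if w = [] then \<one>\<^bsub>K\<^esub> else \<zero>\<^bsub>K\<^esub>),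
      zero = (\<lambda>w. \<zero>\<^bsub>K\<^esub>),
      add = (\<lambda>f h w. f w \<oplus>\<^bsub>K\<^esub> h w)\<rparr>"

definition monomial :: "('k, 'c) ring_scheme \<Rightarrow> 'k \<Rightarrow> 'v list \<Rightarrow> ('v list \<Rightarrow> 'k)" where
  "monomial K a u = (\<lambda>w. if w = u then a else \<zero>\<^bsub>K\<^esub>)"

text \<open>The tensor algebra of a \<open>K\<close>-module \<open>V\<close> is the free algebra on the set \<open>V\<close> modulo the
  relations expressing that the inclusion of \<open>V\<close> is \<open>K\<close>-linear.\<close>

definition tensor_relations ::
  "('k, 'c) ring_scheme \<Rightarrow> ('k, 'v, 'd) module_scheme \<Rightarrow> ('v list \<Rightarrow> 'k) set" where
  "tensor_relations K V =
     {monomial K \<one>\<^bsub>K\<^esub> [v \<oplus>\<^bsub>V\<^esub> w]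
        \<ominus>\<^bsub>free_algebra K (carrier V)\<^esub>
        (monomial K \<one>\<^bsub>K\<^esub> [v] \<oplus>\<^bsub>free_algebra K (carrier V)\<^esub> monomial K \<one>\<^bsub>K\<^esub> [w])
      | v w. v \<in> carrier V \<and> w \<in> carrier V} \<union>
     {monomial K \<one>\<^bsub>K\<^esub> [a \<odot>\<^bsub>V\<^esub> v] \<ominus>\<^bsub>free_algebra K (carrier V)\<^esub> monomial K a [v]
      | a v. a \<in> carrier K \<and> v \<in> carrier V}"

definition tensor_ideal ::
  "('k, 'c) ring_scheme \<Rightarrow> ('k, 'v, 'd) module_scheme \<Rightarrow> ('v list \<Rightarrow> 'k) set" where
  "tensor_ideal K V = Idl\<^bsub>free_algebra K (carrier V)\<^esub> (tensor_relations K V)"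

definition tensor_algebra ::
  "('k, 'c) ring_scheme \<Rightarrow> ('k, 'v, 'd) module_scheme \<Rightarrow> ('v list \<Rightarrow> 'k) set ring" where
  "tensor_algebra K V = free_algebra K (carrier V) Quot tensor_ideal K V"

definition tensor_degree ::
  "('k, 'c) ring_scheme \<Rightarrow> ('k, 'v, 'd) module_scheme \<Rightarrow> nat \<Rightarrow> ('v list \<Rightarrow> 'k) set set" where
  "tensor_degree K V n =
     (\<lambda>f. tensor_ideal K V +>\<^bsub>free_algebra K (carrier V)\<^esub> f) `
       {f \<in> carrier (free_algebra K (carrier V)). \<forall>w. f w \<noteq> \<zero>\<^bsub>K\<^esub> \<longrightarrow> length w = n}"

text \<open>A record of type \<^type>\<open>module_ext\<close> carries a multiplication besides its scalar
  multiplication, so it describes a (not necessarily commutative) \<open>K\<close>-algebra.\<close>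

definition free_algebra_eval ::
  "('k, 'c) ring_scheme \<Rightarrow> ('k, 'v, 'd) module_scheme \<Rightarrow> ('v list \<Rightarrow> 'k) \<Rightarrow> 'v" where
  "free_algebra_eval K A f =
     (\<Oplus>\<^bsub>A\<^esub>w\<in>{w. f w \<noteq> \<zero>\<^bsub>K\<^esub>}. f w \<odot>\<^bsub>A\<^esub> foldr (\<otimes>\<^bsub>A\<^esub>) w \<one>\<^bsub>A\<^esub>)"

definition tensor_canonical ::
  "('k, 'c) ring_scheme \<Rightarrow> ('k, 'v, 'd) module_scheme \<Rightarrow> ('v list \<Rightarrow> 'k) set \<Rightarrow> 'v" where
  "tensor_canonical K A C = the_elem (free_algebra_eval K A ` C)"

text \<open>\<open>A\<close> is an algebra over \<open>K\<close> with homogeneous components \<open>gr k\<close>. The constants of the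
  tensor algebra are in its carrier, so its ring ideals are the same as its algebra ideals.\<close>

definition quadratic_algebra ::
  "('k, 'c) ring_scheme \<Rightarrow> ('k, 'v, 'd) module_scheme \<Rightarrow> (nat \<Rightarrow> 'v set) \<Rightarrow> bool" where
  "quadratic_algebra K A gr \<longleftrightarrow>
     (let V = A\<lparr>carrier := gr 1\<rparr>;
          S = tensor_algebra K V;
          N = a_kernel S A (tensor_canonical K A)
      in tensor_canonical K A ` carrier S = carrier A \<and>
         N = Idl\<^bsub>S\<^esub> (N \<inter> tensor_degree K V 2))"


section \<open>The cohomology algebra and the Bloch-Kato property\<close>

definition tate_cohomology ::
  "nat \<Rightarrow> ('a, 'b) monoid_scheme \<Rightarrow> 'a topology \<Rightarrow> ('a \<Rightarrow> nat \<Rightarrow> int) \<Rightarrow> nat \<Rightarrow>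
     ((nat \<Rightarrow> 'a) \<Rightarrow> (nat \<Rightarrow> int) set) set monoid" where
  "tate_cohomology p G T \<theta> k =
     cohomology G T (padic_quot p 1) (tate_quot_action p \<theta> (int k)) k"

definition tate_class ::
  "nat \<Rightarrow> ('a, 'b) monoid_scheme \<Rightarrow> 'a topology \<Rightarrow> ('a \<Rightarrow> nat \<Rightarrow> int) \<Rightarrow> nat \<Rightarrow>
     ((nat \<Rightarrow> 'a) \<Rightarrow> (nat \<Rightarrow> int) set) \<Rightarrow> ((nat \<Rightarrow> 'a) \<Rightarrow> (nat \<Rightarrow> int) set) set" where
  "tate_class p G T \<theta> k =
     cohomology_class G T (padic_quot p 1) (tate_quot_action p \<theta> (int k)) k"

text \<open>The cup product of cochains,
  \<open>(a \<union> b)(g\<^sub>0,\<dots>,g\<^bsub>k+l-1\<^esub>) = a(g\<^sub>0,\<dots>,g\<^bsub>k-1\<^esub>) \<cdot> (g\<^sub>0\<cdots>g\<^bsub>k-1\<^esub>) b(g\<^sub>k,\<dots>,g\<^bsub>k+l-1\<^esub>)\<close>,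
  for the pairing \<open>\<F>\<^sub>p(k) \<times> \<F>\<^sub>p(l) \<rightarrow> \<F>\<^sub>p(k+l)\<close> given by multiplication in \<open>\<F>\<^sub>p\<close>.\<close>

definition cochain_cup ::
  "nat \<Rightarrow> ('a, 'b) monoid_scheme \<Rightarrow> ('a \<Rightarrow> nat \<Rightarrow> int) \<Rightarrow> nat \<Rightarrow> nat \<Rightarrow>
     ((nat \<Rightarrow> 'a) \<Rightarrow> (nat \<Rightarrow> int) set) \<Rightarrow> ((nat \<Rightarrow> 'a) \<Rightarrow> (nat \<Rightarrow> int) set) \<Rightarrow>
     ((nat \<Rightarrow> 'a) \<Rightarrow> (nat \<Rightarrow> int) set)" where
  "cochain_cup p G \<theta> k l a b =
     (\<lambda>g\<in>{..<k + l} \<rightarrow>\<^sub>E carrier G.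
        a (restrict g {..<k}) \<otimes>\<^bsub>padic_quot p 1\<^esub>
        tate_quot_action p \<theta> (int l) (foldr (\<lambda>i x. g i \<otimes>\<^bsub>G\<^esub> x) [0..<k] \<one>\<^bsub>G\<^esub>)
          (b (\<lambda>j\<in>{..<l}. g (k + j))))"

definition tate_cup ::
  "nat \<Rightarrow> ('a, 'b) monoid_scheme \<Rightarrow> 'a topology \<Rightarrow> ('a \<Rightarrow> nat \<Rightarrow> int) \<Rightarrow> nat \<Rightarrow> nat \<Rightarrow>
     ((nat \<Rightarrow> 'a) \<Rightarrow> (nat \<Rightarrow> int) set) set \<Rightarrow> ((nat \<Rightarrow> 'a) \<Rightarrow> (nat \<Rightarrow> int) set) set \<Rightarrow>
     ((nat \<Rightarrow> 'a) \<Rightarrow> (nat \<Rightarrow> int) set) set" where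
  "tate_cup p G T \<theta> k l X Y =
     (\<Union>a\<in>X. \<Union>b\<in>Y. tate_class p G T \<theta> (k + l) (cochain_cup p G \<theta> k l a b))"

definition tate_scale ::
  "nat \<Rightarrow> ('a, 'b) monoid_scheme \<Rightarrow> 'a topology \<Rightarrow> ('a \<Rightarrow> nat \<Rightarrow> int) \<Rightarrow> nat \<Rightarrow> (nat \<Rightarrow> int) set \<Rightarrow>
     ((nat \<Rightarrow> 'a) \<Rightarrow> (nat \<Rightarrow> int) set) set \<Rightarrow> ((nat \<Rightarrow> 'a) \<Rightarrow> (nat \<Rightarrow> int) set) set" where
  "tate_scale p G T \<theta> k s X =
     (\<Union>a\<in>X. tate_class p G T \<theta> k (\<lambda>g\<in>{..<k} \<rightarrow>\<^sub>E carrier G. s \<otimes>\<^bsub>padic_quot p 1\<^esub> a g))"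

text \<open>The direct sum of the groups \<open>H\<^sup>k(G, \<F>\<^sub>p(k))\<close>, as an algebra over \<open>\<F>\<^sub>p = \<int>\<^sub>p/p\<close>.\<close>

definition cohomology_algebra ::
  "nat \<Rightarrow> ('a, 'b) monoid_scheme \<Rightarrow> 'a topology \<Rightarrow> ('a \<Rightarrow> nat \<Rightarrow> int) \<Rightarrow>
     ((nat \<Rightarrow> int) set, nat \<Rightarrow> ((nat \<Rightarrow> 'a) \<Rightarrow> (nat \<Rightarrow> int) set) set) module" where
  "cohomology_algebra p G T \<theta> =
     \<lparr>carrier = {x. (\<forall>k. x k \<in> carrier (tate_cohomology p G T \<theta> k)) \<and>
        finite {k. x k \<noteq> \<one>\<^bsub>tate_cohomology p G T \<theta> k\<^esub>}},
      mult = (\<lambda>x y n. \<Otimes>\<^bsub>tate_cohomology p G T \<theta> n\<^esub>i\<in>{..n}. tate_cup p G T \<theta> i (n - i) (x i) (y (n - i))),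
      one = (\<lambda>k. if k = 0
         then tate_class p G T \<theta> 0 (\<lambda>g\<in>{..<0} \<rightarrow>\<^sub>E carrier G. \<one>\<^bsub>padic_quot p 1\<^esub>)
         else \<one>\<^bsub>tate_cohomology p G T \<theta> k\<^esub>),
      zero = (\<lambda>k. \<one>\<^bsub>tate_cohomology p G T \<theta> k\<^esub>),
      add = (\<lambda>x y k. x k \<otimes>\<^bsub>tate_cohomology p G T \<theta> k\<^esub> y k),
      smult = (\<lambda>s x k. tate_scale p G T \<theta> k s (x k))\<rparr>"

definition cohomology_degree ::
  "nat \<Rightarrow> ('a, 'b) monoid_scheme \<Rightarrow> 'a topology \<Rightarrow> ('a \<Rightarrow> nat \<Rightarrow> int) \<Rightarrow> nat \<Rightarrow>
     (nat \<Rightarrow> ((nat \<Rightarrow> 'a) \<Rightarrow> (nat \<Rightarrow> int) set) set) set" where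
  "cohomology_degree p G T \<theta> n =
     {x \<in> carrier (cohomology_algebra p G T \<theta>). \<forall>k. k \<noteq> n \<longrightarrow> x k = \<one>\<^bsub>tate_cohomology p G T \<theta> k\<^esub>}"

definition bloch_kato ::
  "nat \<Rightarrow> ('a, 'b) monoid_scheme \<Rightarrow> 'a topology \<Rightarrow> ('a \<Rightarrow> nat \<Rightarrow> int) \<Rightarrow> bool" where
  "bloch_kato p G T \<theta> \<longleftrightarrow>
     (\<forall>U. subgroup U G \<and> openin T U \<longrightarrow>
        quadratic_algebra (padic_quot p 1)
          (cohomology_algebra p (G\<lparr>carrier := U\<rparr>) (subtopology T U) \<theta>)
          (cohomology_degree p (G\<lparr>carrier := U\<rparr>) (subtopology T U) \<theta>))"


section \<open>Abelian normal subgroups in the kernel\<close>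

definition closed_abelian_normal_in ::
  "('a, 'b) monoid_scheme \<Rightarrow> 'a topology \<Rightarrow> 'a set \<Rightarrow> 'a set set" where
  "closed_abelian_normal_in G T H =
     {A. closedin T A \<and> A \<lhd> G \<and> comm_group (G\<lparr>carrier := A\<rparr>) \<and> A \<subseteq> H}"

end

theory Submission
  imports Defs "HOL-Algebra.Group_Action" "HOL-Algebra.Sylow" "HOL-Algebra.Multiplicative_Group"
    "HOL-Algebra.Generated_Groups" "HOL-Number_Theory.Residues"
begin

text \<open>Let \<open>A\<close> be a closed
  abelian normal subgroup in the kernel of \<open>\<theta>\<close>, \<open>z \<in> A\<close> and \<open>g \<in> G\<close>; put \<open>w = g z g\<^sup>-\<^sup>1 z\<^sup>-\<^sup>\<theta>\<^sup>(\<^sup>g\<^sup>)\<close>.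
  A crossed homomorphism \<open>c\<close> into \<open>\<int>\<^sub>p(1)/p\<^sup>n\<close> on an open subgroup containing \<open>g\<close>, \<open>w\<close> and \<open>z\<^sup>q\<close>,
  where \<open>q = p\<^sup>m\<close>, kills \<open>w\<^sup>q = g z\<^sup>q g\<^sup>-\<^sup>1 z\<^sup>-\<^sup>q\<^sup>\<theta>\<^sup>(\<^sup>g\<^sup>)\<close>, so \<open>q c(w) = 0\<close>; for \<open>n > m\<close> the reduction of
  \<open>c\<close> modulo \<open>p\<close> kills \<open>w\<close>. As every homomorphism to \<open>\<F>\<^sub>p\<close> lifts to such a \<open>c\<close>, \<open>w\<close> lies in the
  Frattini subgroup of every open subgroup containing \<open>g\<close> and \<open>w\<close>, hence in the closure of the group
  generated by \<open>g\<close>, say \<open>w = g\<^sup>\<lambda>\<close>. Since \<open>\<theta>(w) = 1\<close>, either \<open>\<lambda> = 0\<close>, because the image of \<open>\<theta>\<close> is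
  torsion free, or \<open>\<theta>(g) = 1\<close>. In the latter case \<open>w = [g, z]\<close> commutes with \<open>g\<close> and \<open>z\<close>, so
  \<open>w\<^sup>\<lambda> = [g\<^sup>\<lambda>, z] = [w, z] = 1\<close>, and \<open>w = 1\<close> as \<open>G\<close> is torsion free.\<close>

text \<open>The obstacle is that \<open>c\<close> is defined only on an open subgroup
  \<open>U\<close>, and \<open>z\<close> need not lie in it. Hence the detour through
  \<open>q\<close>-th powers: \<open>q\<close> kills the finite quotient \<open>G/N\<close> in
  question, so \<open>z^q\<close> lies in \<open>N\<close> and therefore in \<open>U\<close>. The
  detour costs a factor \<open>q\<close>, which is recovered by lifting one power of p further than
  \<open>q\<close>. That \<open>c\<close> kills \<open>g z^q g^-1 z^(-q \<theta>(g))\<close> comes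
  from the two rules \<open>c(u g) = c(u) + c(g)\<close>, for \<open>u\<close> in the kernel of
  \<theta>, and \<open>c(g y) = c(g) + \<theta>(g) c(y)\<close>. Applied to \<open>u g = g y\<close>
  they show that conjugation by \<open>g\<close> multiplies \<open>c\<close> by \<theta>(g) on the
  kernel, which is also what raising to the power \<theta>(g) does. The exponent \<lambda> is never
  formed. Each open normal \<open>N\<close> supplies natural numbers \<open>l\<close> with
  \<open>w\<close> congruent to \<open>g^l\<close> modulo \<open>N\<close>, and "\<lambda> = 0" is
  expressed by saying that all such \<open>l\<close> are divisible by any prescribed power of p once
  \<open>N\<close> is small enough. The condition at p = 2 excludes the torsion unit -1, which is
  congruent to 1 modulo 2.\<close>

section \<open>Finite p-groups\<close>

text \<open>If \<open>V\<close> were its own normalizer, it would have exactly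
  \<open>|G : V|\<close> conjugates, and \<open>V\<close> would be the only one fixed under
  conjugation by \<open>V\<close>. Their number would be 1 modulo p and also a power of p, hence 1,
  so \<open>V\<close> would be the whole group.\<close>

lemma (in group) finite_p_group_normalizer_grows:
  assumes p: "prime p" and Q: "order G = p ^ m"
    and V: "subgroup V G" and ne: "V \<noteq> carrier G"
  shows "\<exists>x\<in>carrier G - V. x <# V #> inv x = V"
proof (rule ccontr)
  assume "\<not> ?thesis"
  then have nV: "\<And>x. x \<in> carrier G \<Longrightarrow> x <# V #> inv x = V \<Longrightarrow> x \<in> V" by blast
  have fin: "finite (carrier G)"
    using Q p by (metis card.infinite order_def power_not_zero not_prime_0)
  define E where "E = {H. subgroup H G}"
  define \<phi> where "\<phi> = (\<lambda>g. \<lambda>H\<in>E. g <# H #> inv g)"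
  interpret A: group_action G E \<phi>
    unfolding E_def \<phi>_def by (rule action_by_conjugation_on_subgroups_set)
  interpret B: group_action "G\<lparr>carrier := V\<rparr>" E \<phi>
    by (rule A.induced_action[OF V])
  have finE: "finite E"
    by (rule finite_subset[of _ "Pow (carrier G)"]) (auto simp: E_def fin dest: subgroup.subset)
  have VE: "V \<in> E" using V by (simp add: E_def)
  define Orb where "Orb = orbit G \<phi> V"
  have OrbE: "Orb \<subseteq> E"
    unfolding Orb_def orbit_def using A.element_image VE by auto
  have Vfix: "\<phi> v V = V" if "v \<in> V" for v
    using that V VE subgroup.mem_carrier[OF V that] subgroup.m_inv_closed[OF V that]
    unfolding \<phi>_def by (simp add: coset_join3 coset_join2)
  have "stabilizer G \<phi> V = V"
    unfolding stabilizer_def using nV Vfix V VE by (auto simp: \<phi>_def dest: subgroup.mem_carrier)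
  then have cO: "card Orb * card V = p ^ m"
    using A.orbit_stabilizer_theorem[OF VE] Q by (simp add: Orb_def)
  \<comment> \<open>A \<open>V\<close>-orbit lies inside \<open>Orb\<close> or misses it, and its
    size is a power of p; so modulo p only the fixed point \<open>V\<close> is counted. The
    indicator cuts the action on all subgroups down to the conjugates of \<open>V\<close>.\<close>
  have contrib: "(\<Sum>W\<in>orb. if W \<in> Orb then 1 else 0) mod p = (if orb = {V} then 1 else (0::nat))"
    if "orb \<in> orbits (G\<lparr>carrier := V\<rparr>) E \<phi>" for orb
  proof -
    obtain W where WE: "W \<in> E" and orb: "orb = orbit (G\<lparr>carrier := V\<rparr>) \<phi> W"
      using \<open>orb \<in> _\<close> by (auto simp: orbits_def)
    have Worb: "W \<in> orb"
      unfolding orb using B.orbit_refl[OF WE] .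
    have orb_sub: "orb \<subseteq> orbit G \<phi> W"
      unfolding orb orbit_def using V subgroup.mem_carrier by fastforce
    have orbE: "orb \<subseteq> E" using orb_sub A.element_image[OF _ WE] by (auto simp: orbit_def)
    have finorb: "finite orb" using orbE finE finite_subset by blast
    have same: "X \<in> Orb \<longleftrightarrow> W \<in> Orb" if "X \<in> orb" for X
    proof -
      have XE: "X \<in> E" and XW: "X \<in> orbit G \<phi> W" using that orbE orb_sub by auto
      have WX: "W \<in> orbit G \<phi> X" by (rule A.orbit_sym[OF WE XE XW])
      show ?thesis unfolding Orb_def
        using A.orbit_trans[OF VE WE XE _ XW] A.orbit_trans[OF VE XE WE _ WX] by blast
    qed
    have "(\<Sum>X\<in>orb. if X \<in> Orb then 1 else 0) = (\<Sum>X\<in>orb. if W \<in> Orb then 1 else (0::nat))"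
      by (intro sum.cong refl if_cong same)
    then have S: "(\<Sum>X\<in>orb. if X \<in> Orb then 1 else 0) = (if W \<in> Orb then card orb else 0)"
      by simp
    have "card orb dvd card V"
      using B.orbit_stabilizer_theorem[OF WE] unfolding orb order_def
      by (intro dvdI[of _ _ "card (stabilizer (G\<lparr>carrier := V\<rparr>) \<phi> W)"]) simp
    also have "card V dvd p ^ m" using cO by (metis dvd_triv_right)
    finally obtain i where i: "card orb = p ^ i"
      using p divides_primepow_nat by blast
    show ?thesis
    proof (cases "i = 0")
      case True
      then have "card orb = 1" using i by simp
      then have orbW: "orb = {W}" using Worb by (metis card_1_singletonE singletonD)
      have "W = V" if WOrb: "W \<in> Orb"
      proof -
        obtain x where x: "x \<in> carrier G" "W = x <# V #> inv x"
          using WOrb VE by (auto simp: Orb_def orbit_def \<phi>_def)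
        have Wf: "v <# W #> inv v = W" if "v \<in> V" for v
          using that orbW WE unfolding orb orbit_def \<phi>_def by auto
        have mW: "x \<otimes> v \<otimes> inv x \<in> W" if "v \<in> V" for v
          using that x by (auto simp: l_coset_def r_coset_def)
        have "V \<subseteq> carrier G" using V by (rule subgroup.subset)
        \<comment> \<open>\<open>V\<close> fixes \<open>W = x V x^-1\<close>, so
          \<open>x^-1 v x\<close> normalizes \<open>V\<close> and hence lies in
          \<open>V\<close>.\<close>
        have sub: "inv x \<otimes> v \<otimes> x \<in> V" if "v \<in> V" for v
        proof (rule nV)
          show "inv x \<otimes> v \<otimes> x \<in> carrier G" using that x \<open>V \<subseteq> carrier G\<close> by auto
          have vc: "v \<in> carrier G" using that V \<open>V \<subseteq> carrier G\<close> by blast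
          have "v <# (x <# V #> inv x) #> inv v = x <# V #> inv x" using Wf[OF that] x by simp
          have conj: "a <# (b <# H #> inv b) #> inv a = (a \<otimes> b) <# H #> inv (a \<otimes> b)"
            if "a \<in> carrier G" "b \<in> carrier G" "H \<subseteq> carrier G" for a b H
            using that by (simp add: coset_assoc[symmetric] lcos_m_assoc coset_mult_assoc inv_mult_group
                l_coset_subset_G r_coset_subset_G)
          show "inv x \<otimes> v \<otimes> x <# V #> inv (inv x \<otimes> v \<otimes> x) = V"
          proof -
            have "inv x \<otimes> v \<otimes> x <# V #> inv (inv x \<otimes> v \<otimes> x) = (inv x \<otimes> v) <# (x <# V #> inv x) #> inv (inv x \<otimes> v)"
              using conj[of "inv x \<otimes> v" x V] x vc \<open>V \<subseteq> carrier G\<close> by simp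
            also have "\<dots> = inv x <# (v <# (x <# V #> inv x) #> inv v) #> inv (inv x)"
              using conj[of "inv x" v "x <# V #> inv x"] x vc \<open>V \<subseteq> carrier G\<close>
              by (simp add: l_coset_subset_G r_coset_subset_G)
            also have "\<dots> = inv x <# (x <# V #> inv x) #> inv (inv x)"
              using \<open>v <# (x <# V #> inv x) #> inv v = x <# V #> inv x\<close> by simp
            also have "\<dots> = V" using conj[of "inv x" x V] x \<open>V \<subseteq> carrier G\<close>
              by (simp add: lcos_mult_one)
            finally show ?thesis .
          qed
        qed
        have fV: "finite V" using \<open>V \<subseteq> carrier G\<close> fin finite_subset by blast
        have inj: "inj_on (\<lambda>v. inv x \<otimes> v \<otimes> x) V"
          by (rule inj_onI) (use x \<open>V \<subseteq> carrier G\<close> in \<open>auto simp: subset_iff\<close>)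
        \<comment> \<open>Finiteness turns the inclusion of \<open>x^-1 V x\<close> in
          \<open>V\<close> into an equality, which gives \<open>W = V\<close>.\<close>
        have surj: "(\<lambda>v. inv x \<otimes> v \<otimes> x) ` V = V"
          by (rule endo_inj_surj[OF fV _ inj]) (use sub in auto)
        have cancel: "x \<otimes> (inv x \<otimes> y \<otimes> x) \<otimes> inv x = y" if "y \<in> carrier G" for y
        proof -
          have "x \<otimes> (inv x \<otimes> y \<otimes> x) \<otimes> inv x = (x \<otimes> inv x) \<otimes> y \<otimes> (x \<otimes> inv x)"
            using that x(1) by (simp only: m_assoc m_closed inv_closed)
          then show ?thesis using that x(1) by simp
        qed
        have "W = V"
        proof
          show "W \<subseteq> V"
          proof
            fix w assume "w \<in> W"
            then obtain v where v: "v \<in> V" "w = x \<otimes> v \<otimes> inv x"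
              using x by (auto simp: l_coset_def r_coset_def)
            obtain u where "u \<in> V" "v = inv x \<otimes> u \<otimes> x" using surj v(1) by blast
            then have "w = u" using v cancel[of u] \<open>V \<subseteq> carrier G\<close> by auto
            then show "w \<in> V" using \<open>u \<in> V\<close> by simp
          qed
          show "V \<subseteq> W"
          proof
            fix v assume "v \<in> V"
            then have "x \<otimes> (inv x \<otimes> v \<otimes> x) \<otimes> inv x \<in> W" using mW sub by blast
            moreover have "x \<otimes> (inv x \<otimes> v \<otimes> x) \<otimes> inv x = v"
              using cancel[of v] \<open>v \<in> V\<close> \<open>V \<subseteq> carrier G\<close> by auto
            ultimately show "v \<in> W" by simp
          qed
        qed
        then show ?thesis .
      qed
      moreover have "V \<in> Orb" unfolding Orb_def using A.orbit_refl[OF VE] .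
      ultimately have "W \<in> Orb \<longleftrightarrow> orb = {V}" using orbW by auto
      then show ?thesis unfolding S using \<open>card orb = 1\<close> prime_gt_1_nat[OF p] by simp
    next
      case False
      have pd: "p dvd card orb" using i False by simp
      then have "orb \<noteq> {V}" using prime_gt_1_nat[OF p] by auto
      moreover note pd
      ultimately show ?thesis unfolding S by simp
    qed
  qed
  have finOrbs: "finite (orbits (G\<lparr>carrier := V\<rparr>) E \<phi>)"
    unfolding orbits_def using finE by auto
  have "orbit (G\<lparr>carrier := V\<rparr>) \<phi> V = {V}"
    using Vfix V unfolding orbit_def by (auto intro: subgroup.one_closed)
  then have VO: "{V} \<in> orbits (G\<lparr>carrier := V\<rparr>) E \<phi>"
    unfolding orbits_def using VE by blast
  have "card Orb = (\<Sum>W\<in>E. if W \<in> Orb then 1 else 0)"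
    using OrbE finE by (simp add: sum.If_cases Int_absorb1)
  also have "\<dots> = (\<Sum>orb\<in>orbits (G\<lparr>carrier := V\<rparr>) E \<phi>. \<Sum>W\<in>orb. if W \<in> Orb then 1 else 0)"
    by (rule B.disjoint_sum[OF finE, symmetric])
  finally have "card Orb mod p = (\<Sum>orb\<in>orbits (G\<lparr>carrier := V\<rparr>) E \<phi>. (\<Sum>W\<in>orb. if W \<in> Orb then 1 else 0) mod p) mod p"
    by (simp add: mod_sum_eq)
  also have "\<dots> = (\<Sum>orb\<in>orbits (G\<lparr>carrier := V\<rparr>) E \<phi>. if orb = {V} then 1 else 0) mod p"
    by (intro arg_cong[where f = "\<lambda>n. n mod p"] sum.cong refl contrib)
  also have "\<dots> = 1"
    using VO finOrbs prime_gt_1_nat[OF p] by simp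
  finally have "card Orb mod p = 1" .
  moreover obtain b where "card Orb = p ^ b"
    using cO p divides_primepow_nat by (metis dvd_triv_left)
  ultimately have "card Orb = 1"
    using prime_gt_1_nat[OF p] by (cases b) auto
  then have "card V = card (carrier G)" using cO Q by (simp add: order_def)
  then have "V = carrier G"
    using fin V by (metis card_subset_eq subgroup.subset)
  then show False using ne by simp
qed

text \<open>Choose \<open>V\<close> maximal among the subgroups that contain \<open>H\<close> but
  not \<open>w\<close>. Since normalizers grow, some \<open>x\<close> outside \<open>V\<close>
  normalizes \<open>V\<close> and has \<open>x^p\<close> in \<open>V\<close>. By maximality
  \<open>w\<close> lies in \<open>U = <x>V\<close>, and \<open>f\<close> is the isomorphism of
  \<open>U/V\<close> with Z/p that sends \<open>x\<close> to 1, with integer representatives as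
  values. The domain has to be allowed to shrink: every homomorphism from the whole group to F_p
  kills the Frattini subgroup.\<close>

lemma (in group) finite_p_group_separating_hom:
  assumes p: "prime p" and Q: "order G = p ^ m"
    and H: "subgroup H G" and w: "w \<in> carrier G" "w \<notin> H"
  obtains U and f :: "'a \<Rightarrow> int" where
    "subgroup U G" "H \<subseteq> U" "w \<in> U" "\<not> int p dvd f w"
    "\<And>x y. x \<in> U \<Longrightarrow> y \<in> U \<Longrightarrow> [f (x \<otimes> y) = f x + f y] (mod int p)"
proof -
  have fin: "finite (carrier G)"
    using Q p by (metis card.infinite order_def power_not_zero not_prime_0)
  define S where "S = {V. subgroup V G \<and> H \<subseteq> V \<and> w \<notin> V}"
  have "finite S"
    by (rule finite_subset[of _ "Pow (carrier G)"]) (auto simp: S_def fin dest: subgroup.subset)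
  moreover have "H \<in> S" using H w by (simp add: S_def)
  ultimately have "\<exists>V\<in>S. \<forall>W\<in>S. card W \<le> card V"
    using Max_in[of "card ` S"] Max_ge[of "card ` S"] by (metis empty_iff finite_imageI image_iff imageI)
  then obtain V where V: "subgroup V G" "H \<subseteq> V" "w \<notin> V"
    and Vmax: "\<And>W. subgroup W G \<Longrightarrow> H \<subseteq> W \<Longrightarrow> w \<notin> W \<Longrightarrow> card W \<le> card V"
    by (auto simp: S_def)
  have Vc: "V \<subseteq> carrier G" using V(1) by (rule subgroup.subset)
  obtain x0 where x0: "x0 \<in> carrier G" "x0 \<notin> V" "x0 <# V #> inv x0 = V"
    using finite_p_group_normalizer_grows[OF p Q V(1)] w V(3) by blast
  interpret A: group_action G "{H. subgroup H G}" "\<lambda>g. \<lambda>H\<in>{H. subgroup H G}. g <# H #> inv g"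
    by (rule action_by_conjugation_on_subgroups_set)
  define M where "M = {y \<in> carrier G. y <# V #> inv y = V}"
  have "stabilizer G (\<lambda>g. \<lambda>H\<in>{H. subgroup H G}. g <# H #> inv g) V = M"
    using V(1) by (auto simp: stabilizer_def M_def)
  then have M: "subgroup M G"
    using A.stabilizer_subgroup[of V] V(1) by simp
  have conj: "y \<otimes> v \<otimes> inv y \<in> V" if "y \<in> M" "v \<in> V" for y v
    using that by (auto simp: M_def l_coset_def r_coset_def)
  \<comment> \<open>The order of \<open>x0\<close> modulo \<open>V\<close> is \<open>p^k\<close>, so
    its power with exponent \<open>p^(k-1)\<close> has order exactly p.\<close>
  define k where "k = (LEAST k. x0 [^] (p ^ k) \<in> V)"
  have ex: "x0 [^] (p ^ m) \<in> V"
    using pow_order_eq_1[OF x0(1)] Q subgroup.one_closed[OF V(1)] by simp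
  have kV: "x0 [^] (p ^ k) \<in> V"
    unfolding k_def by (rule LeastI[of "\<lambda>k. x0 [^] (p ^ k) \<in> V", OF ex])
  then have "k \<noteq> 0" using x0(1,2) by (metis nat_pow_eone power_0)
  define x where "x = x0 [^] (p ^ (k - 1))"
  have xc: "x \<in> carrier G" using x0 by (simp add: x_def)
  have xV: "x \<notin> V"
    using not_less_Least[of "k - 1" "\<lambda>k. x0 [^] (p ^ k) \<in> V"] \<open>k \<noteq> 0\<close> by (simp add: x_def k_def)
  have "p ^ (k - 1) * p = p ^ k" using \<open>k \<noteq> 0\<close> by (simp add: power_eq_if)
  then have xp: "x [^] int p \<in> V"
    using kV x0(1) by (simp add: x_def int_pow_int nat_pow_pow)
  have "x0 \<in> M" using x0 by (simp add: M_def)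
  then have xM: "x [^] (i::int) \<in> M" for i
    using subgroup_int_pow_closed[OF M] unfolding x_def
    by (metis int_pow_int)
  have xi: "x [^] (i::int) \<in> carrier G" for i using xc by simp
  have dvd: "int p dvd i" if "x [^] (i::int) \<in> V" for i
  proof (rule ccontr)
    assume "\<not> int p dvd i"
    then have "coprime (int p) i" using p by (simp add: prime_imp_coprime)
    then obtain a b where ab: "a * int p + b * i = 1"
      by (metis bezout_int coprime_imp_gcd_eq_1)
    have "x = x [^] (int p * a + i * b)" using ab xc by (simp add: mult.commute)
    also have "\<dots> = (x [^] int p) [^] a \<otimes> (x [^] i) [^] b"
      using xc by (simp add: int_pow_mult int_pow_pow)
    also have "\<dots> \<in> V" by (rule subgroup.m_closed[OF V(1) subgroup_int_pow_closed[OF V(1) xp] subgroup_int_pow_closed[OF V(1) that]])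
    finally show False using xV by simp
  qed
  define U where "U = {x [^] (i::int) \<otimes> v | i v. v \<in> V}"
  have comm: "(x [^] i \<otimes> v) \<otimes> (x [^] j \<otimes> v') = x [^] (i + j) \<otimes> ((x [^] (-j) \<otimes> v \<otimes> inv (x [^] (-j))) \<otimes> v')"
    if "v \<in> V" "v' \<in> V" for i j :: int and v v'
  proof -
    have vc: "v \<in> carrier G" "v' \<in> carrier G" using that Vc by auto
    have inv_xj: "inv (x [^] (-j)) = x [^] j" using xc by (simp add: int_pow_neg)
    have "x [^] (i + j) \<otimes> ((x [^] (-j) \<otimes> v \<otimes> inv (x [^] (-j))) \<otimes> v')
       = x [^] i \<otimes> ((x [^] j \<otimes> x [^] (-j)) \<otimes> (v \<otimes> (x [^] j \<otimes> v')))"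
      using vc xc by (simp only: inv_xj int_pow_mult m_assoc m_closed inv_closed int_pow_closed)
    also have "x [^] j \<otimes> x [^] (-j) = \<one>" using xc by (simp add: int_pow_neg)
    finally have "x [^] (i + j) \<otimes> ((x [^] (-j) \<otimes> v \<otimes> inv (x [^] (-j))) \<otimes> v')
       = x [^] i \<otimes> (v \<otimes> (x [^] j \<otimes> v'))" using vc xc by simp
    also have "\<dots> = (x [^] i \<otimes> v) \<otimes> (x [^] j \<otimes> v')" using vc xc by (simp add: m_assoc)
    finally show ?thesis by simp
  qed
  have Uc: "U \<subseteq> carrier G" using xi Vc by (auto simp: U_def)
  have VU: "V \<subseteq> U"
  proof
    fix v assume "v \<in> V"
    then show "v \<in> U" using Vc unfolding U_def by (auto intro!: exI[of _ "0::int"] exI[of _ v])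
  qed
  have xU: "x \<in> U"
    unfolding U_def using xc subgroup.one_closed[OF V(1)]
    by (auto intro!: exI[of _ "1::int"] exI[of _ "\<one>"])
  have U: "subgroup U G"
  proof (rule subgroupI[OF Uc])
    show "U \<noteq> {}" using xU by auto
  next
    fix a assume "a \<in> U"
    then obtain i v where a: "v \<in> V" "a = x [^] (i::int) \<otimes> v" by (auto simp: U_def)
    then have vc: "v \<in> carrier G" using Vc by auto
    have "inv a = x [^] (- i) \<otimes> (x [^] i \<otimes> inv v \<otimes> inv (x [^] i))"
      using a vc xc by (simp add: inv_mult_group int_pow_neg m_assoc)
        (simp add: m_assoc[symmetric])
    moreover have "x [^] i \<otimes> inv v \<otimes> inv (x [^] i) \<in> V"
      using a V(1) by (intro conj xM subgroup.m_inv_closed)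
    ultimately show "inv a \<in> U" unfolding U_def by blast
  next
    fix a b assume "a \<in> U" "b \<in> U"
    then obtain i v j v' where ab: "v \<in> V" "a = x [^] (i::int) \<otimes> v" "v' \<in> V" "b = x [^] (j::int) \<otimes> v'"
      by (auto simp: U_def)
    have "(x [^] (-j) \<otimes> v \<otimes> inv (x [^] (-j))) \<otimes> v' \<in> V"
      using ab V(1) by (intro subgroup.m_closed conj xM)
    then show "a \<otimes> b \<in> U" using comm[OF ab(1,3)] ab unfolding U_def by blast
  qed
  have "card V < card U"
    using VU xU xV fin Uc by (intro psubset_card_mono finite_subset[OF Uc fin]) auto
  then have wU: "w \<in> U" using Vmax[OF U] V(2) VU by fastforce
  define f where "f u = (SOME i. \<exists>v\<in>V. u = x [^] (i::int) \<otimes> v)" for u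
  have fU: "\<exists>v\<in>V. u = x [^] f u \<otimes> v" if "u \<in> U" for u
    unfolding f_def by (rule someI_ex) (use that in \<open>auto simp: U_def\<close>)
  \<comment> \<open>By \<open>dvd\<close>, a power of \<open>x\<close> lies in \<open>V\<close> only
    if p divides the exponent. So the choice made in \<open>f\<close> does not matter modulo
    p.\<close>
  have funiq: "[f (x [^] i \<otimes> v) = i] (mod int p)" if "v \<in> V" for i v
  proof -
    have "x [^] i \<otimes> v \<in> U" using that by (auto simp: U_def)
    then obtain v' where v': "v' \<in> V" "x [^] i \<otimes> v = x [^] f (x [^] i \<otimes> v) \<otimes> v'"
      using fU by blast
    define j where "j = f (x [^] i \<otimes> v)"
    have vc: "v \<in> carrier G" "v' \<in> carrier G" using that v' Vc by auto
    have "x [^] (i - j) = inv (x [^] j) \<otimes> x [^] i"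
      using int_pow_mult[OF xc, of "- j" i] xc by (simp add: int_pow_neg)
    also have "x [^] i = x [^] j \<otimes> v' \<otimes> inv v"
      using v'(2) vc xc by (metis inv_solve_right int_pow_closed m_closed j_def)
    also have "inv (x [^] j) \<otimes> (x [^] j \<otimes> v' \<otimes> inv v) = v' \<otimes> inv v"
      using vc xc by (simp add: m_assoc[symmetric])
    also have "\<dots> \<in> V" using that v' V(1) by (intro subgroup.m_closed subgroup.m_inv_closed)
    finally have "int p dvd i - j" by (rule dvd)
    then show ?thesis by (simp add: cong_iff_dvd_diff j_def dvd_diff_commute)
  qed
  show thesis
  proof (rule that[of U f])
    show "subgroup U G" "H \<subseteq> U" "w \<in> U" using U V(2) VU wU by auto
    show "\<not> int p dvd f w"
    proof
      assume "int p dvd f w"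
      then obtain q where "f w = int p * q" by auto
      then obtain v where "v \<in> V" "w = (x [^] int p) [^] q \<otimes> v"
        using fU[OF wU] xc by (auto simp: int_pow_pow)
      then show False using V xp by (metis subgroup.m_closed subgroup_int_pow_closed)
    qed
    fix a b assume ab: "a \<in> U" "b \<in> U"
    obtain v v' where v: "v \<in> V" "a = x [^] f a \<otimes> v" "v' \<in> V" "b = x [^] f b \<otimes> v'"
      using fU ab by blast
    have "a \<otimes> b = x [^] (f a + f b) \<otimes> ((x [^] (-f b) \<otimes> v \<otimes> inv (x [^] (-f b))) \<otimes> v')"
      using comm[OF v(1,3), of "f a" "f b"] v by simp
    then show "[f (a \<otimes> b) = f a + f b] (mod int p)"
      using funiq[of "(x [^] (-f b) \<otimes> v \<otimes> inv (x [^] (-f b))) \<otimes> v'" "f a + f b"] v V(1)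
      by (metis conj xM subgroup.m_closed)
  qed
qed

text \<open>Another prime divisor q of the order would give, by Sylow's theorem, a subgroup of order
  q, and the order of its nontrivial elements would divide both q and \<open>p^m\<close>.\<close>

lemma (in group) order_prime_power_if_exponent:
  assumes p: "prime p" and fin: "finite (carrier G)"
    and exp: "\<And>x. x \<in> carrier G \<Longrightarrow> x [^] (p ^ m :: nat) = \<one>"
  shows "\<exists>k. order G = p ^ k"
proof -
  have pos: "0 < order G" using fin by (simp add: order_gt_0_iff_finite)
  have "q = p" if q: "prime q" "q dvd order G" for q
  proof (rule ccontr)
    assume "q \<noteq> p"
    obtain n where n: "order G = q ^ 1 * n" using q(2) by auto
    obtain H where H: "subgroup H G" "card H = q ^ 1"
      using sylow_thm[OF q(1) is_group n fin] by blast
    interpret H: group "G\<lparr>carrier := H\<rparr>" by (rule subgroup.subgroup_is_group[OF H(1) is_group])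
    have "1 < card H" using H(2) prime_gt_1_nat[OF q(1)] by simp
    then obtain x where x: "x \<in> H" "x \<noteq> \<one>"
      by (metis One_nat_def card_eq_0_iff card_le_Suc0_iff_eq leD not_gr_zero not_less_zero subgroup.one_closed[OF H(1)])
    then have xc: "x \<in> carrier G" using subgroup.mem_carrier[OF H(1)] by simp
    have "x [^] q = \<one>"
      using H.pow_order_eq_1[of x] x(1) H(2) by (simp add: order_def nat_pow_consistent[symmetric])
    then have "ord x dvd q" using pow_eq_id[OF xc] by simp
    moreover have "ord x dvd p ^ m" using pow_eq_id[OF xc] exp[OF xc] by simp
    moreover have "coprime q (p ^ m)" using p q(1) \<open>q \<noteq> p\<close> by (simp add: primes_coprime)
    ultimately have "ord x = 1" by (metis coprime_common_divisor_nat)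
    then have "x = \<one>" using pow_ord_eq_1[OF xc] xc by simp
    then show False using x by simp
  qed
  moreover obtain n where n: "order G = p ^ multiplicity p (order G) * n" "\<not> p dvd n"
    using multiplicity_decompose'[of "order G" p] pos p by (metis not_prime_unit less_numeral_extra(3))
  ultimately have "n = 1" using prime_factor_nat[of n] by (metis dvd_mult dvd_triv_right dvd_trans)
  then show ?thesis using n by (metis mult_1_right)
qed

section \<open>Powers and cosets\<close>

context group
begin

lemma rcos_eq_iff:
  "subgroup N G \<Longrightarrow> x \<in> carrier G \<Longrightarrow> y \<in> carrier G \<Longrightarrow> N #> x = N #> y \<longleftrightarrow> x \<otimes> inv y \<in> N"
  by (metis inv_closed inv_inv m_closed rcos_self repr_independence subgroup.rcos_module_imp
      subgroup.rcos_module_rev subgroup.subset coset_mult_inv2 coset_mult_inv1 is_group)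

lemma rcos_eq_self_iff: "subgroup N G \<Longrightarrow> x \<in> carrier G \<Longrightarrow> N #> x = N #> \<one> \<longleftrightarrow> x \<in> N"
  by (simp add: rcos_eq_iff)

lemma rcos_mult_cong:
  assumes "N \<lhd> G" "a \<in> carrier G" "b \<in> carrier G" "a' \<in> carrier G" "b' \<in> carrier G"
    "N #> a = N #> a'" "N #> b = N #> b'"
  shows "N #> (a \<otimes> b) = N #> (a' \<otimes> b')"
  using assms by (metis normal.rcos_sum)

lemma rcos_inv_cong:
  assumes "N \<lhd> G" "a \<in> carrier G" "a' \<in> carrier G" "N #> a = N #> a'"
  shows "N #> inv a = N #> inv a'"
  using assms by (metis normal.rcos_inv)

end

text \<open>The exponents that move \<open>x\<close> into \<open>S\<close> form an ideal of Z. It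
  contains \<open>l\<close> and \<open>p^m\<close>, hence their gcd, which is a power of p with
  exponent below \<open>k\<close>. The later use is by contraposition: if \<open>x^(p^k)\<close> is
  outside \<open>S\<close>, then \<open>p^k\<close> divides every \<open>l\<close> with
  \<open>x^l\<close> in \<open>S\<close>.\<close>

lemma (in group) pow_mem_if_not_dvd:
  assumes S: "subgroup S G" and p: "prime p" and x: "x \<in> carrier G"
    and m: "x [^] (p ^ m :: nat) \<in> S" and l: "x [^] (l :: nat) \<in> S" and k: "\<not> p ^ k dvd l"
  shows "x [^] (p ^ k) \<in> S"
proof -
  define d where "d = gcd l (p ^ m)"
  obtain u v where uv: "u * int l + v * int (p ^ m) = int d"
    using bezout_int[of "int l" "int (p ^ m)"] unfolding d_def gcd_int_int_eq by blast
  have "x [^] d = x [^] (int l * u + int (p ^ m) * v)"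
    unfolding int_pow_int[symmetric] uv[symmetric] by (simp only: mult.commute)
  also have "\<dots> = (x [^] int l) [^] u \<otimes> (x [^] int (p ^ m)) [^] v"
    using x by (simp only: int_pow_mult int_pow_pow)
  also have "\<dots> \<in> S"
    unfolding int_pow_int
    by (rule subgroup.m_closed[OF S subgroup_int_pow_closed[OF S l] subgroup_int_pow_closed[OF S m]])
  finally have xd: "x [^] d \<in> S" .
  have "d dvd p ^ m" by (simp add: d_def)
  then obtain i where i: "d = p ^ i" using divides_primepow_nat[OF p] by blast
  have "d dvd l" by (simp add: d_def)
  then have "i < k" using k unfolding i by (metis dvd_trans le_imp_power_dvd not_le)
  then have "x [^] (p ^ k) = (x [^] d) [^] (p ^ (k - i))"
    using x by (simp add: i nat_pow_pow power_add[symmetric])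
  also have "\<dots> = (x [^] d) [^] int (p ^ (k - i))" by (simp only: int_pow_int)
  also have "\<dots> \<in> S" by (rule subgroup_int_pow_closed[OF S xd])
  finally show ?thesis .
qed

lemma (in group) conj_nat_pow:
  assumes "g \<in> carrier G" "z \<in> carrier G"
  shows "(g \<otimes> z \<otimes> inv g) [^] (k::nat) = g \<otimes> z [^] k \<otimes> inv g"
proof (induction k)
  case (Suc k)
  have "(g \<otimes> z [^] k \<otimes> inv g) \<otimes> (g \<otimes> z \<otimes> inv g) = g \<otimes> z [^] k \<otimes> (inv g \<otimes> g) \<otimes> z \<otimes> inv g"
    using assms by (simp only: m_assoc m_closed inv_closed nat_pow_closed)
  then show ?case using Suc assms by (simp add: m_assoc)
qed (use assms in simp)

text \<open>The rule \<open>[g^l, z] = [g, z]^l\<close> for a commutator \<open>w = [g, z]\<close>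
  that commutes with \<open>g\<close>, written without inverses.\<close>

lemma (in group) pow_mult_commutator:
  assumes c: "g \<in> carrier G" "z \<in> carrier G" "w \<in> carrier G"
    and gz: "g \<otimes> z = w \<otimes> z \<otimes> g" and wg: "w \<otimes> g = g \<otimes> w"
  shows "g [^] (l::nat) \<otimes> z = w [^] l \<otimes> z \<otimes> g [^] l"
proof (induction l)
  case (Suc l)
  have wgl: "g [^] l \<otimes> w = w \<otimes> g [^] l"
    using c wg by (induction l) (simp_all add: m_assoc, metis m_assoc nat_pow_closed)
  have "g [^] Suc l \<otimes> z = (g [^] l \<otimes> w) \<otimes> z \<otimes> g" using c gz by (simp add: m_assoc)
  also have "\<dots> = w \<otimes> (g [^] l \<otimes> z) \<otimes> g" using c by (simp add: wgl m_assoc)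
  also have "\<dots> = (w \<otimes> w [^] l) \<otimes> z \<otimes> (g [^] l \<otimes> g)" using c Suc by (simp add: m_assoc)
  also have "w \<otimes> w [^] l = w [^] Suc l" using c nat_pow_Suc2 by simp
  finally show ?case by simp
qed (use c in simp)

section \<open>Residues of p-adic integers\<close>

lemma padic_nth_add: "(x \<oplus>\<^bsub>padic_int p\<^esub> y) n = (x n + y n) mod int p ^ n"
  and padic_nth_mult: "(x \<otimes>\<^bsub>padic_int p\<^esub> y) n = (x n * y n) mod int p ^ n"
  and padic_nth_zero: "\<zero>\<^bsub>padic_int p\<^esub> n = 0"
  and padic_nth_one: "\<one>\<^bsub>padic_int p\<^esub> n = 1 mod int p ^ n"
  by (simp_all add: padic_int_def)

lemma padic_nth_mod_self: "x \<in> carrier (padic_int p) \<Longrightarrow> x n mod int p ^ n = x n"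
  by (simp add: padic_int_def)

lemma padic_nth_mod:
  assumes "x \<in> carrier (padic_int p)" "m \<le> n"
  shows "x n mod int p ^ m = x m"
  using assms(2)
proof (induction n rule: dec_induct)
  case base
  show ?case using assms(1) by (rule padic_nth_mod_self)
next
  case (step n)
  have "x (Suc n) mod int p ^ m = x (Suc n) mod int p ^ n mod int p ^ m"
    using step.hyps by (simp add: mod_mod_cancel le_imp_power_dvd)
  also have "x (Suc n) mod int p ^ n = x n" using assms(1) by (simp add: padic_int_def)
  finally show ?case using step.IH by simp
qed

lemma padic_of_int_closed: "0 < p \<Longrightarrow> (\<lambda>n. i mod int p ^ n) \<in> carrier (padic_int p)"
  by (simp add: padic_int_def mod_mod_cancel)

lemma
  assumes "0 < p" "x \<in> carrier (padic_int p)" "y \<in> carrier (padic_int p)"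
  shows padic_add_closed: "x \<oplus>\<^bsub>padic_int p\<^esub> y \<in> carrier (padic_int p)"
    and padic_mult_closed: "x \<otimes>\<^bsub>padic_int p\<^esub> y \<in> carrier (padic_int p)"
    and padic_neg_closed: "(\<lambda>n. (- x n) mod int p ^ n) \<in> carrier (padic_int p)"
proof -
  have x: "x (Suc n) mod int p ^ n = x n" and y: "y (Suc n) mod int p ^ n = y n" for n
    using assms by (simp_all add: padic_int_def)
  have "(x (Suc n) + y (Suc n)) mod int p ^ n = (x n + y n) mod int p ^ n" for n
    using mod_add_eq[of "x (Suc n)" "int p ^ n" "y (Suc n)"] by (simp only: x y)
  then show "x \<oplus>\<^bsub>padic_int p\<^esub> y \<in> carrier (padic_int p)"
    using assms(1) by (simp add: padic_int_def mod_mod_cancel)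
  have "(x (Suc n) * y (Suc n)) mod int p ^ n = (x n * y n) mod int p ^ n" for n
    using mod_mult_eq[of "x (Suc n)" "int p ^ n" "y (Suc n)"] by (simp only: x y)
  then show "x \<otimes>\<^bsub>padic_int p\<^esub> y \<in> carrier (padic_int p)"
    using assms(1) by (simp add: padic_int_def mod_mod_cancel)
  have "(- x (Suc n)) mod int p ^ n = (- x n) mod int p ^ n" for n
    using mod_minus_eq[of "x (Suc n)" "int p ^ n"] by (simp only: x)
  then show "(\<lambda>n. (- x n) mod int p ^ n) \<in> carrier (padic_int p)"
    using assms(1) by (simp add: padic_int_def mod_mod_cancel)
qed

lemma padic_cring:
  assumes "0 < p" shows "cring (padic_int p)"
proof (rule cringI)
  let ?Z = "padic_int p"
  have one: "\<one>\<^bsub>?Z\<^esub> \<in> carrier ?Z" using padic_of_int_closed[OF assms, of 1] by (simp add: padic_int_def)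
  have zero: "\<zero>\<^bsub>?Z\<^esub> \<in> carrier ?Z" using padic_of_int_closed[OF assms, of 0] by (simp add: padic_int_def)
  show "abelian_group ?Z"
  proof (rule abelian_groupI)
    show "\<exists>y\<in>carrier ?Z. y \<oplus>\<^bsub>?Z\<^esub> x = \<zero>\<^bsub>?Z\<^esub>" if "x \<in> carrier ?Z" for x
      by (rule bexI[OF _ padic_neg_closed[OF assms that that]])
         (simp add: fun_eq_iff padic_nth_add padic_nth_zero mod_add_left_eq)
    show "\<zero>\<^bsub>?Z\<^esub> \<oplus>\<^bsub>?Z\<^esub> x = x" if "x \<in> carrier ?Z" for x
      using that by (simp add: fun_eq_iff padic_nth_add padic_nth_zero padic_nth_mod_self)
  qed (use zero in \<open>auto simp: padic_add_closed[OF assms] fun_eq_iff padic_nth_add mod_simps ac_simps\<close>)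
  show "comm_monoid ?Z"
  proof (rule comm_monoidI)
    show "\<one>\<^bsub>?Z\<^esub> \<otimes>\<^bsub>?Z\<^esub> x = x" if "x \<in> carrier ?Z" for x
      using that by (simp add: fun_eq_iff padic_nth_mult padic_nth_one padic_nth_mod_self mod_mult_left_eq)
  qed (use one in \<open>auto simp: padic_mult_closed[OF assms] fun_eq_iff padic_nth_mult mod_simps ac_simps\<close>)
  show "(x \<oplus>\<^bsub>?Z\<^esub> y) \<otimes>\<^bsub>?Z\<^esub> z = x \<otimes>\<^bsub>?Z\<^esub> z \<oplus>\<^bsub>?Z\<^esub> y \<otimes>\<^bsub>?Z\<^esub> z" for x y z
    by (simp add: fun_eq_iff padic_nth_mult padic_nth_add mod_simps distrib_right)
qed

lemma padic_nth_nat_mult: "([(k::nat)] \<cdot>\<^bsub>padic_int p\<^esub> x) n = (int k * x n) mod int p ^ n"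
proof (induction k)
  case 0
  show ?case by (simp add: add_pow_def padic_nth_zero)
next
  case (Suc k)
  have "[Suc k] \<cdot>\<^bsub>padic_int p\<^esub> x = [k] \<cdot>\<^bsub>padic_int p\<^esub> x \<oplus>\<^bsub>padic_int p\<^esub> x"
    by (simp add: add_pow_def)
  then show ?case by (simp add: padic_nth_add Suc mod_add_right_eq algebra_simps)
qed

text \<open>Membership in the principal ideal becomes the vanishing of a single residue, so that
  cosets of the ideal can be compared through integers.\<close>

lemma padic_power_ideal_eq:
  assumes "0 < p"
  shows "padic_power_ideal p n = {x \<in> carrier (padic_int p). x n = 0}"
proof -
  let ?Z = "padic_int p"
  let ?q = "[(p ^ n)] \<cdot>\<^bsub>?Z\<^esub> \<one>\<^bsub>?Z\<^esub>"
  have q: "?q m = int p ^ n mod int p ^ m" for m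
    by (simp add: padic_nth_nat_mult padic_nth_one mod_mult_right_eq)
  have qc: "?q \<in> carrier ?Z"
    using padic_of_int_closed[OF assms, of "int p ^ n"] by (simp only: q[symmetric])
  show ?thesis
  proof (intro equalityI subsetI)
    fix x assume "x \<in> padic_power_ideal p n"
    then obtain y where y: "y \<in> carrier ?Z" "x = y \<otimes>\<^bsub>?Z\<^esub> ?q"
      by (auto simp: padic_power_ideal_def cgenideal_def)
    then show "x \<in> {x \<in> carrier ?Z. x n = 0}"
      using padic_mult_closed[OF assms y(1) qc] q[of n] by (simp add: padic_nth_mult)
  next
    fix x assume "x \<in> {x \<in> carrier ?Z. x n = 0}"
    then have x: "x \<in> carrier ?Z" "x n = 0" by auto
    \<comment> \<open>Dividing by \<open>p^n\<close> loses n digits of precision: the quotient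
      modulo \<open>p^m\<close> is read off from \<open>x\<close> modulo
      \<open>p^(m+n)\<close>.\<close>
    define y where "y m = x (m + n) div int p ^ n" for m
    have xy: "int p ^ n * y m = x (m + n)" for m
    proof -
      have "x (m + n) mod int p ^ n = 0" using padic_nth_mod[OF x(1), of n "m + n"] x(2) by simp
      then show ?thesis by (simp add: y_def mod_eq_0_iff_dvd)
    qed
    have pos: "0 < int p ^ n" using assms by simp
    have xb: "0 \<le> x m" "x m < int p ^ m" for m using x(1) by (simp_all add: padic_int_def)
    have "y \<in> carrier ?Z"
    proof -
      have "0 \<le> y m" for m using xb[of "m+n"] pos by (simp add: y_def pos_imp_zdiv_nonneg_iff)
      moreover have "y m < int p ^ m" for m
      proof -
        have "int p ^ n * y m < int p ^ n * int p ^ m"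
          unfolding xy using xb(2)[of "m + n"] by (simp add: power_add mult.commute)
        then show ?thesis using pos mult_less_cancel_left_pos by blast
      qed
      moreover have "y (Suc m) mod int p ^ m = y m" for m
      proof -
        have "int p ^ n * (y (Suc m) mod int p ^ m) = (int p ^ n * y (Suc m)) mod (int p ^ n * int p ^ m)"
          by (rule mult_mod_right)
        also have "\<dots> = x (Suc m + n) mod int p ^ (m + n)"
          unfolding xy by (simp add: power_add mult.commute)
        also have "\<dots> = x (m + n)" by (rule padic_nth_mod[OF x(1)]) simp
        also have "\<dots> = int p ^ n * y m" by (simp add: xy)
        finally show ?thesis using assms by auto
      qed
      ultimately show ?thesis by (simp add: padic_int_def)
    qed
    moreover have "x = y \<otimes>\<^bsub>?Z\<^esub> ?q"
    proof
      fix m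
      have "(y \<otimes>\<^bsub>?Z\<^esub> ?q) m = (int p ^ n * y m) mod int p ^ m"
        by (simp add: padic_nth_mult q mod_mult_right_eq mult.commute)
      also have "\<dots> = x m" using xy padic_nth_mod[OF x(1), of m "m + n"] by simp
      finally show "x m = (y \<otimes>\<^bsub>?Z\<^esub> ?q) m" by simp
    qed
    ultimately show "x \<in> padic_power_ideal p n"
      unfolding padic_power_ideal_def cgenideal_def by blast
  qed
qed

lemma padic_quot_cring:
  assumes "0 < p" shows "cring (padic_quot p n)"
proof -
  interpret cring "padic_int p" by (rule padic_cring[OF assms])
  have "[(p ^ n)] \<cdot>\<^bsub>padic_int p\<^esub> \<one>\<^bsub>padic_int p\<^esub> \<in> carrier (padic_int p)" by simp
  then have "ideal (padic_power_ideal p n) (padic_int p)"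
    unfolding padic_power_ideal_def by (rule cgenideal_ideal)
  then show ?thesis unfolding padic_quot_def by (rule ideal.quotient_is_cring) (rule is_cring)
qed

text \<open>The values of cochains are cosets, hence sets; this relation lets one compute with
  integers modulo \<open>p^n\<close> instead. It asks only for a nonempty set with constant residue,
  not for a full coset, so that it passes easily through sums, scalings and reductions of
  sets.\<close>

definition has_residue :: "nat \<Rightarrow> nat \<Rightarrow> (nat \<Rightarrow> int) set \<Rightarrow> int \<Rightarrow> bool" where
  "has_residue p n C s \<longleftrightarrow> C \<subseteq> carrier (padic_int p) \<and> C \<noteq> {} \<and> (\<forall>x\<in>C. x n = s)"

lemma has_residue_unique: "has_residue p n C s \<Longrightarrow> has_residue p n C t \<Longrightarrow> s = t"
  by (auto simp: has_residue_def)

lemma has_residue_coset: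
  assumes "0 < p" "a \<in> carrier (padic_int p)"
  shows "has_residue p n (padic_power_ideal p n +>\<^bsub>padic_int p\<^esub> a) (a n)"
  using assms padic_add_closed[OF assms(1) _ assms(2)] padic_nth_mod_self[OF assms(2)]
    padic_of_int_closed[OF assms(1), of 0]
  by (auto simp: has_residue_def a_r_coset_def' padic_power_ideal_eq padic_nth_add)

lemma padic_quot_carrier:
  "carrier (padic_quot p n) = (\<lambda>a. padic_power_ideal p n +>\<^bsub>padic_int p\<^esub> a) ` carrier (padic_int p)"
  by (auto simp: padic_quot_def FactRing_def A_RCOSETS_def')

lemma has_residue_ex: "0 < p \<Longrightarrow> C \<in> carrier (padic_quot p n) \<Longrightarrow> \<exists>s. has_residue p n C s"
  unfolding padic_quot_carrier by (auto intro: has_residue_coset)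

lemma padic_coset_eq:
  assumes p: "0 < p" and a: "a \<in> carrier (padic_int p)"
  shows "padic_power_ideal p n +>\<^bsub>padic_int p\<^esub> a = {x \<in> carrier (padic_int p). x n = a n}"
proof (intro equalityI subsetI)
  fix x assume "x \<in> padic_power_ideal p n +>\<^bsub>padic_int p\<^esub> a"
  then show "x \<in> {x \<in> carrier (padic_int p). x n = a n}"
    using has_residue_coset[OF p a, of n] by (auto simp: has_residue_def)
next
  interpret cring "padic_int p" by (rule padic_cring[OF p])
  fix x assume x: "x \<in> {x \<in> carrier (padic_int p). x n = a n}"
  define h where "h = x \<ominus>\<^bsub>padic_int p\<^esub> a"
  have hc: "h \<in> carrier (padic_int p)" and xh: "x = h \<oplus>\<^bsub>padic_int p\<^esub> a"
    using x a by (auto simp: h_def a_minus_def a_assoc l_neg)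
  have "x n = (h n + a n) mod int p ^ n" by (subst xh) (rule padic_nth_add)
  then have "(h n + a n) mod int p ^ n = (0 + a n) mod int p ^ n"
    using x padic_nth_mod_self[OF a, of n] by simp
  then have "h n mod int p ^ n = 0"
    using cong_add_rcancel[of "h n" "a n" 0 "int p ^ n"] by (simp add: cong_def)
  then have "h n = 0" using padic_nth_mod_self[OF hc] by simp
  then show "x \<in> padic_power_ideal p n +>\<^bsub>padic_int p\<^esub> a"
    using hc xh by (auto simp: a_r_coset_def' padic_power_ideal_eq[OF p])
qed

lemma padic_quot_eqI:
  assumes p: "0 < p" and C: "C \<in> carrier (padic_quot p n)" "D \<in> carrier (padic_quot p n)"
    and s: "has_residue p n C s" "has_residue p n D s"
  shows "C = D"
proof -
  obtain a b where a: "a \<in> carrier (padic_int p)" "C = padic_power_ideal p n +>\<^bsub>padic_int p\<^esub> a"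
    and b: "b \<in> carrier (padic_int p)" "D = padic_power_ideal p n +>\<^bsub>padic_int p\<^esub> b"
    using C by (auto simp: padic_quot_carrier)
  have "a n = s" "b n = s"
    using s has_residue_unique has_residue_coset[OF p] a b by blast+
  then show ?thesis using a b padic_coset_eq[OF p] by simp
qed

lemma has_residue_add:
  assumes "0 < p" "has_residue p n C s" "has_residue p n D t"
  shows "has_residue p n (C \<oplus>\<^bsub>padic_quot p n\<^esub> D) ((s + t) mod int p ^ n)"
  using assms padic_add_closed[OF assms(1)]
  unfolding has_residue_def padic_quot_def FactRing_def set_add_def'
  by (auto simp: padic_nth_add)

lemma has_residue_zero:
  assumes "0 < p" shows "has_residue p n \<zero>\<^bsub>padic_quot p n\<^esub> 0"
  using padic_of_int_closed[OF assms, of 0]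
  by (auto simp: has_residue_def padic_quot_def FactRing_def padic_power_ideal_eq[OF assms])

lemma has_residue_uminus:
  assumes p: "0 < p" and C: "C \<in> carrier (padic_quot p n)" and s: "has_residue p n C s"
    and t: "has_residue p n (\<ominus>\<^bsub>padic_quot p n\<^esub> C) t"
  shows "[t = - s] (mod int p ^ n)"
proof -
  interpret M: cring "padic_quot p n" by (rule padic_quot_cring[OF p])
  have "has_residue p n \<zero>\<^bsub>padic_quot p n\<^esub> ((s + t) mod int p ^ n)"
    using has_residue_add[OF p s t] C by (simp add: M.r_neg)
  then have "(s + t) mod int p ^ n = 0" using has_residue_zero[OF p] has_residue_unique by blast
  then have "int p ^ n dvd t - (- s)" by (simp add: mod_eq_0_iff_dvd add.commute)
  then show ?thesis by (simp add: cong_iff_dvd_diff)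
qed

lemma tate_action_one:
  "\<theta> g \<in> carrier (padic_int p) \<Longrightarrow> 0 < p \<Longrightarrow>
    tate_action p \<theta> 1 g z = \<theta> g \<otimes>\<^bsub>padic_int p\<^esub> z"
proof -
  assume "\<theta> g \<in> carrier (padic_int p)" "0 < p"
  interpret cring "padic_int p" by (rule padic_cring) fact
  show ?thesis using \<open>\<theta> g \<in> _\<close>
    by (simp add: tate_action_def padic_units_def int_pow_def2 nat_pow_def units_of_def)
qed

lemma has_residue_tate:
  assumes "0 < p" "\<theta> g \<in> carrier (padic_int p)" "has_residue p n C s"
  shows "has_residue p n (tate_quot_action p \<theta> 1 g C) ((\<theta> g n * s) mod int p ^ n)"
  using assms padic_mult_closed[OF assms(1,2)]
  by (auto simp: has_residue_def tate_quot_action_def tate_action_one padic_nth_mult)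

lemma has_residue_reduction:
  assumes p: "0 < p" and n: "1 \<le> n" and s: "has_residue p n C s"
  shows "has_residue p 1 (padic_reduction p C) (s mod int p)"
proof -
  have C: "C \<subseteq> carrier (padic_int p)" "C \<noteq> {}" "\<And>x. x \<in> C \<Longrightarrow> x n = s"
    using s by (auto simp: has_residue_def)
  have x1: "(h \<oplus>\<^bsub>padic_int p\<^esub> x) 1 = s mod int p" if "x \<in> C" "h 1 = 0" for x h
  proof -
    have "x 1 = s mod int p" using padic_nth_mod[of x p 1 n] n that C by auto
    then show ?thesis using that(2) by (simp add: padic_nth_add)
  qed
  have I: "padic_power_ideal p 1 \<subseteq> carrier (padic_int p)" "\<And>h. h \<in> padic_power_ideal p 1 \<Longrightarrow> h 1 = 0"
    by (auto simp: padic_power_ideal_eq[OF p])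
  have "(\<lambda>n. 0 mod int p ^ n) \<in> padic_power_ideal p 1"
    using padic_of_int_closed[OF p, of 0] by (simp add: padic_power_ideal_eq[OF p])
  then have ne: "padic_power_ideal p 1 \<noteq> {}" by blast
  have e: "padic_reduction p C = {h \<oplus>\<^bsub>padic_int p\<^esub> x | h x. h \<in> padic_power_ideal p 1 \<and> x \<in> C}"
    unfolding padic_reduction_def set_add_def' by blast
  have "padic_reduction p C \<subseteq> carrier (padic_int p)"
  proof
    fix y assume "y \<in> padic_reduction p C"
    then obtain h x where "h \<in> padic_power_ideal p 1" "x \<in> C" "y = h \<oplus>\<^bsub>padic_int p\<^esub> x"
      unfolding e by blast
    then show "y \<in> carrier (padic_int p)"
      using padic_add_closed[OF p, of h x] C(1) I(1) by auto
  qed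
  moreover have "padic_reduction p C \<noteq> {}" unfolding e using C(2) ne by blast
  moreover have "\<forall>y\<in>padic_reduction p C. y 1 = s mod int p" unfolding e using x1 I(2) by auto
  ultimately show ?thesis unfolding has_residue_def by blast
qed

text \<open>Residues alone show only that the image lies in a coset. That it fills the coset needs
  the inverse of the unit \<open>\<theta> g\<close>.\<close>

lemma tate_quot_action_closed:
  assumes p: "0 < p" and t: "\<theta> g \<in> carrier (padic_units p)" and C: "C \<in> carrier (padic_quot p n)"
  shows "tate_quot_action p \<theta> 1 g C \<in> carrier (padic_quot p n)"
proof -
  let ?t = "\<theta> g"
  have U: "?t \<in> Units (padic_int p)" using t unfolding padic_units_def units_of_def by simp
  interpret cring "padic_int p" by (rule padic_cring[OF p])
  have tc: "?t \<in> carrier (padic_int p)" using U by (rule Units_closed)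
  let ?u = "inv\<^bsub>padic_int p\<^esub> ?t"
  obtain a where a: "a \<in> carrier (padic_int p)" "C = padic_power_ideal p n +>\<^bsub>padic_int p\<^esub> a"
    using C by (auto simp: padic_quot_carrier)
  let ?b = "?t \<otimes>\<^bsub>padic_int p\<^esub> a"
  have "tate_quot_action p \<theta> 1 g C = {x \<in> carrier (padic_int p). x n = ?b n}"
  proof (intro equalityI subsetI)
    fix x assume "x \<in> tate_quot_action p \<theta> 1 g C"
    then show "x \<in> {x \<in> carrier (padic_int p). x n = ?b n}"
      using a tc p by (auto simp: tate_quot_action_def tate_action_one padic_coset_eq padic_nth_mult)
  next
    fix x assume x: "x \<in> {x \<in> carrier (padic_int p). x n = ?b n}"
    have "x = ?t \<otimes>\<^bsub>padic_int p\<^esub> (?u \<otimes>\<^bsub>padic_int p\<^esub> x)"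
      using x U tc by (simp add: m_assoc[symmetric])
    moreover have "?u \<otimes>\<^bsub>padic_int p\<^esub> ?b = a"
      using a U tc by (simp add: m_assoc[symmetric])
    then have "(?u \<otimes>\<^bsub>padic_int p\<^esub> x) n = a n"
      using x by (metis (mono_tags, lifting) mem_Collect_eq padic_nth_mult)
    ultimately show "x \<in> tate_quot_action p \<theta> 1 g C"
      using a tc p x U by (auto simp: tate_quot_action_def tate_action_one padic_coset_eq intro!: image_eqI)
  qed
  then show ?thesis
    using padic_coset_eq[OF p, of ?b n] a tc by (auto simp: padic_quot_carrier)
qed

section \<open>Lifting homomorphisms to crossed homomorphisms\<close>

definition singleton_tuple :: "'a \<Rightarrow> nat \<Rightarrow> 'a" where
  "singleton_tuple x = (\<lambda>j\<in>{..<1}. x)"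

lemma singleton_tuple_PiE: "x \<in> U \<Longrightarrow> singleton_tuple x \<in> {..<1} \<rightarrow>\<^sub>E U"
  by (simp add: singleton_tuple_def)

text \<open>The function \<open>\<lambda>_. undefined\<close> is the empty tuple, the only argument
  of a 0-cochain.\<close>

lemma coboundary_map_0:
  assumes "abelian_group M" "x \<in> carrier G" "m (\<lambda>_. undefined) \<in> carrier M"
    "act x (m (\<lambda>_. undefined)) \<in> carrier M"
  shows "coboundary_map G M act 0 m (singleton_tuple x) =
    act x (m (\<lambda>_. undefined)) \<oplus>\<^bsub>M\<^esub> (\<ominus>\<^bsub>M\<^esub> m (\<lambda>_. undefined))"
proof -
  interpret abelian_group M by fact
  have 1: "restrict f {} = (\<lambda>_. undefined)" for f :: "nat \<Rightarrow> _"
    by (simp add: restrict_def)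
  have neg: "[(-1::int)] \<cdot>\<^bsub>M\<^esub> c = \<ominus>\<^bsub>M\<^esub> c" if "c \<in> carrier M" for c
    using that add.int_pow_neg[of c 1] add.int_pow_1[of c] by simp
  have "{..<Suc 0} = {..<1::nat}" by simp
  then have "singleton_tuple x \<in> {..<Suc 0} \<rightarrow>\<^sub>E carrier G"
    using singleton_tuple_PiE[OF assms(2)] by simp
  moreover have "singleton_tuple x 0 = x" by (simp add: singleton_tuple_def)
  ultimately show ?thesis using assms(3,4) by (simp add: coboundary_map_def 1 neg)
qed

lemma coboundary_map_1:
  assumes M: "abelian_group M" and g: "g \<in> {..<2} \<rightarrow>\<^sub>E carrier G" and G: "g 0 \<otimes>\<^bsub>G\<^esub> g 1 \<in> carrier G"
    and h: "\<And>x. x \<in> carrier G \<Longrightarrow> h (singleton_tuple x) \<in> carrier M"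
  shows "coboundary_map G M act 1 h g =
    act (g 0) (h (singleton_tuple (g 1))) \<oplus>\<^bsub>M\<^esub> (\<ominus>\<^bsub>M\<^esub> h (singleton_tuple (g 0 \<otimes>\<^bsub>G\<^esub> g 1)))
      \<oplus>\<^bsub>M\<^esub> h (singleton_tuple (g 0))"
proof -
  interpret abelian_group M by fact
  have neg: "[(-1::int)] \<cdot>\<^bsub>M\<^esub> c = \<ominus>\<^bsub>M\<^esub> c" if "c \<in> carrier M" for c
    using that add.int_pow_neg[of c 1] add.int_pow_1[of c] by simp
  have pos: "[(1::int)] \<cdot>\<^bsub>M\<^esub> c = c" if "c \<in> carrier M" for c
    using that by (rule add.int_pow_1)
  have gc: "g 0 \<in> carrier G" "g 1 \<in> carrier G" using g by (auto simp: PiE_iff)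
  have 1: "(\<lambda>j\<in>{..<1::nat}. g (Suc j)) = singleton_tuple (g 1)"
    "merge_at G 1 0 g = singleton_tuple (g 0 \<otimes>\<^bsub>G\<^esub> g 1)" "restrict g {..<1} = singleton_tuple (g 0)"
    by (auto simp: singleton_tuple_def merge_at_def fun_eq_iff)
  have "(\<Oplus>\<^bsub>M\<^esub>i\<in>{..<1::nat}. [((- 1 :: int) ^ (i + 1))] \<cdot>\<^bsub>M\<^esub> h (merge_at G 1 i g))
      = (\<Oplus>\<^bsub>M\<^esub>i\<in>{0::nat}. [((- 1 :: int) ^ (i + 1))] \<cdot>\<^bsub>M\<^esub> h (merge_at G 1 i g))"
    by (simp add: lessThan_Suc)
  also have "\<dots> = \<ominus>\<^bsub>M\<^esub> h (singleton_tuple (g 0 \<otimes>\<^bsub>G\<^esub> g 1))"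
    using h[OF G] by (subst finsum_insert) (auto simp: 1(2)[simplified] neg)
  finally have s: "(\<Oplus>\<^bsub>M\<^esub>i\<in>{..<1::nat}. [((- 1 :: int) ^ (i + 1))] \<cdot>\<^bsub>M\<^esub> h (merge_at G 1 i g))
      = \<ominus>\<^bsub>M\<^esub> h (singleton_tuple (g 0 \<otimes>\<^bsub>G\<^esub> g 1))" .
  have g': "g \<in> {..<Suc 1} \<rightarrow>\<^sub>E carrier G" using g by (simp add: numeral_2_eq_2)
  have "coboundary_map G M act 1 h g = act (g 0) (h (\<lambda>j\<in>{..<1}. g (Suc j)))
        \<oplus>\<^bsub>M\<^esub> (\<Oplus>\<^bsub>M\<^esub>i\<in>{..<1}. [((- 1 :: int) ^ (i + 1))] \<cdot>\<^bsub>M\<^esub> h (merge_at G 1 i g))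
        \<oplus>\<^bsub>M\<^esub> [((- 1 :: int) ^ (1 + 1))] \<cdot>\<^bsub>M\<^esub> h (restrict g {..<1})"
    unfolding coboundary_map_def using g' by (rule restrict_apply')
  also have "\<dots> = act (g 0) (h (singleton_tuple (g 1))) \<oplus>\<^bsub>M\<^esub> (\<ominus>\<^bsub>M\<^esub> h (singleton_tuple (g 0 \<otimes>\<^bsub>G\<^esub> g 1)))
      \<oplus>\<^bsub>M\<^esub> h (singleton_tuple (g 0))"
    unfolding s 1 using pos[OF h[OF gc(1)]] by simp
  finally show ?thesis .
qed

lemma cochain_closed:
  assumes "h \<in> carrier (cochains G T M k)" "topspace T = carrier G" "g \<in> {..<k} \<rightarrow>\<^sub>E carrier G"
  shows "h g \<in> carrier M"
  using assms continuous_map_image_subset_topspace[of "product_topology (\<lambda>i. T) {..<k}" "discrete_topology (carrier M)" h]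
  by (auto simp: cochains_def)

text \<open>A coboundary sends \<open>x\<close> to \<open>(\<theta>(x) - 1) C\<close>, and
  \<theta>(x) is 1 modulo p. So coboundaries vanish modulo p, and an equality of classes will give a
  congruence of functions.\<close>

lemma coboundary_1_residue:
  assumes p: "0 < p" and n: "1 \<le> n" and x: "x \<in> carrier G" and T: "topspace T = carrier G"
    and t: "\<theta> x \<in> carrier (padic_units p)" "[\<theta> x n = 1] (mod int p)"
    and b: "b \<in> coboundaries G T (padic_quot p n) (tate_quot_action p \<theta> 1) 1"
  obtains s where "has_residue p n (b (singleton_tuple x)) s" "int p dvd s"
proof -
  interpret M: cring "padic_quot p n" by (rule padic_quot_cring[OF p])
  have tc: "\<theta> x \<in> carrier (padic_int p)"
    using t(1) by (simp add: padic_units_def units_of_def Units_def)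
  obtain m where m: "m \<in> carrier (cochains G T (padic_quot p n) 0)"
    "b = coboundary_map G (padic_quot p n) (tate_quot_action p \<theta> 1) 0 m"
    using b by (auto simp: coboundaries_def)
  define C where "C = m (\<lambda>_. undefined)"
  have C: "C \<in> carrier (padic_quot p n)"
    unfolding C_def by (rule cochain_closed[OF m(1) T]) simp
  obtain s where s: "has_residue p n C s" using has_residue_ex[OF p C] by blast
  obtain r where r: "has_residue p n (\<ominus>\<^bsub>padic_quot p n\<^esub> C) r"
    using has_residue_ex[OF p M.a_inv_closed[OF C]] by blast
  have "b (singleton_tuple x) = tate_quot_action p \<theta> 1 x C \<oplus>\<^bsub>padic_quot p n\<^esub> (\<ominus>\<^bsub>padic_quot p n\<^esub> C)"
    unfolding m(2) C_def using C tate_quot_action_closed[of p \<theta> x C n, OF p t(1) C]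
    by (intro coboundary_map_0 M.abelian_group_axioms x) (auto simp: C_def)
  then have "has_residue p n (b (singleton_tuple x)) (((\<theta> x n * s) mod int p ^ n + r) mod int p ^ n)"
    using has_residue_add[OF p has_residue_tate[of p \<theta> x n C s, OF p tc s] r] by simp
  moreover have "int p dvd ((\<theta> x n * s) mod int p ^ n + r) mod int p ^ n"
  proof -
    have pd: "int p dvd int p ^ n" using n by (simp add: dvd_power)
    have "[((\<theta> x n * s) mod int p ^ n + r) mod int p ^ n = \<theta> x n * s + r] (mod int p ^ n)"
      by (simp add: cong_def mod_add_left_eq)
    then have "[((\<theta> x n * s) mod int p ^ n + r) mod int p ^ n = \<theta> x n * s + r] (mod int p)"
      using cong_dvd_modulus pd by blast
    moreover have "[r = - s] (mod int p)"
      using has_residue_uminus[OF p C s r] cong_dvd_modulus pd by blast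
    moreover have "[\<theta> x n * s + r = 1 * s + - s] (mod int p)"
      by (intro cong_add cong_mult t(2) calculation cong_refl)
    ultimately show ?thesis by (metis cong_0_iff cong_trans add.right_inverse mult_1)
  qed
  ultimately show thesis by (rule that)
qed

text \<open>Since \<theta> is 1 modulo p, the action on F_p(1) is trivial and \<open>F\<close>
  modulo p is a 1-cocycle. The cyclotomic property in degree 1 lifts its class to level
  \<open>n\<close>, and as coboundaries vanish modulo p the lift reduces to \<open>F\<close> itself.
  The conclusion is stated in integers so that cosets and cochains need not appear again.\<close>

lemma cyclotomic_lift:
  fixes F :: "'a \<Rightarrow> int"
  assumes p: "prime p" and G: "group G" and cyc: "cyclotomic p G T \<theta>"
    and U: "subgroup U G" "openin T U"
    and n: "1 \<le> n"
    and t: "\<And>x. x \<in> U \<Longrightarrow> \<theta> x \<in> carrier (padic_units p)"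
    and t1: "\<And>x k. x \<in> U \<Longrightarrow> 1 \<le> k \<Longrightarrow> [\<theta> x k = 1] (mod int p)"
    and F: "\<And>x y. x \<in> U \<Longrightarrow> y \<in> U \<Longrightarrow> [F (x \<otimes>\<^bsub>G\<^esub> y) = F x + F y] (mod int p)"
    and Fc: "continuous_map (subtopology T U) (discrete_topology UNIV) F"
  obtains c :: "'a \<Rightarrow> int" where
    "\<And>x y. x \<in> U \<Longrightarrow> y \<in> U \<Longrightarrow> [c (x \<otimes>\<^bsub>G\<^esub> y) = c x + \<theta> x n * c y] (mod int p ^ n)"
    "\<And>x. x \<in> U \<Longrightarrow> [c x = F x] (mod int p)"
proof -
  have p0: "0 < p" using p prime_gt_0_nat by blast
  define H where "H = G\<lparr>carrier := U\<rparr>"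
  define S where "S = subtopology T U"
  have cH: "carrier H = U" "x \<otimes>\<^bsub>H\<^esub> y = x \<otimes>\<^bsub>G\<^esub> y" for x y by (simp_all add: H_def)
  have tS: "topspace S = carrier H"
    using openin_subset[OF U(2)] by (auto simp: S_def cH)
  have mU: "x \<otimes>\<^bsub>G\<^esub> y \<in> U" if "x \<in> U" "y \<in> U" for x y using that U(1) by (simp add: subgroup.m_closed)
  let ?act = "tate_quot_action p \<theta> 1"
  let ?M = "padic_quot p"
  have cring: "cring (?M k)" for k by (rule padic_quot_cring[OF p0])
  then have ab: "abelian_group (?M k)" for k by (simp add: cring.is_cring ring.is_abelian_group cring.axioms(1))
  have tc: "\<theta> x \<in> carrier (padic_int p)" if "x \<in> U" for x
    using t[OF that] by (simp add: padic_units_def units_of_def Units_def)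
  define q where "q i = padic_power_ideal p 1 +>\<^bsub>padic_int p\<^esub> (\<lambda>m. i mod int p ^ m)" for i
  have qc: "q i \<in> carrier (?M 1)" for i
    unfolding q_def padic_quot_carrier using padic_of_int_closed[OF p0] by blast
  have qr: "has_residue p 1 (q i) (i mod int p)" for i
    using has_residue_coset[OF p0 padic_of_int_closed[OF p0, of i], of 1] by (simp add: q_def)
  define f where "f = (\<lambda>g\<in>{..<1::nat} \<rightarrow>\<^sub>E carrier H. q (F (g 0)))"
  have fs: "f (singleton_tuple x) = q (F x)" if "x \<in> U" for x
    using singleton_tuple_PiE[OF that] by (simp add: f_def cH singleton_tuple_def)
  have fcoch: "f \<in> carrier (cochains H S (?M 1) 1)"
  proof -
    have "continuous_map (product_topology (\<lambda>i. S) {..<1}) (discrete_topology (carrier (?M 1))) ((q \<circ> F) \<circ> (\<lambda>g. g (0::nat)))"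
    proof (rule continuous_map_compose[where X' = S])
      show "continuous_map (product_topology (\<lambda>i. S) {..<1}) S (\<lambda>g. g (0::nat))"
        by (rule continuous_map_product_projection) simp
      have "continuous_map (discrete_topology UNIV) (discrete_topology (carrier (?M 1))) q"
        using qc by simp
      then show "continuous_map S (discrete_topology (carrier (?M 1))) (q \<circ> F)"
        unfolding S_def by (rule continuous_map_compose[OF Fc])
    qed
    then have "continuous_map (product_topology (\<lambda>i. S) {..<1}) (discrete_topology (carrier (?M 1))) f"
      by (rule continuous_map_eq) (simp add: f_def tS)
    then show ?thesis by (simp add: cochains_def f_def)
  qed
  \<comment> \<open>The residue of the coboundary is
    \<open>\<theta>(g0) F(g1) - F(g0 g1) + F(g0)\<close>, where \<theta>(g0) may be replaced by
    1.\<close>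
  have fcocy: "f \<in> cocycles H S (?M 1) ?act 1"
  proof -
    have "coboundary_map H (?M 1) ?act 1 f g = \<zero>\<^bsub>?M 1\<^esub>" if "g \<in> {..<2} \<rightarrow>\<^sub>E U" for g
    proof -
      interpret M: cring "?M 1" by (rule cring)
      have gU: "g 0 \<in> U" "g 1 \<in> U" "g 0 \<otimes>\<^bsub>G\<^esub> g 1 \<in> U" using that mU by (auto simp: PiE_iff)
      let ?x = "q (F (g 0 \<otimes>\<^bsub>G\<^esub> g 1))"
      obtain r where r: "has_residue p 1 (\<ominus>\<^bsub>?M 1\<^esub> ?x) r"
        using has_residue_ex[OF p0 M.a_inv_closed[OF qc]] by blast
      have e: "coboundary_map H (?M 1) ?act 1 f g =
          ?act (g 0) (q (F (g 1))) \<oplus>\<^bsub>?M 1\<^esub> (\<ominus>\<^bsub>?M 1\<^esub> ?x) \<oplus>\<^bsub>?M 1\<^esub> q (F (g 0))"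
        using coboundary_map_1[OF ab, of g H f 1 ?act] that gU by (simp add: cH fs qc del: One_nat_def)
      have a: "?act (g 0) (q (F (g 1))) \<in> carrier (?M 1)"
        by (rule tate_quot_action_closed[of p \<theta> "g 0", OF p0 t[OF gU(1)] qc])
      define s where "s = (((\<theta> (g 0) 1 * (F (g 1) mod int p)) mod int p ^ 1 + r) mod int p ^ 1 + F (g 0) mod int p) mod int p ^ 1"
      have "has_residue p 1 (coboundary_map H (?M 1) ?act 1 f g) s"
        unfolding e s_def by (intro has_residue_add has_residue_tate p0 tc gU qr r)
      moreover have "s = 0"
      proof -
        have "[r = - (F (g 0 \<otimes>\<^bsub>G\<^esub> g 1) mod int p)] (mod int p)"
          using has_residue_uminus[OF p0 qc qr r] by simp
        then have r': "[r = - (F (g 0) + F (g 1))] (mod int p)"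
        proof -
          have "[F (g 0 \<otimes>\<^bsub>G\<^esub> g 1) mod int p = F (g 0) + F (g 1)] (mod int p)"
            using F[OF gU(1,2)] by (simp add: cong_def)
          then show ?thesis
            using cong_trans[OF \<open>[r = _] (mod int p)\<close>] cong_minus_minus_iff by blast
        qed
        have "[s = \<theta> (g 0) 1 * F (g 1) + r + F (g 0)] (mod int p)"
          by (simp add: s_def cong_def mod_simps)
        also have "[\<theta> (g 0) 1 * F (g 1) + r + F (g 0) = 1 * F (g 1) + - (F (g 0) + F (g 1)) + F (g 0)] (mod int p)"
          by (intro cong_add cong_mult r' t1 gU cong_refl) simp
        finally have "[s = 0] (mod int p)" by simp
        then show ?thesis by (simp add: cong_def s_def)
      qed
      ultimately have "has_residue p 1 (coboundary_map H (?M 1) ?act 1 f g) 0" by simp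
      moreover have "coboundary_map H (?M 1) ?act 1 f g \<in> carrier (?M 1)"
        unfolding e by (intro M.a_closed M.a_inv_closed a qc)
      ultimately show ?thesis
        by (intro padic_quot_eqI[OF p0 _ M.zero_closed _ has_residue_zero[OF p0]])
    qed
    then have eq: "coboundary_map H (?M 1) ?act 1 f g = \<zero>\<^bsub>?M 1\<^esub>" if "g \<in> {..<Suc 1} \<rightarrow>\<^sub>E U" for g
      using that by (simp only: numeral_2_eq_2 One_nat_def)
    have "coboundary_map H (?M 1) ?act 1 f = \<one>\<^bsub>cochains H S (?M 1) (Suc 1)\<^esub>"
    proof (rule ext)
      fix g
      show "coboundary_map H (?M 1) ?act 1 f g = \<one>\<^bsub>cochains H S (?M 1) (Suc 1)\<^esub> g"
      proof (cases "g \<in> {..<Suc 1} \<rightarrow>\<^sub>E U")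
        case True
        then show ?thesis using eq[OF True] by (simp add: cochains_def cH)
      next
        case False
        then show ?thesis by (simp add: cochains_def cH coboundary_map_def)
      qed
    qed
    then show ?thesis using fcoch by (simp add: cocycles_def)
  qed
  let ?B = "\<lambda>k. coboundaries H S (?M k) ?act 1"
  have car: "carrier (cohomology H S (?M k) ?act 1)
      = (\<lambda>c. ?B k #>\<^bsub>cochains H S (?M k) 1\<^esub> c) ` cocycles H S (?M k) ?act 1" for k
    by (auto simp: cohomology_def carrier_FactGroup r_coset_def)
  have "cohomology_map H S (?M 1) ?act 1 (padic_reduction p) ` carrier (cohomology H S (?M n) ?act 1)
      = carrier (cohomology H S (?M 1) ?act 1)"
    using cyc U n unfolding cyclotomic_def H_def S_def by (metis of_nat_1 order_refl)
  moreover have "?B 1 #>\<^bsub>cochains H S (?M 1) 1\<^esub> f \<in> carrier (cohomology H S (?M 1) ?act 1)"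
    unfolding car using fcocy by blast
  ultimately have "?B 1 #>\<^bsub>cochains H S (?M 1) 1\<^esub> f
      \<in> cohomology_map H S (?M 1) ?act 1 (padic_reduction p) ` carrier (cohomology H S (?M n) ?act 1)"
    by (simp only:)
  then obtain X where "X \<in> carrier (cohomology H S (?M n) ?act 1)" and cX:
    "?B 1 #>\<^bsub>cochains H S (?M 1) 1\<^esub> f = cohomology_map H S (?M 1) ?act 1 (padic_reduction p) X"
    by (rule imageE)
  then obtain c where c: "c \<in> cocycles H S (?M n) ?act 1" and X: "X = ?B n #>\<^bsub>cochains H S (?M n) 1\<^esub> c"
    unfolding car by (elim imageE)
  note cf = cX[unfolded X]
  \<comment> \<open>The zero 0-cochain shows that coboundaries exist, so the class of
    \<open>f\<close>, which is a set, has an element to compare.\<close>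
  let ?z = "\<lambda>g\<in>{..<0::nat} \<rightarrow>\<^sub>E carrier H. \<zero>\<^bsub>?M 1\<^esub>"
  have "?z \<in> carrier (cochains H S (?M 1) 0)"
  proof -
    interpret M: cring "?M 1" by (rule cring)
    have "continuous_map (product_topology (\<lambda>i. S) {..<0}) (discrete_topology (carrier (?M 1))) ?z"
      by (rule continuous_map_eq[where f = "\<lambda>_. \<zero>\<^bsub>?M 1\<^esub>"]) (use M.zero_closed in \<open>simp_all add: tS del: One_nat_def\<close>)
    then show ?thesis by (simp add: cochains_def)
  qed
  then obtain b0 where b0: "b0 \<in> ?B 1" by (auto simp: coboundaries_def)
  then have "b0 \<otimes>\<^bsub>cochains H S (?M 1) 1\<^esub> f \<in> ?B 1 #>\<^bsub>cochains H S (?M 1) 1\<^esub> f"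
    by (auto simp: r_coset_def)
  \<comment> \<open>The induced map is a union over all representatives of a class. Hence there is
    one coboundary \<open>b2\<close> modulo \<open>p^n\<close> inside the reduction and another one,
    \<open>b1\<close>, modulo p outside it.\<close>
  then obtain b1 b2 where b: "b1 \<in> ?B 1" "b2 \<in> ?B n"
    and eq: "b0 \<otimes>\<^bsub>cochains H S (?M 1) 1\<^esub> f = b1 \<otimes>\<^bsub>cochains H S (?M 1) 1\<^esub>
      (\<lambda>g\<in>{..<1::nat} \<rightarrow>\<^sub>E carrier H. padic_reduction p ((b2 \<otimes>\<^bsub>cochains H S (?M n) 1\<^esub> c) g))"
    unfolding cf cohomology_map_def cohomology_class_def by (auto simp: r_coset_def)
  have cc: "c (singleton_tuple x) \<in> carrier (?M n)" if "x \<in> U" for x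
    using c that singleton_tuple_PiE[OF that] by (intro cochain_closed[OF _ tS]) (auto simp: cocycles_def cH)
  define c' where "c' x = (SOME s. has_residue p n (c (singleton_tuple x)) s)" for x
  have c': "has_residue p n (c (singleton_tuple x)) (c' x)" if "x \<in> U" for x
    unfolding c'_def using has_residue_ex[OF p0 cc[OF that]] by (rule someI_ex)
  have pd: "int p dvd int p ^ n" using n by (simp add: dvd_power)
  show thesis
  proof (rule that[of c'])
    fix x y assume xy: "x \<in> U" "y \<in> U"
    interpret M: cring "?M n" by (rule cring)
    define g where "g = (\<lambda>j\<in>{..<2::nat}. if j = 0 then x else y)"
    have g: "g \<in> {..<2} \<rightarrow>\<^sub>E U" "g 0 = x" "g 1 = y" using xy by (auto simp: g_def)
    have "coboundary_map H (?M n) ?act 1 c = \<one>\<^bsub>cochains H S (?M n) (Suc 1)\<^esub>"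
      using c by (simp add: cocycles_def)
    moreover have "g \<in> {..<Suc 1} \<rightarrow>\<^sub>E U" using g(1) by (simp only: numeral_2_eq_2 One_nat_def)
    ultimately have "coboundary_map H (?M n) ?act 1 c g = \<zero>\<^bsub>?M n\<^esub>"
      by (simp add: cochains_def cH)
    moreover have "coboundary_map H (?M n) ?act 1 c g = ?act x (c (singleton_tuple y)) \<oplus>\<^bsub>?M n\<^esub>
        (\<ominus>\<^bsub>?M n\<^esub> c (singleton_tuple (x \<otimes>\<^bsub>G\<^esub> y))) \<oplus>\<^bsub>?M n\<^esub> c (singleton_tuple x)"
      using coboundary_map_1[OF ab, of g H c n ?act] g mU xy cc by (simp add: cH)
    moreover obtain r where r: "has_residue p n (\<ominus>\<^bsub>?M n\<^esub> c (singleton_tuple (x \<otimes>\<^bsub>G\<^esub> y))) r"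
      using has_residue_ex[OF p0 M.a_inv_closed[OF cc[OF mU[OF xy]]]] by blast
    ultimately have "has_residue p n \<zero>\<^bsub>?M n\<^esub>
        ((((\<theta> x n * c' y) mod int p ^ n + r) mod int p ^ n + c' x) mod int p ^ n)"
      using has_residue_add[OF p0 has_residue_add[OF p0 has_residue_tate[of p \<theta> x n, OF p0 tc[OF xy(1)] c'[OF xy(2)]] r] c'[OF xy(1)]]
      by simp
    then have "(((\<theta> x n * c' y) mod int p ^ n + r) mod int p ^ n + c' x) mod int p ^ n = 0"
      using has_residue_zero[OF p0] has_residue_unique by blast
    then have 1: "[\<theta> x n * c' y + r + c' x = 0] (mod int p ^ n)"
      by (simp add: cong_def mod_simps)
    have 2: "[r = - c' (x \<otimes>\<^bsub>G\<^esub> y)] (mod int p ^ n)"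
      by (rule has_residue_uminus[OF p0 cc[OF mU[OF xy]] c'[OF mU[OF xy]] r])
    have "int p ^ n dvd (\<theta> x n * c' y + r + c' x) - (r + c' (x \<otimes>\<^bsub>G\<^esub> y))"
      using 1 2 by (intro dvd_diff) (simp_all add: cong_iff_dvd_diff)
    then have "int p ^ n dvd (c' x + \<theta> x n * c' y) - c' (x \<otimes>\<^bsub>G\<^esub> y)"
      by (simp add: algebra_simps)
    then have "[c' x + \<theta> x n * c' y = c' (x \<otimes>\<^bsub>G\<^esub> y)] (mod int p ^ n)"
      by (simp only: cong_iff_dvd_diff)
    then show "[c' (x \<otimes>\<^bsub>G\<^esub> y) = c' x + \<theta> x n * c' y] (mod int p ^ n)"
      by (rule cong_sym)
  next
    fix x assume x: "x \<in> U"
    have st: "singleton_tuple x \<in> {..<1} \<rightarrow>\<^sub>E carrier H" using singleton_tuple_PiE[OF x] by (simp add: cH)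
    \<comment> \<open>The three coboundaries that separate \<open>c\<close> from \<open>F\<close>
      all have values divisible by p.\<close>
    obtain s0 where s0: "has_residue p 1 (b0 (singleton_tuple x)) s0" "int p dvd s0"
      using coboundary_1_residue[OF p0 _ _ tS t[OF x] t1[OF x] b0] x cH by blast
    obtain s1 where s1: "has_residue p 1 (b1 (singleton_tuple x)) s1" "int p dvd s1"
      using coboundary_1_residue[OF p0 _ _ tS t[OF x] t1[OF x] b(1)] x cH by blast
    obtain s2 where s2: "has_residue p n (b2 (singleton_tuple x)) s2" "int p dvd s2"
      using coboundary_1_residue[OF p0 n _ tS t[OF x] t1[OF x n] b(2)] x cH by blast
    have "b0 (singleton_tuple x) \<oplus>\<^bsub>?M 1\<^esub> q (F x) = b1 (singleton_tuple x) \<oplus>\<^bsub>?M 1\<^esub>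
        padic_reduction p (b2 (singleton_tuple x) \<oplus>\<^bsub>?M n\<^esub> c (singleton_tuple x))"
      using fun_cong[OF eq, of "singleton_tuple x"] st fs[OF x] by (simp add: cochains_def)
    moreover have "has_residue p 1 (b0 (singleton_tuple x) \<oplus>\<^bsub>?M 1\<^esub> q (F x)) ((s0 + F x mod int p) mod int p ^ 1)"
      by (intro has_residue_add p0 s0 qr)
    moreover have "has_residue p 1 (b1 (singleton_tuple x) \<oplus>\<^bsub>?M 1\<^esub>
        padic_reduction p (b2 (singleton_tuple x) \<oplus>\<^bsub>?M n\<^esub> c (singleton_tuple x)))
        ((s1 + ((s2 + c' x) mod int p ^ n) mod int p) mod int p ^ 1)"
      by (rule has_residue_add[OF p0 s1(1) has_residue_reduction[OF p0 n has_residue_add[OF p0 s2(1) c'[OF x]]]])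
    ultimately have "(s0 + F x mod int p) mod int p ^ 1 = (s1 + ((s2 + c' x) mod int p ^ n) mod int p) mod int p ^ 1"
      using has_residue_unique by metis
    then have "(s0 + F x) mod int p = (s1 + (s2 + c' x)) mod int p"
      using pd by (simp add: mod_simps mod_mod_cancel)
    then have "int p dvd (s0 + F x) - (s1 + (s2 + c' x))" by (simp add: mod_eq_dvd_iff)
    then have "int p dvd (s0 + F x) - (s1 + (s2 + c' x)) - s0 + s1 + s2"
      by (rule dvd_add[OF dvd_add[OF dvd_diff[OF _ s0(2)] s1(2)] s2(2)])
    then have "int p dvd F x - c' x" by (simp add: algebra_simps)
    then show "[c' x = F x] (mod int p)" by (simp add: cong_iff_dvd_diff dvd_diff_commute)
  qed
qed

section \<open>Profinite and pro-p groups\<close>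

locale profinite = group G for G (structure) +
  fixes T :: "'a topology"
  assumes profinite: "profinite_group G T"
begin

definition open_normal :: "'a set set" where
  "open_normal = {N. N \<lhd> G \<and> openin T N}"

lemma topspace_eq [simp]: "topspace T = carrier G"
  and compact: "compact_space T"
  and Hausdorff: "Hausdorff_space T"
  using profinite by (auto simp: profinite_group_def topological_group_def)

lemma continuous_map_mult:
  "continuous_map X T f \<Longrightarrow> continuous_map X T g \<Longrightarrow> continuous_map X T (\<lambda>x. f x \<otimes> g x)"
  using continuous_map_compose[of X "prod_topology T T" "\<lambda>x. (f x, g x)" T "\<lambda>(x, y). x \<otimes> y"] profinite
  by (simp add: o_def continuous_map_paired profinite_group_def topological_group_def)

lemma continuous_map_inv: "continuous_map X T f \<Longrightarrow> continuous_map X T (\<lambda>x. inv f x)"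
  using continuous_map_compose[of X T f T "\<lambda>x. inv x"] profinite
  by (simp add: o_def profinite_group_def topological_group_def)

text \<open>In a compact Hausdorff space components and quasi-components agree, so here points are
  quasi-components; such a set can be separated by a clopen set from the compact complement of
  \<open>W\<close>.\<close>

lemma clopen_neighbourhood:
  assumes W: "openin T W" "x \<in> W"
  obtains K where "openin T K" "closedin T K" "x \<in> K" "K \<subseteq> W"
proof -
  have x: "x \<in> topspace T" using W openin_subset by blast
  obtain a where "connected_component_of_set T x \<subseteq> {a}"
    using profinite connectedin_connected_component_of[of T x]
    unfolding profinite_group_def totally_disconnected_space_def by blast
  moreover have "x \<in> connected_component_of_set T x"
    using x by (simp add: connected_component_of_refl)
  ultimately have "connected_component_of_set T x = {x}" by blast
  then have "quasi_component_of_set T x = {x}"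
    using quasi_eq_connected_component_of[of T x] compact Hausdorff by simp
  then have "{x} \<in> quasi_components_of T" using x unfolding quasi_components_of_def by auto
  moreover have "compactin T (topspace T - W)"
    using W closedin_compact_space[OF compact] by blast
  ultimately have "separated_between T {x} (topspace T - W)"
    using W(2) separated_between_quasi_component_compact[of "{x}" T "topspace T - W"] by (auto simp: disjnt_def)
  then obtain U where U: "closedin T U" "openin T U" "{x} \<subseteq> U" "topspace T - W \<subseteq> topspace T - U"
    unfolding separated_between by blast
  moreover have "U \<subseteq> W" using U(4) openin_subset[OF U(2)] by blast
  ultimately show thesis using that by blast
qed

lemma open_subgroupI:
  assumes S: "subgroup S G" and W: "openin T W" "\<one> \<in> W" "W \<subseteq> S"
  shows "openin T S"
proof (rule openin_subopen[THEN iffD2], intro ballI)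
  fix s assume s: "s \<in> S"
  then have sc: "s \<in> carrier G" using subgroup.mem_carrier[OF S] by simp
  let ?O = "{y \<in> topspace T. inv s \<otimes> y \<in> W}"
  have "openin T ?O"
    by (intro openin_continuous_map_preimage[where Y = T] continuous_map_mult W) (use sc in auto)
  moreover have "s \<in> ?O" using sc W by simp
  moreover have "?O \<subseteq> S"
  proof
    fix y assume y: "y \<in> ?O"
    then have "s \<otimes> (inv s \<otimes> y) \<in> S" using s W S by (blast intro: subgroup.m_closed)
    then show "y \<in> S" using y sc by (simp add: m_assoc[symmetric])
  qed
  ultimately show "\<exists>O'. openin T O' \<and> s \<in> O' \<and> O' \<subseteq> S" by blast
qed

text \<open>The elements that, together with their inverses, move a clopen neighbourhood
  \<open>K\<close> of 1 into itself form a subgroup \<open>S\<close> inside \<open>K\<close>, open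
  because \<open>K\<close> is compact. Its normal core \<open>N\<close> is still open because
  \<open>G\<close> is compact.\<close>

lemma open_normal_neighbourhood:
  assumes W: "openin T W" "\<one> \<in> W"
  obtains N where "N \<in> open_normal" "N \<subseteq> W"
proof -
  obtain K where K: "openin T K" "closedin T K" "\<one> \<in> K" "K \<subseteq> W"
    using clopen_neighbourhood[OF W] by blast
  have Kc: "K \<subseteq> carrier G" using openin_subset[OF K(1)] by simp
  define S where "S = {x \<in> carrier G. (\<forall>k\<in>K. x \<otimes> k \<in> K) \<and> (\<forall>k\<in>K. inv x \<otimes> k \<in> K)}"
  have S: "subgroup S G"
  proof (rule subgroupI)
    show "S \<subseteq> carrier G" by (auto simp: S_def)
    show "S \<noteq> {}" using Kc by (auto simp: S_def intro!: exI[of _ "\<one>"])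
    show "inv a \<in> S" if "a \<in> S" for a using that by (auto simp: S_def)
    show "a \<otimes> b \<in> S" if "a \<in> S" "b \<in> S" for a b
      using that Kc by (auto simp: S_def m_assoc inv_mult_group subset_iff)
  qed
  have SK: "S \<subseteq> K" using K(3) by (force simp: S_def)
  have fst: "continuous_map (prod_topology T T) T fst" and snd: "continuous_map (prod_topology T T) T snd"
    by (rule continuous_map_fst continuous_map_snd)+
  \<comment> \<open>Compactness of \<open>K\<close> gives one neighbourhood \<open>U\<close> of 1
    with \<open>U K\<close> inside \<open>K\<close>; the part of \<open>U\<close> whose inverses are
    also in \<open>U\<close> is then contained in \<open>S\<close>.\<close>
  let ?P = "{q \<in> topspace (prod_topology T T). fst q \<otimes> snd q \<in> K}"
  have "openin (prod_topology T T) ?P"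
    by (intro openin_continuous_map_preimage[where Y = T] continuous_map_mult K fst snd)
  moreover have "compactin T K" using closedin_compact_space[OF compact K(2)] .
  moreover have "{\<one>} \<times> K \<subseteq> ?P" using Kc by auto
  ultimately obtain U V where UV: "openin T U" "\<one> \<in> U" "K \<subseteq> V" "U \<times> V \<subseteq> ?P"
    using tube_lemma_right[of T T ?P K "\<one>"] by auto
  have "openin T (U \<inter> {x \<in> topspace T. inv x \<in> U})"
    by (intro openin_Int UV openin_continuous_map_preimage[where Y = T] continuous_map_inv) auto
  moreover have "U \<inter> {x \<in> topspace T. inv x \<in> U} \<subseteq> S"
    using UV(3,4) by (fastforce simp: S_def)
  ultimately have openS: "openin T S"
    using open_subgroupI[OF S] UV(2) by simp
  define N where "N = {x \<in> carrier G. \<forall>g\<in>carrier G. g \<otimes> x \<otimes> inv g \<in> S}"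
  have N: "subgroup N G"
  proof (rule subgroupI)
    show "N \<subseteq> carrier G" by (auto simp: N_def)
    show "N \<noteq> {}" using subgroup.one_closed[OF S] by (auto simp: N_def intro!: exI[of _ "\<one>"])
    fix a assume a: "a \<in> N"
    have "g \<otimes> inv a \<otimes> inv g = inv (g \<otimes> a \<otimes> inv g)" if "g \<in> carrier G" for g
      using a that by (simp add: N_def inv_mult_group m_assoc)
    then show "inv a \<in> N" using a subgroup.m_inv_closed[OF S] by (simp add: N_def)
    fix b assume b: "b \<in> N"
    have "g \<otimes> (a \<otimes> b) \<otimes> inv g = (g \<otimes> a \<otimes> inv g) \<otimes> (g \<otimes> b \<otimes> inv g)" if "g \<in> carrier G" for g
      using a b that by (simp add: N_def m_assoc inv_solve_left') (simp add: m_assoc[symmetric])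
    then show "a \<otimes> b \<in> N" using a b subgroup.m_closed[OF S] by (simp add: N_def)
  qed
  have "N \<lhd> G"
  proof (rule normal_invI[OF N])
    fix x h assume xh: "x \<in> carrier G" "h \<in> N"
    then have "g \<otimes> (x \<otimes> h \<otimes> inv x) \<otimes> inv g = (g \<otimes> x) \<otimes> h \<otimes> inv (g \<otimes> x)" if "g \<in> carrier G" for g
      using that by (simp add: N_def m_assoc inv_mult_group)
    then show "x \<otimes> h \<otimes> inv x \<in> N" using xh by (simp add: N_def)
  qed
  \<comment> \<open>The same tube argument over all of \<open>G\<close>: elements close to 1 have
    all their conjugates in \<open>S\<close>.\<close>
  let ?P = "{q \<in> topspace (prod_topology T T). fst q \<otimes> snd q \<otimes> inv fst q \<in> S}"
  have "openin (prod_topology T T) ?P"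
    by (intro openin_continuous_map_preimage[where Y = T] continuous_map_mult continuous_map_inv openS fst snd)
  moreover have "compactin T (topspace T)" using compact by (simp add: compact_space_def)
  moreover have "topspace T \<times> {\<one>} \<subseteq> ?P" using subgroup.one_closed[OF S] by auto
  ultimately obtain U V where UV: "openin T V" "\<one> \<in> V" "topspace T \<subseteq> U" "U \<times> V \<subseteq> ?P"
    using tube_lemma_left[of T T ?P "topspace T" "\<one>"] by auto
  have "V \<subseteq> N" using UV(3,4) openin_subset[OF UV(1)] by (fastforce simp: N_def)
  then have "openin T N" using open_subgroupI[OF N UV(1,2)] by simp
  moreover have "N \<subseteq> S"
  proof
    fix x assume "x \<in> N"
    then have x: "x \<in> carrier G" "\<forall>g\<in>carrier G. g \<otimes> x \<otimes> inv g \<in> S" unfolding N_def by blast+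
    show "x \<in> S" using bspec[OF x(2) one_closed] x(1) by simp
  qed
  ultimately show thesis
    using \<open>N \<lhd> G\<close> SK K(4) by (intro that[of N]) (auto simp: open_normal_def)
qed

lemma open_normal_Int: "M \<in> open_normal \<Longrightarrow> N \<in> open_normal \<Longrightarrow> M \<inter> N \<in> open_normal"
  by (auto simp: open_normal_def normal_subgroup_intersect)

lemma open_normal_normal: "N \<in> open_normal \<Longrightarrow> N \<lhd> G"
  and open_normal_open: "N \<in> open_normal \<Longrightarrow> openin T N"
  and open_normal_subgroup: "N \<in> open_normal \<Longrightarrow> subgroup N G"
  by (auto simp: open_normal_def normal_imp_subgroup)

lemma carrier_open_normal: "carrier G \<in> open_normal"
  unfolding open_normal_def using openin_topspace[of T] normal_invI[OF subgroup_self] by simp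

lemma openin_rcos_eq:
  assumes "N \<in> open_normal" "a \<in> carrier G"
  shows "openin T {y \<in> carrier G. N #> y = N #> a}"
proof -
  have "openin T {y \<in> topspace T. y \<otimes> inv a \<in> N}"
    by (intro openin_continuous_map_preimage[where Y = T] continuous_map_mult open_normal_open)
       (use assms in auto)
  also have "{y \<in> topspace T. y \<otimes> inv a \<in> N} = {y \<in> carrier G. N #> y = N #> a}"
    by (rule Collect_cong) (simp add: rcos_eq_iff[OF open_normal_subgroup[OF assms(1)] _ assms(2)] cong: conj_cong)
  finally show ?thesis .
qed

lemma closedin_rcos_eq:
  assumes "N \<in> open_normal" "a \<in> carrier G"
  shows "closedin T {y \<in> carrier G. N #> y = N #> a}"
proof -
  have "carrier G - {y \<in> carrier G. N #> y = N #> a}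
      = \<Union> ((\<lambda>b. {y \<in> carrier G. N #> y = N #> b}) ` {b \<in> carrier G. N #> b \<noteq> N #> a})"
    by auto
  moreover have "openin T \<dots>"
    using assms(1) by (intro openin_Union) (auto intro: openin_rcos_eq)
  ultimately show ?thesis by (simp add: closedin_def)
qed

text \<open>The open normal subgroups of a Hausdorff profinite group intersect trivially, so
  identities in \<open>G\<close> can be checked in the finite quotients.\<close>

lemma eq_if_rcos_eq:
  assumes "x \<in> carrier G" "y \<in> carrier G" "\<And>N. N \<in> open_normal \<Longrightarrow> N #> x = N #> y"
  shows "x = y"
proof (rule ccontr)
  assume "x \<noteq> y"
  then have "\<one> \<in> topspace T - {x \<otimes> inv y}"
    using assms(1,2) by (auto simp: inv_solve_right)
  moreover have "openin T (topspace T - {x \<otimes> inv y})"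
    using closedin_Hausdorff_singleton[OF Hausdorff, of "x \<otimes> inv y"] assms(1,2)
      openin_topspace[of T] by (intro openin_diff) auto
  ultimately obtain N where N: "N \<in> open_normal" "N \<subseteq> topspace T - {x \<otimes> inv y}"
    using open_normal_neighbourhood by metis
  have "x \<otimes> inv y \<in> N"
    using assms(3)[OF N(1)] rcos_eq_iff[OF open_normal_subgroup[OF N(1)] assms(1,2)] by simp
  then show False using N(2) by blast
qed

lemma limitin_if_rcos_eq:
  assumes y: "y \<in> carrier G" and f: "\<And>n. f n \<in> carrier G"
    and ev: "\<And>N. N \<in> open_normal \<Longrightarrow> eventually (\<lambda>n. N #> f n = N #> y) F"
  shows "limitin T f y F"
  unfolding limitin_def
proof (intro conjI allI impI)
  show "y \<in> topspace T" using y by simp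
  fix W assume W: "openin T W \<and> y \<in> W"
  let ?O = "{x \<in> topspace T. x \<otimes> y \<in> W}"
  have "openin T ?O"
    by (intro openin_continuous_map_preimage[where Y = T] continuous_map_mult) (use y W in auto)
  moreover have "\<one> \<in> ?O" using y W by simp
  ultimately obtain N where N: "N \<in> open_normal" "N \<subseteq> ?O" using open_normal_neighbourhood by blast
  show "eventually (\<lambda>n. f n \<in> W) F"
  proof (rule eventually_mono[OF ev[OF N(1)]])
    fix n assume "N #> f n = N #> y"
    then have "f n \<otimes> inv y \<in> ?O"
      using N(2) rcos_eq_iff[OF open_normal_subgroup[OF N(1)] f y] by blast
    then show "f n \<in> W" using f y by (simp add: m_assoc)
  qed
qed

text \<open>Completeness from compactness: the eventual cosets of the sequence are closed and have
  the finite intersection property.\<close>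

lemma rcos_Cauchy_converges:
  assumes f: "\<And>n. f n \<in> carrier G"
    and C: "\<And>N. N \<in> open_normal \<Longrightarrow> \<exists>k::nat. \<forall>n\<ge>k. N #> f n = N #> f k"
  obtains y where "y \<in> carrier G"
    "\<And>N. N \<in> open_normal \<Longrightarrow> eventually (\<lambda>n. N #> f n = N #> y) sequentially"
proof -
  obtain k where k: "\<And>N n. N \<in> open_normal \<Longrightarrow> n \<ge> k N \<Longrightarrow> N #> f n = N #> f (k N)"
    using C by metis
  define D where "D N = {y \<in> carrier G. N #> y = N #> f (k N)}" for N
  have "\<Inter> (D ` open_normal) \<noteq> {}"
  proof -
    have "closedin T X" if "X \<in> D ` open_normal" for X
      using that closedin_rcos_eq f by (auto simp: D_def)
    moreover have "\<Inter>\<F> \<noteq> {}" if F: "finite \<F>" "\<F> \<subseteq> D ` open_normal" for \<F>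
    proof -
      obtain X where X: "finite X" "X \<subseteq> open_normal" "\<F> = D ` X"
        using F finite_subset_image by metis
      \<comment> \<open>A term beyond finitely many thresholds lies in all their cosets; 0 is
        inserted for the empty family, where \<open>Max\<close> would be unspecified.\<close>
      have "f (Max (insert 0 (k ` X))) \<in> D N" if "N \<in> X" for N
        using that X f by (auto simp: D_def intro!: k)
      then show ?thesis using X(3) by blast
    qed
    ultimately show ?thesis
      using compact[unfolded compact_space_fip, THEN spec[of _ "D ` open_normal"]] by simp
  qed
  then obtain y where y: "\<And>N. N \<in> open_normal \<Longrightarrow> y \<in> D N" by blast
  show thesis
  proof (rule that[of y])
    show "y \<in> carrier G" using y[OF carrier_open_normal] by (simp add: D_def)
    show "eventually (\<lambda>n. N #> f n = N #> y) sequentially" if "N \<in> open_normal" for N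
    proof (rule eventually_sequentiallyI)
      show "N #> f n = N #> y" if "n \<ge> k N" for n
        using k[OF \<open>N \<in> open_normal\<close> that] y[OF \<open>N \<in> open_normal\<close>] by (simp add: D_def)
    qed
  qed
qed

end

section \<open>p-adic powers in pro-p groups\<close>

locale pro_p = profinite +
  fixes p :: nat
  assumes prime: "prime p" and pro_p: "pro_p_group p G T"
begin

lemma p_pos: "0 < p" using prime prime_gt_0_nat by blast

lemma finite_quotient:
  assumes "N \<in> open_normal" obtains m where "Coset.order (G Mod N) = p ^ m"
  using assms pro_p by (auto simp: pro_p_group_def open_normal_def)

lemma pow_in_open_normal:
  assumes N: "N \<in> open_normal"
  shows "\<exists>m. \<forall>x\<in>carrier G. x [^] (p ^ m) \<in> N"
proof -
  obtain m where m: "Coset.order (G Mod N) = p ^ m" using finite_quotient[OF N] .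
  interpret N: normal N G using N by (rule open_normal_normal)
  interpret Q: group "G Mod N" by (rule N.factorgroup_is_group)
  have "x [^] (p ^ m) \<in> N" if x: "x \<in> carrier G" for x
  proof -
    have "(N #> x) [^]\<^bsub>G Mod N\<^esub> (p ^ m) = \<one>\<^bsub>G Mod N\<^esub>"
      using Q.pow_order_eq_1[of "N #> x"] x m by (simp add: carrier_FactGroup)
    then have "N #> (x [^] (p ^ m)) = N #> \<one>"
      using N.FactGroup_pow[OF x, of "p ^ m"] N.subset by (simp add: coset_mult_one)
    then show ?thesis using rcos_eq_self_iff[OF N.subgroup_axioms] x by simp
  qed
  then show ?thesis by blast
qed

lemma int_pow_rcos_cong:
  assumes N: "N \<in> open_normal" and m: "x [^] (p ^ m) \<in> N" and x: "x \<in> carrier G"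
    and ij: "i mod int p ^ m = j mod int p ^ m"
  shows "N #> (x [^] (i::int)) = N #> (x [^] (j::int))"
proof -
  obtain q where q: "i = j + int p ^ m * q"
    using ij by (metis mod_eqE mult.commute add.commute mult_minus_left add_uminus_conv_diff)
  have "x [^] i \<otimes> inv (x [^] j) = (x [^] (p ^ m)) [^] q"
    using x by (simp add: q int_pow_diff[symmetric] int_pow_pow int_pow_int[symmetric])
  also have "\<dots> \<in> N" using m open_normal_subgroup[OF N] subgroup_int_pow_closed by blast
  finally show ?thesis using x rcos_eq_iff open_normal_subgroup[OF N] by simp
qed

text \<open>Modulo an open normal subgroup the powers are eventually constant, so a limit exists,
  and it is unique by Hausdorffness: the \<open>THE\<close> in \<open>padic_power\<close> is
  justified. The second claim replaces the limit by congruences.\<close>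

lemma padic_power:
  assumes x: "x \<in> carrier G" and z: "z \<in> carrier (padic_int p)"
  shows padic_power_closed: "padic_power G T x z \<in> carrier G"
    and padic_power_limit: "\<And>N. N \<in> open_normal \<Longrightarrow>
      eventually (\<lambda>n. N #> (x [^] z n) = N #> padic_power G T x z) sequentially"
proof -
  have C: "\<exists>k. \<forall>n\<ge>k. N #> (x [^] z n) = N #> (x [^] z k)" if N: "N \<in> open_normal" for N
  proof -
    obtain m where m: "\<And>x. x \<in> carrier G \<Longrightarrow> x [^] (p ^ m) \<in> N" using pow_in_open_normal[OF N] by blast
    show ?thesis
      using int_pow_rcos_cong[OF N m[OF x] x] padic_nth_mod[OF z] by (intro exI[of _ m]) auto
  qed
  obtain y where y: "y \<in> carrier G"
    "\<And>N. N \<in> open_normal \<Longrightarrow> eventually (\<lambda>n. N #> (x [^] z n) = N #> y) sequentially"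
    using rcos_Cauchy_converges[OF _ C] x by (metis int_pow_closed)
  have "limitin T (\<lambda>n. x [^] z n) y sequentially"
    using y x by (intro limitin_if_rcos_eq) auto
  then have "padic_power G T x z = y"
    unfolding padic_power_def
  proof (rule the_equality)
    show "y' = y" if "limitin T (\<lambda>n. x [^] z n) y' sequentially" for y'
      using limitin_Hausdorff_unique[OF that \<open>limitin T _ y sequentially\<close> _ Hausdorff] by simp
  qed
  with y show "padic_power G T x z \<in> carrier G"
    "\<And>N. N \<in> open_normal \<Longrightarrow> eventually (\<lambda>n. N #> (x [^] z n) = N #> padic_power G T x z) sequentially"
    by auto
qed

lemma padic_power_eqI:
  assumes "x \<in> carrier G" "z \<in> carrier (padic_int p)" "y \<in> carrier G"
    "\<And>N. N \<in> open_normal \<Longrightarrow> eventually (\<lambda>n. N #> (x [^] z n) = N #> y) sequentially"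
  shows "padic_power G T x z = y"
proof (rule eq_if_rcos_eq[OF padic_power_closed[OF assms(1,2)] assms(3)])
  fix N assume N: "N \<in> open_normal"
  have "eventually (\<lambda>n::nat. N #> padic_power G T x z = N #> y) sequentially"
    using padic_power_limit[OF assms(1,2) N] assms(4)[OF N] by eventually_elim auto
  then show "N #> padic_power G T x z = N #> y" by simp
qed

end

section \<open>Orientations\<close>

text \<open>First-order binomial expansion: terms of degree at least 2 in \<open>p s\<close> vanish
  modulo \<open>p^2\<close>. It serves to sum the powers of \<open>t\<close> below the p-th.\<close>

lemma sum_powers_cong:
  fixes s :: int and p :: nat
  assumes t: "t = 1 + int p * s"
  shows "[t ^ i = 1 + int i * int p * s] (mod int p ^ 2)"
proof (induction i)
  case (Suc i)
  have "[t ^ Suc i = (1 + int p * s) * (1 + int i * int p * s)] (mod int p ^ 2)"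
    unfolding power_Suc using Suc by (intro cong_mult) (simp_all add: t)
  also have "(1 + int p * s) * (1 + int i * int p * s)
      = (1 + int (Suc i) * int p * s) + int p ^ 2 * (int i * s ^ 2)"
    by (simp add: algebra_simps power2_eq_square)
  also have "[\<dots> = 1 + int (Suc i) * int p * s] (mod int p ^ 2)"
    by (simp add: cong_iff_dvd_diff)
  finally show ?case .
qed simp

text \<open>For \<open>t \<equiv> 1\<close> modulo \<open>p\<close> (modulo \<open>4\<close> if \<open>p = 2\<close>), the cofactor of \<open>t - 1\<close> in \<open>t\<^sup>p - 1\<close> is
  exactly divisible by \<open>p\<close>.\<close>

lemma cong_1_if_power_p_cong_1:
  fixes t :: int and p :: nat
  assumes p: "prime p" and t: "[t = 1] (mod int p)" and t4: "p = 2 \<Longrightarrow> [t = 1] (mod 4)"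
    and pow: "[t ^ p = 1] (mod int p ^ Suc r)"
  shows "[t = 1] (mod int p ^ r)"
proof -
  obtain s where s: "t = 1 + int p * s"
    using t by (metis add.commute cong_iff_lin cong_sym)
  define S where "S = (\<Sum>i<p. t ^ i)"
  have "[S = int p] (mod int p ^ 2)"
  proof (cases "p = 2")
    case True
    obtain k where "t = 1 + 4 * k" using t4[OF True] by (metis cong_iff_lin cong_sym)
    then show ?thesis
      using True by (simp add: S_def numeral_2_eq_2 cong_iff_dvd_diff)
  next
    case False
    then have "odd p" using p prime_odd_nat prime_ge_2_nat le_neq_implies_less by metis
    then obtain k where k: "p = 2 * k + 1" by (elim oddE)
    have "[S = (\<Sum>i<p. 1 + int i * int p * s)] (mod int p ^ 2)"
      unfolding S_def by (intro cong_sum sum_powers_cong s)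
    also have "(\<Sum>i<p. 1 + int i * int p * s) = int p + (\<Sum>i<p. int i) * (int p * s)"
      by (simp add: sum.distrib sum_distrib_right mult.assoc)
    \<comment> \<open>For odd p the sum \<open>p (p - 1) / 2\<close> is a multiple of p. For p = 2
      it is 1, which is why that case relies on \<open>t\<close> being 1 modulo 4.\<close>
    also have "(\<Sum>i<p. int i) = int p * int k"
    proof -
      have "2 * (\<Sum>i<n. int i) = int n * (int n - 1)" for n
        by (induction n) (simp_all add: algebra_simps)
      from this[of p] show ?thesis using k by simp
    qed
    also have "int p + int p * int k * (int p * s) = int p + int p ^ 2 * (int k * s)"
      by (simp add: power2_eq_square)
    also have "[\<dots> = int p] (mod int p ^ 2)" by (simp add: cong_iff_dvd_diff)
    finally show ?thesis .
  qed
  then obtain l where "S = int p + int p ^ 2 * l" by (metis cong_iff_lin cong_sym)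
  then have S: "S = int p * (1 + int p * l)" by (simp add: power2_eq_square algebra_simps)
  have "t ^ p - 1 = (t - 1) * S" unfolding S_def by (rule power_diff_1_eq)
  then have "int p ^ Suc r dvd (t - 1) * S" using pow by (simp add: cong_iff_dvd_diff)
  then have "int p * int p ^ r dvd int p * ((t - 1) * (1 + int p * l))"
    by (simp add: S ac_simps)
  then have "int p ^ r dvd (t - 1) * (1 + int p * l)"
    using p by (simp add: prime_gt_0_nat)
  moreover have "coprime (int p ^ r) (1 + int p * l)"
  proof -
    have "coprime (int p) (1 + int p * l)"
      by (metis coprime_1_right coprime_iff_gcd_eq_1 gcd_add_mult mult.commute add.commute)
    then show ?thesis by simp
  qed
  ultimately have "int p ^ r dvd t - 1" by (simp add: coprime_dvd_mult_left_iff)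
  then show ?thesis by (simp add: cong_iff_dvd_diff)
qed

locale oriented_pro_p = pro_p +
  fixes \<theta> :: "'a \<Rightarrow> nat \<Rightarrow> int"
  assumes orientation: "p_orientation p G T \<theta>"
begin

abbreviation Ker :: "'a set" where
  "Ker \<equiv> kernel G (padic_units p) \<theta>"

lemma padic_units_group: "group (padic_units p)"
  unfolding padic_units_def using padic_cring[OF p_pos] by (intro monoid.units_group) (simp add: cring_def ring_def)

lemma theta_hom: "group_hom G (padic_units p) \<theta>"
  using orientation padic_units_group is_group
  by (simp add: group_hom_def group_hom_axioms_def p_orientation_def)

lemma theta_units: "x \<in> carrier G \<Longrightarrow> \<theta> x \<in> carrier (padic_units p)"
  using group_hom.hom_closed[OF theta_hom] .

lemma theta_closed: "x \<in> carrier G \<Longrightarrow> \<theta> x \<in> carrier (padic_int p)"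
  using theta_units by (simp add: padic_units_def units_of_def Units_def)

lemma theta_mult: "x \<in> carrier G \<Longrightarrow> y \<in> carrier G \<Longrightarrow> \<theta> (x \<otimes> y) n = (\<theta> x n * \<theta> y n) mod int p ^ n"
  using group_hom.hom_mult[OF theta_hom] by (simp add: padic_units_def units_of_def padic_nth_mult)

lemma theta_comm:
  assumes "x \<in> carrier G" "y \<in> carrier G" shows "\<theta> (x \<otimes> y) = \<theta> (y \<otimes> x)"
  by (rule ext) (simp add: theta_mult assms mult.commute)

lemma theta_one: "\<theta> \<one> n = 1 mod int p ^ n"
  using group_hom.hom_one[OF theta_hom] by (simp add: padic_units_def units_of_def padic_nth_one)

lemma Ker_iff: "x \<in> Ker \<longleftrightarrow> x \<in> carrier G \<and> (\<forall>n. \<theta> x n = 1 mod int p ^ n)"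
  by (auto simp: kernel_def padic_units_def units_of_def fun_eq_iff padic_nth_one)

lemma theta_pow: "x \<in> carrier G \<Longrightarrow> \<theta> (x [^] (k::nat)) n = (\<theta> x n) ^ k mod int p ^ n"
  by (induction k) (simp_all add: theta_one theta_mult mod_mult_left_eq mod_mult_right_eq mult.commute)

text \<open>The kernel of \<theta> modulo \<open>p^r\<close>. It is open even when
  \<open>Ker\<close> is not, so it is visible in a finite quotient of \<open>G\<close>.\<close>

definition congruence_kernel :: "nat \<Rightarrow> 'a set" where
  "congruence_kernel r = {x \<in> carrier G. \<theta> x r = 1 mod int p ^ r}"

lemma Ker_normal: "Ker \<lhd> G"
  using group_hom.normal_kernel[OF theta_hom] .

lemma Ker_eq: "Ker = (\<Inter>r. congruence_kernel r)"
  by (auto simp: Ker_iff congruence_kernel_def)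

lemma congruence_kernel_open_normal: "congruence_kernel r \<in> open_normal"
proof -
  have c: "continuous_map T (discrete_topology UNIV) (\<lambda>x. \<theta> x r)"
  proof -
    have "continuous_map T (product_topology (\<lambda>n. discrete_topology UNIV) UNIV) \<theta>"
      using orientation by (simp add: p_orientation_def padic_topology_def continuous_map_in_subtopology)
    then show ?thesis by (simp add: continuous_map_componentwise_UNIV)
  qed
  have "openin T {x \<in> topspace T. \<theta> x r \<in> {1 mod int p ^ r}}"
    by (rule openin_continuous_map_preimage[OF c]) simp
  then have op: "openin T (congruence_kernel r)" by (simp add: congruence_kernel_def)
  have "congruence_kernel r \<lhd> G"
  proof (rule normal_invI)
    have inv: "\<theta> x r * \<theta> (inv x) r mod int p ^ r = 1 mod int p ^ r" if "x \<in> carrier G" for x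
      using theta_mult[of x "inv x" r] that by (simp add: theta_one)
    show "subgroup (congruence_kernel r) G"
    proof (rule subgroupI)
      show "congruence_kernel r \<noteq> {}" by (auto simp: congruence_kernel_def theta_one intro!: exI[of _ "\<one>"])
      show "inv x \<in> congruence_kernel r" if "x \<in> congruence_kernel r" for x
        using inv[of x] that padic_nth_mod_self[OF theta_closed[of "inv x"], of r]
        by (simp add: congruence_kernel_def mod_mult_left_eq)
      show "x \<otimes> y \<in> congruence_kernel r" if "x \<in> congruence_kernel r" "y \<in> congruence_kernel r" for x y
        using that by (simp add: congruence_kernel_def theta_mult mod_mult_left_eq mod_mult_right_eq)
    qed (auto simp: congruence_kernel_def)
    fix x h assume xh: "x \<in> carrier G" "h \<in> congruence_kernel r"
    then have hc: "h \<in> carrier G" by (simp add: congruence_kernel_def)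
    have "\<theta> (x \<otimes> h \<otimes> inv x) r = \<theta> (inv x \<otimes> (x \<otimes> h)) r"
      using xh hc by (metis theta_comm inv_closed m_closed)
    also have "inv x \<otimes> (x \<otimes> h) = h" using xh hc by (simp add: m_assoc[symmetric])
    finally show "x \<otimes> h \<otimes> inv x \<in> congruence_kernel r" using xh hc by (simp add: congruence_kernel_def)
  qed
  with op show ?thesis by (simp add: open_normal_def)
qed

text \<open>The image of \<theta> modulo p is a p-group inside the units of F_p, which have order p
  - 1. Concretely, Fermat makes a residue equal to its \<open>p^m\<close>-th power, which is 1 for
  suitable \<open>m\<close>.\<close>

lemma theta_cong_1:
  assumes x: "x \<in> carrier G" and k: "1 \<le> k"
  shows "[\<theta> x k = 1] (mod int p)"
proof -
  define a where "a = nat (\<theta> x 1)"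
  have a: "int a = \<theta> x 1" using theta_closed[OF x] by (simp add: a_def padic_int_def)
  obtain m where "x [^] (p ^ m) \<in> congruence_kernel 1"
    using pow_in_open_normal[OF congruence_kernel_open_normal] x by blast
  then have "[\<theta> x 1 ^ (p ^ m) = 1] (mod int p)"
    using theta_pow[OF x, of "p ^ m" 1] by (simp add: congruence_kernel_def cong_def)
  then have 1: "[a ^ (p ^ m) = 1] (mod p)"
    by (metis a cong_int_iff of_nat_1 of_nat_power)
  have F: "[a ^ p = a] (mod p)" for a :: nat
  proof (cases "p dvd a")
    case True
    then show ?thesis using p_pos by (metis cong_0_iff cong_sym cong_trans dvd_power dvd_trans)
  next
    case False
    have "[a ^ (p - 1) * a = 1 * a] (mod p)"
      using fermat_theorem[OF prime False] by (intro cong_mult cong_refl)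
    moreover have "a ^ (p - 1) * a = a ^ p" using p_pos by (metis power_minus_mult)
    ultimately show ?thesis by simp
  qed
  have "[a ^ (p ^ j) = a] (mod p)" for j
  proof (induction j)
    case (Suc j)
    have "[(a ^ (p ^ j)) ^ p = a ^ (p ^ j)] (mod p)" by (rule F)
    then show ?case using Suc by (metis cong_trans power_Suc2 power_mult)
  qed simp
  then have "[a = 1] (mod p)" using 1 cong_sym cong_trans by blast
  then have "[\<theta> x 1 = 1] (mod int p)" using a by (metis cong_int_iff of_nat_1)
  moreover have "\<theta> x k mod int p = \<theta> x 1" using padic_nth_mod[OF theta_closed[OF x], of 1 k] k by simp
  ultimately show ?thesis by (metis cong_def mod_mod_trivial)
qed

text \<open>The image of \<theta> has no p-torsion. For p = 2 the condition modulo 4 is what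
  excludes -1.\<close>

lemma theta_power_p_eq_1:
  assumes x: "x \<in> carrier G" and "x [^] p \<in> Ker"
    and t4: "p = 2 \<Longrightarrow> \<theta> ` carrier G \<subseteq>
           {\<one>\<^bsub>padic_int 2\<^esub> \<oplus>\<^bsub>padic_int 2\<^esub> [(4::nat)] \<cdot>\<^bsub>padic_int 2\<^esub> z |z. z \<in> carrier (padic_int 2)}"
  shows "x \<in> Ker"
proof -
  have "\<theta> x r = 1 mod int p ^ r" for r
  proof -
    \<comment> \<open>Two extra levels: extracting the p-th root costs one, and for p = 2 the
      residue modulo 4 must be determined by the residue modulo \<open>2^(r+2)\<close> even when
      \<open>r = 0\<close>.\<close>
    let ?t = "\<theta> x (r + 2)"
    have 1: "[?t ^ p = 1] (mod int p ^ (r + 2))"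
      using assms(2) theta_pow[OF x, of p "r + 2"] by (simp add: Ker_iff cong_def)
    have 2: "[?t = 1] (mod int p)" using theta_cong_1[OF x] by simp
    have 3: "[?t = 1] (mod 4)" if p2: "p = 2"
    proof -
      obtain z where z: "\<theta> x = \<one>\<^bsub>padic_int 2\<^esub> \<oplus>\<^bsub>padic_int 2\<^esub> [(4::nat)] \<cdot>\<^bsub>padic_int 2\<^esub> z"
        using t4[OF p2] x by blast
      have "(4::int) dvd 2 ^ (r + 2)" by simp
      then show ?thesis
        unfolding z by (simp add: padic_nth_add padic_nth_nat_mult padic_nth_one cong_def mod_mod_cancel mod_simps)
    qed
    have "[?t = 1] (mod int p ^ (r + 1))"
      by (rule cong_1_if_power_p_cong_1[OF prime 2 3]) (use 1 in simp_all)
    then have "[?t = 1] (mod int p ^ r)" by (rule cong_dvd_modulus) simp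
    then show ?thesis using padic_nth_mod[OF theta_closed[OF x], of r "r + 2"] by (simp add: cong_def)
  qed
  then show ?thesis using x by (simp add: Ker_iff)
qed

end

section \<open>Closed abelian normal subgroups\<close>

context pro_p
begin

text \<open>Modulo \<open>N\<close> only the exponent modulo \<open>p^m\<close> matters, so the
  approximating sequence has reached its limit from index \<open>m\<close> on.\<close>

lemma padic_power_rcos:
  assumes N: "N \<in> open_normal" and m: "x [^] (p ^ m) \<in> N" and n: "m \<le> n"
    and x: "x \<in> carrier G" and z: "z \<in> carrier (padic_int p)"
  shows "N #> padic_power G T x z = N #> x [^] z n"
proof -
  have "eventually (\<lambda>k. N #> padic_power G T x z = N #> x [^] z n) sequentially"
    using padic_power_limit[OF x z N] eventually_ge_at_top[of m]
  proof eventually_elim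
    case (elim k)
    have "N #> x [^] z k = N #> x [^] z n"
      by (rule int_pow_rcos_cong[OF N m x]) (use padic_nth_mod[OF z] elim n in simp)
    with elim show ?case by simp
  qed
  then show ?thesis by simp
qed

lemma padic_power_mem_closed:
  assumes S: "closedin T S" "subgroup S G" and x: "x \<in> S" and z: "z \<in> carrier (padic_int p)"
  shows "padic_power G T x z \<in> S"
proof -
  have xc: "x \<in> carrier G" using subgroup.mem_carrier[OF S(2) x] .
  have "limitin T (\<lambda>n. x [^] z n) (padic_power G T x z) sequentially"
    by (rule limitin_if_rcos_eq[OF padic_power_closed[OF xc z] _ padic_power_limit[OF xc z]])
       (use xc in simp_all)
  then show ?thesis
    by (rule limitin_closedin[OF _ S(1)]) (use subgroup_int_pow_closed[OF S(2) x] in simp_all)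
qed

lemma rcos_eq_mono:
  assumes "N \<in> open_normal" "M \<in> open_normal" "N \<subseteq> M" "x \<in> carrier G" "y \<in> carrier G" "N #> x = N #> y"
  shows "M #> x = M #> y"
  using assms(3,6) rcos_eq_iff[OF open_normal_subgroup[OF assms(1)] assms(4,5)]
    rcos_eq_iff[OF open_normal_subgroup[OF assms(2)] assms(4,5)] by blast

text \<open>This stands for "if \<open>w = g^\<lambda>\<close> and \<lambda> = 0, then
  \<open>w = 1\<close>". The numbers \<open>l\<close> approximate \<lambda>; \<open>null\<close>
  says that they tend to 0 p-adically, and a multiple of a sufficiently large \<open>p^m\<close>
  kills \<open>g\<close> modulo any given \<open>M\<close>.\<close>

lemma eq_one_if_exponents_null:
  assumes g: "g \<in> carrier G" and w: "w \<in> carrier G"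
    and approx: "\<And>N. N \<in> open_normal \<Longrightarrow> \<exists>l::nat. N #> w = N #> g [^] l"
    and null: "\<And>k. \<exists>M\<in>open_normal. \<forall>N\<in>open_normal. \<forall>l. N \<subseteq> M \<and> N #> w = N #> g [^] l \<longrightarrow> p ^ k dvd l"
  shows "w = \<one>"
proof (rule eq_if_rcos_eq[OF w one_closed])
  fix M assume M: "M \<in> open_normal"
  obtain m where m: "\<And>x. x \<in> carrier G \<Longrightarrow> x [^] (p ^ m) \<in> M" using pow_in_open_normal[OF M] by blast
  obtain M' where M': "M' \<in> open_normal"
    "\<And>N l. N \<in> open_normal \<Longrightarrow> N \<subseteq> M' \<Longrightarrow> N #> w = N #> g [^] l \<Longrightarrow> p ^ m dvd l"
    using null[of m] by blast
  have N: "M \<inter> M' \<in> open_normal" using M M'(1) by (rule open_normal_Int)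
  obtain l where l: "(M \<inter> M') #> w = (M \<inter> M') #> g [^] (l::nat)" using approx[OF N] by blast
  have "p ^ m dvd l" using M'(2)[OF N _ l] by blast
  then obtain q where "l = q * p ^ m" by (metis dvd_def mult.commute)
  then have "g [^] l = (g [^] q) [^] (p ^ m)" using g by (simp add: nat_pow_pow)
  then have "g [^] l \<in> M" using m g by simp
  then have "M #> g [^] l = M #> \<one>" using rcos_eq_self_iff[OF open_normal_subgroup[OF M]] g by simp
  moreover have "M #> w = M #> g [^] l" using rcos_eq_mono[OF N M _ w _ l] g by simp
  ultimately show "M #> w = M #> \<one>" by simp
qed

end

section \<open>Conjugation on closed abelian normal subgroups\<close>

context oriented_pro_p
begin

lemma padic_power_Ker:
  assumes g: "g \<in> Ker" and x: "x \<in> carrier G"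
  shows "padic_power G T x (\<theta> g) = x"
proof (rule padic_power_eqI[OF x _ x])
  show "\<theta> g \<in> carrier (padic_int p)" using g by (simp add: Ker_iff theta_closed)
  fix N
  show "eventually (\<lambda>n. N #> x [^] \<theta> g n = N #> x) sequentially"
  proof (rule eventually_sequentiallyI)
    \<comment> \<open>At \<open>n = 0\<close> the residue of 1 is 0, so the powers are equal to
      \<open>x\<close> only from \<open>n = 1\<close> on.\<close>
    fix n :: nat assume "1 \<le> n"
    then have "\<theta> g n = 1" using g prime_gt_1_nat[OF prime] by (simp add: Ker_iff)
    then show "N #> x [^] \<theta> g n = N #> x" using x by simp
  qed
qed

text \<open>In each finite quotient \<open>w\<close> is a power of \<open>g\<close>. Otherwise an
  open subgroup \<open>U\<close> containing \<open>N\<close>, \<open>g\<close> and \<open>w\<close>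
  carries a homomorphism to F_p that is nonzero on \<open>w\<close>, and its crossed lift leads to a
  contradiction.\<close>

lemma rcos_conj_padic_power:
  assumes cyc: "cyclotomic p G T \<theta>" and A: "A \<in> closed_abelian_normal_in G T Ker"
    and z: "z \<in> A" and g: "g \<in> carrier G" and N: "N \<in> open_normal"
  shows "\<exists>l::nat. N #> (g \<otimes> z \<otimes> inv g \<otimes> inv (padic_power G T z (\<theta> g))) = N #> g [^] l"
proof (rule ccontr)
  assume no: "\<not> ?thesis"
  define w where "w = g \<otimes> z \<otimes> inv g \<otimes> inv (padic_power G T z (\<theta> g))"
  have An: "A \<lhd> G" and AK: "A \<subseteq> Ker" and ab: "comm_group (G\<lparr>carrier := A\<rparr>)"
    using A by (auto simp: closed_abelian_normal_in_def)
  have As: "subgroup A G" using An by (rule normal_imp_subgroup)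
  have Ac: "a \<in> carrier G" if "a \<in> A" for a using subgroup.mem_carrier[OF As that] .
  have comm: "a \<otimes> b = b \<otimes> a" if "a \<in> A" "b \<in> A" for a b
    using comm_groupE(4)[OF ab, of a b] that by simp
  have zc: "z \<in> carrier G" using Ac[OF z] .
  have wc: "w \<in> carrier G"
    unfolding w_def using g zc padic_power_closed[OF zc theta_closed[OF g]] by simp
  obtain m where m: "\<And>x. x \<in> carrier G \<Longrightarrow> x [^] (p ^ m) \<in> N" using pow_in_open_normal[OF N] by blast
  obtain e where e: "Coset.order (G Mod N) = p ^ e" using finite_quotient[OF N] .
  interpret N: normal N G using open_normal_normal[OF N] .
  interpret Q: group "G Mod N" by (rule N.factorgroup_is_group)
  have Qc: "N #> x \<in> carrier (G Mod N)" if "x \<in> carrier G" for x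
    using that by (simp add: carrier_FactGroup)
  define H where "H = generate (G Mod N) {N #> g}"
  have Hs: "subgroup H (G Mod N)"
    unfolding H_def by (rule Q.generate_is_subgroup) (use Qc[OF g] in simp)
  have gH: "N #> g \<in> H" unfolding H_def by (rule generate.incl) simp
  have wH: "N #> w \<notin> H"
  proof
    assume "N #> w \<in> H"
    then obtain k :: int where "N #> w = (N #> g) [^]\<^bsub>G Mod N\<^esub> k"
      using Q.generate_pow[OF Qc[OF g]] unfolding H_def by auto
    then have "N #> w = N #> g [^] k" using N.FactGroup_int_pow[OF g] by simp
    also have "\<dots> = N #> g [^] int (nat (k mod int p ^ m))"
      by (rule int_pow_rcos_cong[OF N m[OF g] g]) (use p_pos in simp)
    also have "\<dots> = N #> g [^] nat (k mod int p ^ m)" by (simp only: int_pow_int)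
    finally show False using no unfolding w_def by blast
  qed
  obtain U' f where U': "subgroup U' (G Mod N)" "H \<subseteq> U'" "N #> w \<in> U'"
    and fw: "\<not> int p dvd f (N #> w)"
    and f: "\<And>X Y. X \<in> U' \<Longrightarrow> Y \<in> U' \<Longrightarrow> [f (X \<otimes>\<^bsub>G Mod N\<^esub> Y) = f X + f Y] (mod int p)"
    using Q.finite_p_group_separating_hom[OF prime e Hs Qc[OF wc] wH] by metis
  define U where "U = {x \<in> carrier G. N #> x \<in> U'}"
  have U: "subgroup U G"
  proof (rule subgroupI)
    show "U \<noteq> {}" using gH U'(2) g by (auto simp: U_def)
    fix a assume a: "a \<in> U"
    then have "inv\<^bsub>G Mod N\<^esub> (N #> a) = N #> inv a"
      by (intro Q.inv_equality) (auto simp: U_def N.rcos_sum Qc coset_mult_one N.subset)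
    then show "inv a \<in> U" using a subgroup.m_inv_closed[OF U'(1), of "N #> a"] by (simp add: U_def)
    fix b assume b: "b \<in> U"
    show "a \<otimes> b \<in> U"
      using a b subgroup.m_closed[OF U'(1), of "N #> a" "N #> b"] by (simp add: U_def N.rcos_sum)
  qed (auto simp: U_def)
  have Uc: "x \<in> carrier G" if "x \<in> U" for x using that by (simp add: U_def)
  have NU: "N \<subseteq> U"
  proof
    fix x assume x: "x \<in> N"
    then have "N #> x = N #> \<one>" using rcos_eq_self_iff[OF N.subgroup_axioms] N.subset by blast
    then show "x \<in> U" using subgroup.one_closed[OF U] x N.subset by (auto simp: U_def)
  qed
  have Uo: "openin T U"
    by (rule open_subgroupI[OF U open_normal_open[OF N] N.one_closed NU])
  have gU: "g \<in> U" using gH U'(2) g by (auto simp: U_def)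
  define F where "F x = f (N #> x)" for x
  have F: "[F (x \<otimes> y) = F x + F y] (mod int p)" if "x \<in> U" "y \<in> U" for x y
    using f[of "N #> x" "N #> y"] that by (simp add: F_def U_def N.rcos_sum)
  have "continuous_map (subtopology T U) (discrete_topology UNIV) F"
    unfolding continuous_map_def
  proof (intro conjI allI impI)
    fix S
    have "{x \<in> topspace (subtopology T U). F x \<in> S} = \<Union> ((\<lambda>a. {y \<in> carrier G. N #> y = N #> a}) ` {x \<in> U. F x \<in> S})"
      using Uc by (auto simp: F_def U_def)
    moreover have "openin T \<dots>" using openin_rcos_eq[OF N] Uc by (intro openin_Union) auto
    ultimately have "openin T {x \<in> topspace (subtopology T U). F x \<in> S}" by (simp only:)
    then show "openin (subtopology T U) {x \<in> topspace (subtopology T U). F x \<in> S}"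
      unfolding openin_open_subtopology[OF Uo] by auto
  qed simp
  \<comment> \<open>Level \<open>m + 1\<close>, where \<open>p^m\<close> kills \<open>G/N\<close>:
    cancelling \<open>p^m\<close> at the end leaves exactly one factor p.\<close>
  then obtain c where
    c: "\<And>x y. x \<in> U \<Longrightarrow> y \<in> U \<Longrightarrow> [c (x \<otimes> y) = c x + \<theta> x (Suc m) * c y] (mod int p ^ Suc m)"
    and cF: "\<And>x. x \<in> U \<Longrightarrow> [c x = F x] (mod int p)"
    using cyclotomic_lift[OF prime is_group cyc U Uo, of "Suc m" F] theta_units[OF Uc] theta_cong_1[OF Uc] F
    by (metis le_add1 plus_1_eq_Suc)
  \<comment> \<open>\<open>B\<close> lies in the kernel of \<theta>, so the twist disappears for a
    first factor in \<open>B\<close>. In \<open>cB\<close> the second factor stays arbitrary in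
    \<open>U\<close> because it will be \<open>g\<close>.\<close>
  define B where "B = A \<inter> U"
  have Bs: "subgroup B G" unfolding B_def by (rule subgroups_Inter_pair[OF As U])
  have BU: "x \<in> U" if "x \<in> B" for x using that by (simp add: B_def)
  have Bp: "x [^] (k::nat) \<in> B" if "x \<in> B" for x k
    using subgroup_int_pow_closed[OF Bs that, of "int k"] by (simp only: int_pow_int)
  have cB: "[c (x \<otimes> y) = c x + c y] (mod int p ^ Suc m)" if "x \<in> B" "y \<in> U" for x y
  proof -
    have "\<theta> x (Suc m) = 1 mod int p ^ Suc m" using that AK Ker_iff by (auto simp: B_def)
    then have "[\<theta> x (Suc m) = 1] (mod int p ^ Suc m)" by (simp add: cong_def)
    then have "[c x + \<theta> x (Suc m) * c y = c x + 1 * c y] (mod int p ^ Suc m)"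
      by (intro cong_add cong_mult cong_refl)
    then show ?thesis using cong_trans[OF c[OF BU[OF that(1)] that(2)]] by simp
  qed
  have c1: "[c \<one> = 0] (mod int p ^ Suc m)"
    using cB[OF subgroup.one_closed[OF Bs] subgroup.one_closed[OF U]] by (simp add: cong_iff_dvd_diff)
  have cpow: "[c (x [^] (k::nat)) = int k * c x] (mod int p ^ Suc m)" if "x \<in> B" for x k
  proof (induction k)
    case 0
    show ?case using c1 by simp
  next
    case (Suc k)
    have "[c (x [^] Suc k) = c (x [^] k) + c x] (mod int p ^ Suc m)"
      using cB[OF Bp[OF that] BU[OF that]] by simp
    also have "[c (x [^] k) + c x = int k * c x + c x] (mod int p ^ Suc m)"
      by (intro cong_add Suc cong_refl)
    finally show ?case by (simp add: algebra_simps)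
  qed
  have cinv: "[c (inv x) = - c x] (mod int p ^ Suc m)" if "x \<in> B" for x
  proof -
    have "[c (x \<otimes> inv x) = c x + c (inv x)] (mod int p ^ Suc m)"
      using cB[OF that BU[OF subgroup.m_inv_closed[OF Bs that]]] .
    then have "[c x + c (inv x) = 0] (mod int p ^ Suc m)"
      using c1 Uc[OF BU[OF that]] cong_sym cong_trans by (metis r_inv)
    then show ?thesis by (simp add: cong_iff_dvd_diff add.commute)
  qed
  define t where "t = nat (\<theta> g (Suc m))"
  have t: "int t = \<theta> g (Suc m)" using theta_closed[OF g] by (simp add: t_def padic_int_def)
  \<comment> \<open>\<open>z\<close> may lie outside \<open>U\<close>, but its \<open>p^m\<close>-th
    power lies in \<open>N\<close>, where \<open>c\<close> can be evaluated.\<close>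
  define y where "y = z [^] (p ^ m)"
  have "y \<in> A" using subgroup_int_pow_closed[OF As z, of "int (p ^ m)"] by (simp only: y_def int_pow_int)
  moreover have "y \<in> U" unfolding y_def using m[OF zc] NU by blast
  ultimately have yB: "y \<in> B" by (simp add: B_def)
  have yc: "y \<in> carrier G" using Uc BU yB by blast
  define u where "u = g \<otimes> y \<otimes> inv g"
  have "u \<in> A" unfolding u_def using normal.inv_op_closed2[OF An g \<open>y \<in> A\<close>] .
  moreover have "u \<in> U" unfolding u_def
    by (rule subgroup.m_closed[OF U subgroup.m_closed[OF U gU \<open>y \<in> U\<close>] subgroup.m_inv_closed[OF U gU]])
  ultimately have uB: "u \<in> B" by (simp add: B_def)
  \<comment> \<open>Evaluate \<open>c\<close> on \<open>u g = g y\<close> in both ways; only the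
    product \<open>g y\<close> is twisted.\<close>
  have cu: "[c u = int t * c y] (mod int p ^ Suc m)"
  proof -
    have "u \<otimes> g = g \<otimes> y" using g yc by (simp add: u_def m_assoc)
    then have "[c u + c g = c g + int t * c y] (mod int p ^ Suc m)"
      using cB[OF uB gU] c[OF gU \<open>y \<in> U\<close>] t by (metis cong_sym cong_trans)
    then show ?thesis by (simp add: cong_iff_dvd_diff algebra_simps)
  qed
  \<comment> \<open>This is \<open>w\<close> with the p-adic exponent replaced by its residue
    \<open>t\<close>. The coset modulo \<open>N\<close> is unchanged, and the powers of
    \<open>v\<close> involve integer exponents only.\<close>
  define v where "v = g \<otimes> z \<otimes> inv g \<otimes> inv (z [^] t)"
  have gzA: "g \<otimes> z \<otimes> inv g \<in> A" using normal.inv_op_closed2[OF An g z] .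
  have ztA: "inv (z [^] t) \<in> A"
    using subgroup.m_inv_closed[OF As subgroup_int_pow_closed[OF As z, of "int t"]] by (simp only: int_pow_int)
  have vA: "v \<in> A" unfolding v_def using subgroup.m_closed[OF As gzA ztA] .
  have Nv: "N #> v = N #> w"
  proof -
    have "N #> padic_power G T z (\<theta> g) = N #> z [^] t"
      using padic_power_rcos[OF N m[OF zc] _ zc theta_closed[OF g], of "Suc m"]
      by (simp add: t[symmetric] int_pow_int)
    then show ?thesis unfolding v_def w_def
      using g zc padic_power_closed[OF zc theta_closed[OF g]]
      by (intro rcos_mult_cong[OF N.normal_axioms] rcos_inv_cong[OF N.normal_axioms]) simp_all
  qed
  have vU: "v \<in> U" using Nv U'(3) Ac[OF vA] by (simp add: U_def)
  have vB: "v \<in> B" using vA vU by (simp add: B_def)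
  \<comment> \<open>Commutativity of \<open>A\<close> splits the power of the product and brings in
    \<open>u\<close> and \<open>y\<close>, on which \<open>c\<close> is known.\<close>
  have "v [^] (p ^ m) = (g \<otimes> z \<otimes> inv g) [^] (p ^ m) \<otimes> (inv (z [^] t)) [^] (p ^ m)"
    unfolding v_def by (rule pow_mult_distrib[OF comm[OF gzA ztA] Ac[OF gzA] Ac[OF ztA]])
  also have "(g \<otimes> z \<otimes> inv g) [^] (p ^ m) = u" unfolding u_def y_def by (rule conj_nat_pow[OF g zc])
  also have "(inv (z [^] t)) [^] (p ^ m) = inv (y [^] t)"
    using zc by (simp add: nat_pow_inv[symmetric] nat_pow_pow y_def mult.commute)
  finally have vp: "v [^] (p ^ m) = u \<otimes> inv (y [^] t)" .
  have yt: "inv (y [^] t) \<in> B" using subgroup.m_inv_closed[OF Bs Bp[OF yB]] .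
  have "[int (p ^ m) * c v = c (v [^] (p ^ m))] (mod int p ^ Suc m)"
    using cong_sym[OF cpow[OF vB]] .
  also have "[c (v [^] (p ^ m)) = c u + c (inv (y [^] t))] (mod int p ^ Suc m)"
    unfolding vp by (rule cB[OF uB BU[OF yt]])
  also have "[c u + c (inv (y [^] t)) = int t * c y + - c (y [^] t)] (mod int p ^ Suc m)"
    by (rule cong_add[OF cu cinv[OF Bp[OF yB]]])
  also have "[int t * c y + - c (y [^] t) = int t * c y + - (int t * c y)] (mod int p ^ Suc m)"
    using cpow[OF yB, of t] by (intro cong_add cong_refl) (simp add: cong_minus_minus_iff)
  finally have "int p ^ m * int p dvd int p ^ m * c v" by (simp add: cong_iff_dvd_diff mult.commute)
  then have "int p dvd c v" using p_pos by simp
  then have "int p dvd F v" using cF[OF vU] cong_dvd_iff by blast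
  then show False using fw Nv by (simp add: F_def)
qed

text \<open>Both cases show that the exponents approximating \<open>w\<close> by powers of
  \<open>g\<close> are p-adically null. Outside \<open>Ker\<close> they are detected by \<theta>,
  whose image has no p-torsion; inside \<open>Ker\<close> they are detected by the powers of
  \<open>w\<close>, which is not torsion.\<close>

lemma conj_eq_padic_power:
  assumes cyc: "cyclotomic p G T \<theta>" and tf: "torsion_free_group G"
    and t4: "p = 2 \<Longrightarrow> \<theta> ` carrier G \<subseteq>
           {\<one>\<^bsub>padic_int 2\<^esub> \<oplus>\<^bsub>padic_int 2\<^esub> [(4::nat)] \<cdot>\<^bsub>padic_int 2\<^esub> z |z. z \<in> carrier (padic_int 2)}"
    and A: "A \<in> closed_abelian_normal_in G T Ker"
    and z: "z \<in> A" and g: "g \<in> carrier G"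
  shows "g \<otimes> z \<otimes> inv g = padic_power G T z (\<theta> g)"
proof -
  define w where "w = g \<otimes> z \<otimes> inv g \<otimes> inv (padic_power G T z (\<theta> g))"
  have An: "A \<lhd> G" and AK: "A \<subseteq> Ker" and ab: "comm_group (G\<lparr>carrier := A\<rparr>)" and Acl: "closedin T A"
    using A by (auto simp: closed_abelian_normal_in_def)
  have As: "subgroup A G" using An by (rule normal_imp_subgroup)
  have zc: "z \<in> carrier G" using subgroup.mem_carrier[OF As z] .
  have pc: "padic_power G T z (\<theta> g) \<in> carrier G" by (rule padic_power_closed[OF zc theta_closed[OF g]])
  have wA: "w \<in> A" unfolding w_def
    by (rule subgroup.m_closed[OF As normal.inv_op_closed2[OF An g z]
          subgroup.m_inv_closed[OF As padic_power_mem_closed[OF Acl As z theta_closed[OF g]]]])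
  have wc: "w \<in> carrier G" using subgroup.mem_carrier[OF As wA] .
  have approx: "\<exists>l::nat. N #> w = N #> g [^] l" if "N \<in> open_normal" for N
    unfolding w_def by (rule rcos_conj_padic_power[OF cyc A z g that])
  \<comment> \<open>Modulo every \<open>N\<close>, \<open>w\<close> is a power of
    \<open>g\<close>.\<close>
  have wg: "w \<otimes> g = g \<otimes> w"
  proof (rule eq_if_rcos_eq)
    fix N assume N: "N \<in> open_normal"
    obtain l where l: "N #> w = N #> g [^] (l::nat)" using approx[OF N] by blast
    have "N #> (w \<otimes> g) = N #> (g [^] l \<otimes> g)"
      using wc g l by (intro rcos_mult_cong[OF open_normal_normal[OF N]]) simp_all
    also have "g [^] l \<otimes> g = g \<otimes> g [^] l" using g nat_pow_Suc2 by (metis nat_pow_Suc)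
    also have "N #> (g \<otimes> g [^] l) = N #> (g \<otimes> w)"
      using wc g l by (intro rcos_mult_cong[OF open_normal_normal[OF N]]) simp_all
    finally show "N #> (w \<otimes> g) = N #> (g \<otimes> w)" .
  qed (use wc g in simp_all)
  have "w = \<one>"
  proof (cases "g \<in> Ker")
    case False
    have notK: "g [^] (p ^ k) \<notin> Ker" for k
    proof (induction k)
      case 0
      then show ?case using False g by simp
    next
      case (Suc k)
      have "g [^] (p ^ Suc k) = (g [^] (p ^ k)) [^] p" using g by (simp add: nat_pow_pow mult.commute)
      then show ?case using Suc theta_power_p_eq_1[OF _ _ t4, of "g [^] (p ^ k)"] g by auto
    qed
    show ?thesis
    proof (rule eq_one_if_exponents_null[OF g wc approx])
      fix k
      \<comment> \<open>At level \<open>r\<close> the value of \<theta> on \<open>g^(p^k)\<close>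
        differs from 1. As \<open>w\<close> is in \<open>Ker\<close>, an approximating
        \<open>g^l\<close> with \<open>N\<close> inside this congruence kernel is trivial at level
        \<open>r\<close>, which forces \<open>p^k\<close> to divide \<open>l\<close>.\<close>
      obtain r where r: "g [^] (p ^ k) \<notin> congruence_kernel r" using notK[of k] unfolding Ker_eq by blast
      let ?M = "congruence_kernel r"
      have M: "?M \<in> open_normal" by (rule congruence_kernel_open_normal)
      have Ms: "subgroup ?M G" by (rule open_normal_subgroup[OF M])
      show "\<exists>M\<in>open_normal. \<forall>N\<in>open_normal. \<forall>l. N \<subseteq> M \<and> N #> w = N #> g [^] l \<longrightarrow> p ^ k dvd l"
      proof (intro bexI[OF _ M] ballI allI impI)
        fix N l assume N: "N \<in> open_normal" and "N \<subseteq> ?M \<and> N #> w = N #> g [^] (l::nat)"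
        then have "?M #> w = ?M #> g [^] l" using rcos_eq_mono[OF N M _ wc] g by simp
        moreover have "w \<in> ?M" using wA AK unfolding Ker_eq by blast
        ultimately have gl: "g [^] l \<in> ?M"
          using rcos_eq_self_iff[OF Ms wc] rcos_eq_self_iff[OF Ms, of "g [^] l"] g by simp
        obtain m where "g [^] (p ^ m) \<in> ?M" using pow_in_open_normal[OF M] g by blast
        then show "p ^ k dvd l" using pow_mem_if_not_dvd[OF Ms prime g _ gl] r by blast
      qed
    qed
  next
    case True
    have w: "w = g \<otimes> z \<otimes> inv g \<otimes> inv z"
      by (simp add: w_def padic_power_Ker[OF True zc])
    have gz: "g \<otimes> z = w \<otimes> z \<otimes> g" unfolding w using g zc by (simp add: m_assoc)
    have wz: "w \<otimes> z = z \<otimes> w" using comm_groupE(4)[OF ab, of w z] wA z by simp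
    show ?thesis
    proof (rule ccontr)
      assume "w \<noteq> \<one>"
      have "w = \<one>"
      proof (rule eq_one_if_exponents_null[OF g wc approx])
        fix k
        \<comment> \<open>Torsion freeness provides an open normal subgroup that misses
          \<open>w^(p^k)\<close>; it plays the part that the congruence kernel has in the other
          case.\<close>
        have "w [^] (p ^ k) \<noteq> \<one>"
          using tf wc \<open>w \<noteq> \<one>\<close> p_pos unfolding torsion_free_group_def by (metis zero_less_power)
        then obtain M where M: "M \<in> open_normal" "w [^] (p ^ k) \<notin> M"
          using eq_if_rcos_eq[of "w [^] (p ^ k)" \<one>] rcos_eq_self_iff[OF open_normal_subgroup, of _ "w [^] (p ^ k)"] wc
          by auto
        show "\<exists>M\<in>open_normal. \<forall>N\<in>open_normal. \<forall>l. N \<subseteq> M \<and> N #> w = N #> g [^] l \<longrightarrow> p ^ k dvd l"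
        proof (intro bexI[OF _ M(1)] ballI allI impI)
          fix N l assume N: "N \<in> open_normal" and NM: "N \<subseteq> M \<and> N #> w = N #> g [^] (l::nat)"
          have Ns: "subgroup N G" by (rule open_normal_subgroup[OF N])
          have Nn: "N \<lhd> G" by (rule open_normal_normal[OF N])
          \<comment> \<open>Replace \<open>g^l\<close> by \<open>w\<close> modulo \<open>N\<close>
            in \<open>g^l z = w^l z g^l\<close>. As \<open>w\<close> and \<open>z\<close> commute,
            what remains is that \<open>w^l\<close> lies in \<open>N\<close>.\<close>
          have "N #> (z \<otimes> w) = N #> (w \<otimes> z)" by (simp add: wz)
          also have "\<dots> = N #> (g [^] l \<otimes> z)"
            using NM g wc zc by (intro rcos_mult_cong[OF Nn]) simp_all
          also have "g [^] l \<otimes> z = w [^] l \<otimes> z \<otimes> g [^] l" by (rule pow_mult_commutator[OF g zc wc gz wg])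
          also have "N #> \<dots> = N #> (w [^] l \<otimes> z \<otimes> w)"
            using NM g wc zc by (intro rcos_mult_cong[OF Nn]) simp_all
          finally have "(w [^] l \<otimes> z \<otimes> w) \<otimes> inv (z \<otimes> w) \<in> N"
            using rcos_eq_iff[OF Ns, of "w [^] l \<otimes> z \<otimes> w" "z \<otimes> w"] wc zc by simp
          moreover have "(w [^] l \<otimes> z \<otimes> w) \<otimes> inv (z \<otimes> w) = w [^] l \<otimes> ((z \<otimes> w) \<otimes> inv (z \<otimes> w))"
            using wc zc by (simp only: m_assoc m_closed inv_closed nat_pow_closed)
          ultimately have wl: "w [^] l \<in> N" using wc zc by simp
          obtain m where "w [^] (p ^ m) \<in> N" using pow_in_open_normal[OF N] wc by blast
          then show "p ^ k dvd l" using pow_mem_if_not_dvd[OF Ns prime wc _ wl] M(2) NM by blast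
        qed
      qed
      then show False using \<open>w \<noteq> \<one>\<close> by simp
    qed
  qed
  then show ?thesis
    unfolding w_def using inv_equality[of "g \<otimes> z \<otimes> inv g" "inv (padic_power G T z (\<theta> g))"] g zc pc by simp
qed

end

section \<open>Closed subgroups, the p-core and rules for p-adic powers\<close>

context profinite
begin

lemma closedin_open_normal:
  assumes N: "N \<in> open_normal" shows "closedin T N"
proof -
  have Ns: "subgroup N G" by (rule open_normal_subgroup[OF N])
  have "{y \<in> carrier G. N #> y = N #> \<one>} = N"
    using rcos_eq_self_iff[OF Ns] subgroup.subset[OF Ns] by blast
  then show ?thesis using closedin_rcos_eq[OF N one_closed] by simp
qed

lemma continuous_map_int_pow:
  assumes "continuous_map X T f" shows "continuous_map X T (\<lambda>x. f x [^] (k::int))"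
proof -
  have nat: "continuous_map X T (\<lambda>x. f x [^] (n::nat))" for n
    by (induction n) (simp_all add: continuous_map_mult assms)
  show ?thesis
    unfolding int_pow_def2 by (cases "k < 0") (simp_all only: if_True if_False nat continuous_map_inv)
qed

end

context pro_p
begin

text \<open>An open normal subgroup \<open>M\<close> of \<open>K\<close> contains
  \<open>N \<inter> K\<close> for some open normal \<open>N\<close> of \<open>G\<close>. So
  \<open>K/M\<close> is finite and killed by a power of p, which makes its order a power of
  p.\<close>

lemma closed_subgroup_pro_p:
  assumes cl: "closedin T K" and K: "subgroup K G"
  shows "pro_p_group p (G\<lparr>carrier := K\<rparr>) (subtopology T K)"
proof -
  let ?K = "G\<lparr>carrier := K\<rparr>" and ?S = "subtopology T K"
  have gK: "group ?K" by (rule subgroup.subgroup_is_group[OF K is_group])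
  have Kc: "K \<subseteq> carrier G" using subgroup.subset[OF K] .
  have tS: "topspace ?S = K" using Kc by (simp add: Int_absorb1)
  have sub: "continuous_map ?S T (\<lambda>x. x)" by (simp add: continuous_map_from_subtopology)
  have "continuous_map (prod_topology ?S ?S) ?S (\<lambda>(x, y). x \<otimes> y)"
  proof (rule continuous_map_into_subtopology)
    have fst: "continuous_map (prod_topology ?S ?S) T fst" and snd: "continuous_map (prod_topology ?S ?S) T snd"
      using continuous_map_compose[OF continuous_map_fst sub] continuous_map_compose[OF continuous_map_snd sub]
      by (simp_all add: o_def)
    show "continuous_map (prod_topology ?S ?S) T (\<lambda>(x, y). x \<otimes> y)"
      using continuous_map_mult[OF fst snd] by (simp add: case_prod_unfold)
    show "(\<lambda>(x, y). x \<otimes> y) \<in> topspace (prod_topology ?S ?S) \<rightarrow> K"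
      using subgroup.m_closed[OF K] tS by auto
  qed
  moreover have "continuous_map ?S ?S (\<lambda>x. inv\<^bsub>?K\<^esub> x)"
  proof (rule continuous_map_into_subtopology)
    show "continuous_map ?S T (\<lambda>x. inv\<^bsub>?K\<^esub> x)"
      by (rule continuous_map_eq[OF continuous_map_inv[OF sub]]) (use K tS m_inv_consistent in auto)
    show "(\<lambda>x. inv\<^bsub>?K\<^esub> x) \<in> topspace ?S \<rightarrow> K"
      using group.inv_closed[OF gK] tS by auto
  qed
  ultimately have "topological_group ?K ?S"
    using gK tS by (simp add: topological_group_def)
  moreover have "compact_space ?S"
    using closedin_compact_space[OF compact cl] by (simp add: compact_space_subtopology)
  moreover have "Hausdorff_space ?S" using Hausdorff by (rule Hausdorff_space_subtopology)
  moreover have "totally_disconnected_space ?S"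
    using profinite by (simp add: profinite_group_def totally_disconnected_space_def connectedin_subtopology)
  ultimately have prof: "profinite_group ?K ?S" by (simp add: profinite_group_def)
  have "\<exists>m. Coset.order (?K Mod M) = p ^ m" if Mn: "M \<lhd> ?K" and Mo: "openin ?S M" for M
  proof -
    interpret M: normal M ?K by (rule Mn)
    interpret Q: group "?K Mod M" by (rule M.factorgroup_is_group)
    obtain W where W: "openin T W" "M = W \<inter> K" using Mo by (auto simp: openin_subtopology)
    have "\<one> \<in> W" using subgroup.one_closed[OF M.subgroup_axioms] W(2) by simp
    then obtain N where N: "N \<in> open_normal" "N \<subseteq> W" using open_normal_neighbourhood[OF W(1)] by metis
    have Ns: "subgroup N G" by (rule open_normal_subgroup[OF N(1)])
    have NM: "x \<in> M" if "x \<in> N" "x \<in> K" for x using that N(2) W(2) by blast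
    obtain m where m: "\<And>x. x \<in> carrier G \<Longrightarrow> x [^] (p ^ m) \<in> N" using pow_in_open_normal[OF N(1)] by blast
    have carr: "carrier (?K Mod M) = (\<lambda>x. M #>\<^bsub>?K\<^esub> x) ` K" by (simp add: carrier_FactGroup)
    have eq: "M #>\<^bsub>?K\<^esub> x = M #>\<^bsub>?K\<^esub> y" if "x \<in> K" "y \<in> K" "N #> x = N #> y" for x y
    proof -
      have "x \<otimes> inv y \<in> N" using that rcos_eq_iff[OF Ns] Kc by auto
      then have "x \<otimes>\<^bsub>?K\<^esub> inv\<^bsub>?K\<^esub> y \<in> M"
        using that K NM by (simp add: m_inv_consistent subgroup.m_closed subgroup.m_inv_closed)
      then have "x \<in> M #>\<^bsub>?K\<^esub> y"
        using M.rcos_module_rev[OF gK, of y x] that by simp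
      then show ?thesis
        using group.repr_independence[OF gK _ _ M.subgroup_axioms, of x y] that by simp
    qed
    have "finite (carrier (G Mod N))"
    proof -
      obtain e where "Coset.order (G Mod N) = p ^ e" using finite_quotient[OF N(1)] .
      then show ?thesis using p_pos by (metis card.infinite order_def power_eq_0_iff less_numeral_extra(3))
    qed
    then have "finite ((\<lambda>x. N #> x) ` K)"
      by (rule rev_finite_subset) (use Kc in \<open>auto simp: carrier_FactGroup\<close>)
    \<comment> \<open>By \<open>eq\<close>, a coset of \<open>M\<close> in \<open>K\<close> depends
      only on the \<open>N\<close>-coset of a representative, so there are at most as many as there
      are \<open>N\<close>-cosets.\<close>
    moreover have "carrier (?K Mod M) \<subseteq> (\<lambda>C. M #>\<^bsub>?K\<^esub> (SOME y. y \<in> K \<and> N #> y = C)) ` ((\<lambda>x. N #> x) ` K)"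
    proof
      fix X assume "X \<in> carrier (?K Mod M)"
      then obtain x where x: "x \<in> K" "X = M #>\<^bsub>?K\<^esub> x" unfolding carr by blast
      let ?y = "SOME y. y \<in> K \<and> N #> y = N #> x"
      have "?y \<in> K \<and> N #> ?y = N #> x" by (rule someI[of _ x]) (use x in simp)
      then have "X = M #>\<^bsub>?K\<^esub> ?y" using eq[OF x(1), of ?y] x(2) by simp
      then show "X \<in> (\<lambda>C. M #>\<^bsub>?K\<^esub> (SOME y. y \<in> K \<and> N #> y = C)) ` ((\<lambda>x. N #> x) ` K)"
        using x(1) by (intro image_eqI[of _ _ "N #> x"]) simp_all
    qed
    ultimately have fin: "finite (carrier (?K Mod M))" using finite_surj by blast
    have "X [^]\<^bsub>?K Mod M\<^esub> (p ^ m :: nat) = \<one>\<^bsub>?K Mod M\<^esub>" if XM: "X \<in> carrier (?K Mod M)" for X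
    proof -
      obtain x where x: "x \<in> K" "X = M #>\<^bsub>?K\<^esub> x" using XM unfolding carr by blast
      have "x [^]\<^bsub>?K\<^esub> (p ^ m) = x [^] (p ^ m)" by (simp add: nat_pow_consistent[symmetric])
      moreover have "x [^]\<^bsub>?K\<^esub> (p ^ m) \<in> K"
        using monoid.nat_pow_closed[OF group.is_monoid[OF gK], of x] x(1) by simp
      moreover have "x [^] (p ^ m) \<in> N" using m x(1) Kc by blast
      ultimately have "x [^]\<^bsub>?K\<^esub> (p ^ m) \<in> M" using NM by simp
      then have "M #>\<^bsub>?K\<^esub> (x [^]\<^bsub>?K\<^esub> (p ^ m)) = M"
        using M.rcos_const[OF gK] by blast
      then show ?thesis using M.FactGroup_pow[of x "p ^ m"] x by simp
    qed
    then show ?thesis by (rule Q.order_prime_power_if_exponent[OF prime fin])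
  qed
  with prof show ?thesis by (simp add: pro_p_group_def)
qed

text \<open>Being pro-p itself, \<open>K\<close> is its own largest closed normal pro-p subgroup.
  For \<open>K = Ker\<close> this removes the p-core from the description of the
  \<theta>-center.\<close>

lemma p_core_closed_subgroup:
  assumes cl: "closedin T K" and K: "subgroup K G"
  shows "p_core p (G\<lparr>carrier := K\<rparr>) (subtopology T K) = K"
proof -
  let ?K = "G\<lparr>carrier := K\<rparr>" and ?S = "subtopology T K"
  interpret K: group ?K by (rule subgroup.subgroup_is_group[OF K is_group])
  have tS: "topspace ?S = K" using subgroup.subset[OF K] by (simp add: Int_absorb1)
  have top: "closed_normal_pro_p p ?K ?S K"
    unfolding closed_normal_pro_p_def
  proof (intro conjI)
    show "closedin ?S K" using closedin_topspace[of ?S] tS by simp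
    show "K \<lhd> ?K" by (rule K.normal_invI) (use K.subgroup_self subgroup.m_closed[OF K] K.inv_closed in auto)
    show "pro_p_group p (?K\<lparr>carrier := K\<rparr>) (subtopology ?S K)"
      using closed_subgroup_pro_p[OF cl K] by (simp add: subtopology_subtopology)
  qed
  have le: "M \<subseteq> K" if "closed_normal_pro_p p ?K ?S M" for M
    using that normal_imp_subgroup subgroup.subset unfolding closed_normal_pro_p_def by fastforce
  show ?thesis
    unfolding p_core_def by (rule the_equality) (use top le in blast)+
qed

lemma padic_power_mult:
  assumes x: "x \<in> carrier G" and y: "y \<in> carrier G" and z: "z \<in> carrier (padic_int p)"
    and comm: "x \<otimes> y = y \<otimes> x"
  shows "padic_power G T (x \<otimes> y) z = padic_power G T x z \<otimes> padic_power G T y z"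
proof (rule padic_power_eqI)
  fix N assume N: "N \<in> open_normal"
  show "eventually (\<lambda>n. N #> (x \<otimes> y) [^] z n = N #> (padic_power G T x z \<otimes> padic_power G T y z)) sequentially"
    using padic_power_limit[OF x z N] padic_power_limit[OF y z N]
  proof eventually_elim
    case (elim n)
    then have "N #> (x [^] z n \<otimes> y [^] z n) = N #> (padic_power G T x z \<otimes> padic_power G T y z)"
      by (intro rcos_mult_cong[OF open_normal_normal[OF N]]) (simp_all add: x y padic_power_closed z)
    then show ?case by (simp add: int_pow_mult_distrib[OF comm x y])
  qed
qed (simp_all add: x y z padic_power_closed)

lemma padic_power_inv:
  assumes x: "x \<in> carrier G" and z: "z \<in> carrier (padic_int p)"
  shows "padic_power G T (inv x) z = inv (padic_power G T x z)"
proof (rule padic_power_eqI)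
  fix N assume N: "N \<in> open_normal"
  show "eventually (\<lambda>n. N #> inv x [^] z n = N #> inv (padic_power G T x z)) sequentially"
    using padic_power_limit[OF x z N]
  proof eventually_elim
    case (elim n)
    then have "N #> inv (x [^] z n) = N #> inv (padic_power G T x z)"
      by (intro rcos_inv_cong[OF open_normal_normal[OF N]]) (simp_all add: x padic_power_closed z)
    then show ?case by (simp add: int_pow_inv x)
  qed
qed (simp_all add: x z padic_power_closed)

lemma padic_power_conj:
  assumes x: "x \<in> carrier G" and h: "h \<in> carrier G" and z: "z \<in> carrier (padic_int p)"
  shows "padic_power G T (h \<otimes> x \<otimes> inv h) z = h \<otimes> padic_power G T x z \<otimes> inv h"
proof (rule padic_power_eqI)
  fix N assume N: "N \<in> open_normal"
  have conj: "(h \<otimes> x \<otimes> inv h) [^] k = h \<otimes> x [^] k \<otimes> inv h" for k :: int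
  proof (cases k rule: int_cases2)
    case (nonneg n)
    then show ?thesis by (simp only: int_pow_int conj_nat_pow[OF h x])
  next
    case (nonpos n)
    have "(h \<otimes> x \<otimes> inv h) [^] k = inv (h \<otimes> x [^] n \<otimes> inv h)"
      using h x unfolding nonpos by (simp only: int_pow_neg_int conj_nat_pow m_closed inv_closed)
    also have "\<dots> = h \<otimes> inv (x [^] n) \<otimes> inv h"
      using h nat_pow_closed[OF x, of n] by (simp add: inv_mult_group m_assoc)
    finally show ?thesis using x unfolding nonpos by (simp only: int_pow_neg_int)
  qed
  show "eventually (\<lambda>n. N #> (h \<otimes> x \<otimes> inv h) [^] z n = N #> (h \<otimes> padic_power G T x z \<otimes> inv h)) sequentially"
    using padic_power_limit[OF x z N]
  proof eventually_elim
    case (elim n)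
    then show ?case unfolding conj
      by (intro rcos_mult_cong[OF open_normal_normal[OF N]]) (simp_all add: x h padic_power_closed z)
  qed
qed (simp_all add: x h z padic_power_closed)

end

section \<open>The \<theta>-center as a closed abelian normal subgroup\<close>

context oriented_pro_p
begin

lemma closedin_Ker: "closedin T Ker"
  unfolding Ker_eq by (rule closedin_Inter) (auto intro: closedin_open_normal congruence_kernel_open_normal)

lemma theta_center_eq:
  "theta_center p G T \<theta> = {x \<in> Ker. \<forall>g\<in>carrier G. g \<otimes> x \<otimes> inv g = padic_power G T x (\<theta> g)}"
  unfolding theta_center_def p_core_closed_subgroup[OF closedin_Ker normal_imp_subgroup[OF Ker_normal]] ..

lemma theta_center_closed_abelian_normal:
  "theta_center p G T \<theta> \<in> closed_abelian_normal_in G T Ker"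
proof -
  let ?Z = "theta_center p G T \<theta>"
  have Ks: "subgroup Ker G" by (rule normal_imp_subgroup[OF Ker_normal])
  have ZK: "?Z \<subseteq> Ker" by (auto simp: theta_center_eq)
  have Zc: "x \<in> carrier G" if "x \<in> ?Z" for x using that ZK Ker_iff by blast
  have Zg: "g \<otimes> x \<otimes> inv g = padic_power G T x (\<theta> g)" if "x \<in> ?Z" "g \<in> carrier G" for x g
    using that by (simp add: theta_center_eq)
  \<comment> \<open>\<open>x\<close> acts on \<open>y\<close> by the power \<theta>(x), and
    \<theta>(x) = 1 because \<open>x\<close> lies in \<open>Ker\<close>.\<close>
  have comm: "x \<otimes> y = y \<otimes> x" if "x \<in> ?Z" "y \<in> ?Z" for x y
  proof -
    have "x \<otimes> y \<otimes> inv x = y"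
      using Zg[OF that(2) Zc[OF that(1)]] padic_power_Ker[of x y] that ZK Zc by auto
    then show ?thesis using Zc[OF that(1)] Zc[OF that(2)] by (metis inv_solve_right' m_closed)
  qed
  have Zs: "subgroup ?Z G"
  proof (rule subgroupI)
    show "?Z \<subseteq> carrier G" using Zc by blast
    have "padic_power G T \<one> (\<theta> g) = \<one>" if "g \<in> carrier G" for g
      using that by (intro padic_power_eqI) (auto simp: theta_closed)
    then have "\<one> \<in> ?Z" using subgroup.one_closed[OF Ks] by (simp add: theta_center_eq)
    then show "?Z \<noteq> {}" by blast
    fix x assume x: "x \<in> ?Z"
    have "g \<otimes> inv x \<otimes> inv g = padic_power G T (inv x) (\<theta> g)" if g: "g \<in> carrier G" for g
    proof -
      have "g \<otimes> inv x \<otimes> inv g = inv (g \<otimes> x \<otimes> inv g)"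
        using g Zc[OF x] by (simp add: inv_mult_group m_assoc)
      then show ?thesis using Zg[OF x g] padic_power_inv[OF Zc[OF x] theta_closed[OF g]] by simp
    qed
    then show "inv x \<in> ?Z" using subgroup.m_inv_closed[OF Ks] x by (simp add: theta_center_eq)
    fix y assume y: "y \<in> ?Z"
    have "g \<otimes> (x \<otimes> y) \<otimes> inv g = padic_power G T (x \<otimes> y) (\<theta> g)" if g: "g \<in> carrier G" for g
    proof -
      have "g \<otimes> (x \<otimes> y) \<otimes> inv g = g \<otimes> x \<otimes> (inv g \<otimes> g) \<otimes> y \<otimes> inv g"
        using g Zc[OF x] Zc[OF y] by (simp add: m_assoc)
      also have "\<dots> = (g \<otimes> x \<otimes> inv g) \<otimes> (g \<otimes> y \<otimes> inv g)"
        using g Zc[OF x] Zc[OF y] by (simp only: m_assoc m_closed inv_closed)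
      finally show ?thesis
        using Zg[OF x g] Zg[OF y g] padic_power_mult[OF Zc[OF x] Zc[OF y] theta_closed[OF g] comm[OF x y]] by simp
    qed
    then show "x \<otimes> y \<in> ?Z" using subgroup.m_closed[OF Ks] x y by (simp add: theta_center_eq)
  qed
  have "?Z \<lhd> G"
  proof (rule normal_invI[OF Zs])
    fix h x assume h: "h \<in> carrier G" and x: "x \<in> ?Z"
    have xc: "x \<in> carrier G" by (rule Zc[OF x])
    have cc: "a \<otimes> (b \<otimes> x \<otimes> inv b) \<otimes> inv a = (a \<otimes> b) \<otimes> x \<otimes> inv (a \<otimes> b)"
      if "a \<in> carrier G" "b \<in> carrier G" for a b
      using that xc by (simp add: inv_mult_group m_assoc)
    have "g \<otimes> (h \<otimes> x \<otimes> inv h) \<otimes> inv g = padic_power G T (h \<otimes> x \<otimes> inv h) (\<theta> g)" if g: "g \<in> carrier G" for g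
    proof -
      \<comment> \<open>Normality rests on \<theta>(gh) = \<theta>(hg): both products conjugate
        \<open>x\<close> to the same power, so conjugation by \<open>g\<close> may be moved inside
        that by \<open>h\<close>.\<close>
      have "g \<otimes> (h \<otimes> x \<otimes> inv h) \<otimes> inv g = padic_power G T x (\<theta> (g \<otimes> h))"
        using Zg[OF x, of "g \<otimes> h"] g h by (simp add: cc)
      also have "\<dots> = h \<otimes> (g \<otimes> x \<otimes> inv g) \<otimes> inv h"
        using Zg[OF x, of "h \<otimes> g"] g h theta_comm[OF g h] by (simp add: cc)
      also have "\<dots> = padic_power G T (h \<otimes> x \<otimes> inv h) (\<theta> g)"
        using Zg[OF x g] padic_power_conj[OF xc h theta_closed[OF g]] by simp
      finally show ?thesis .
    qed
    then show "h \<otimes> x \<otimes> inv h \<in> ?Z"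
      using normal.inv_op_closed2[OF Ker_normal h] x ZK by (auto simp: theta_center_eq)
  qed
  moreover have "comm_group (G\<lparr>carrier := ?Z\<rparr>)"
    by (rule group.group_comm_groupI[OF subgroup.subgroup_is_group[OF Zs is_group]]) (simp add: comm)
  moreover have "closedin T ?Z"
  proof -
    obtain m where m: "\<And>N x. N \<in> open_normal \<Longrightarrow> x \<in> carrier G \<Longrightarrow> x [^] (p ^ m N) \<in> N"
      using pow_in_open_normal by metis
    \<comment> \<open>Modulo \<open>N\<close> the p-adic power equals an integer power with an
      exponent independent of \<open>x\<close>. Each condition therefore says that a continuous map
      sends \<open>x\<close> into the closed set \<open>N\<close>, and the center is an intersection
      of closed sets.\<close>
    define D where "D g N = {x \<in> topspace T. g \<otimes> x \<otimes> inv g \<otimes> inv (x [^] \<theta> g (m N)) \<in> N}" for g N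
    have "closedin T (D g N)" if "g \<in> carrier G" "N \<in> open_normal" for g N
      unfolding D_def
      by (intro closedin_continuous_map_preimage[where Y = T] continuous_map_mult continuous_map_inv
          continuous_map_int_pow closedin_open_normal that(2)) (use that(1) in simp_all)
    then have "closedin T (Ker \<inter> \<Inter> (case_prod D ` (carrier G \<times> open_normal)))"
      using carrier_open_normal by (intro closedin_Int closedin_Ker closedin_Inter) auto
    moreover have "?Z = Ker \<inter> \<Inter> (case_prod D ` (carrier G \<times> open_normal))"
    proof -
      have "g \<otimes> x \<otimes> inv g = padic_power G T x (\<theta> g) \<longleftrightarrow> (\<forall>N\<in>open_normal. x \<in> D g N)"
        if x: "x \<in> carrier G" and g: "g \<in> carrier G" for x g
      proof -
        have tg: "\<theta> g \<in> carrier (padic_int p)" by (rule theta_closed[OF g])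
        have D: "x \<in> D g N \<longleftrightarrow> N #> (g \<otimes> x \<otimes> inv g) = N #> padic_power G T x (\<theta> g)" if N: "N \<in> open_normal" for N
          using rcos_eq_iff[OF open_normal_subgroup[OF N], of "g \<otimes> x \<otimes> inv g" "x [^] \<theta> g (m N)"] x g
            padic_power_rcos[OF N m[OF N x] order_refl x tg]
          by (simp add: D_def)
        show ?thesis
          using eq_if_rcos_eq[of "g \<otimes> x \<otimes> inv g" "padic_power G T x (\<theta> g)"] padic_power_closed[OF x tg] x g D by auto
      qed
      then show ?thesis by (auto simp: theta_center_eq Ker_iff)
    qed
    ultimately show ?thesis by simp
  qed
  ultimately show ?thesis using ZK by (simp add: closed_abelian_normal_in_def)
qed

end

theorem theorem7p7:
  fixes p :: nat and G :: "('a, 'b) monoid_scheme" and T :: "'a topology"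
    and \<theta> :: "'a \<Rightarrow> nat \<Rightarrow> int"
  assumes "prime p"
    and "pro_p_group p G T"
    and "torsion_free_group G"
    and "p_orientation p G T \<theta>"
    and "cyclotomic p G T \<theta>"
    and "bloch_kato p G T \<theta>"
    and "p = 2 \<Longrightarrow> \<theta> ` carrier G \<subseteq>
           {\<one>\<^bsub>padic_int 2\<^esub> \<oplus>\<^bsub>padic_int 2\<^esub> [(4::nat)] \<cdot>\<^bsub>padic_int 2\<^esub> z |z. z \<in> carrier (padic_int 2)}"
  shows "{A \<in> closed_abelian_normal_in G T (Coset.kernel G (padic_units p) \<theta>).
            \<forall>B \<in> closed_abelian_normal_in G T (Coset.kernel G (padic_units p) \<theta>). A \<subseteq> B \<longrightarrow> B = A}
         = {theta_center p G T \<theta>}"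
proof -
  have "profinite_group G T" using assms(2) by (simp add: pro_p_group_def)
  then have "group G" by (simp add: profinite_group_def topological_group_def)
  interpret oriented_pro_p G T p \<theta>
    using assms \<open>profinite_group G T\<close> \<open>group G\<close>
    by (simp add: oriented_pro_p_def oriented_pro_p_axioms_def pro_p_def pro_p_axioms_def profinite_def profinite_axioms_def)
  \<comment> \<open>The \<theta>-center is a member of the family and contains every other member; a
    greatest element is the only maximal one.\<close>
  have "A \<subseteq> theta_center p G T \<theta>" if A: "A \<in> closed_abelian_normal_in G T Ker" for A
  proof
    fix z assume z: "z \<in> A"
    then have "z \<in> Ker" using A by (auto simp: closed_abelian_normal_in_def)
    then show "z \<in> theta_center p G T \<theta>"
      using conj_eq_padic_power[OF assms(5,3,7) A z] by (simp add: theta_center_eq)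
  qed
  with theta_center_closed_abelian_normal show ?thesis by blast
qed

end
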